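(* Let $\mathcal{A}$ be a properly infinite von Neumann algebra acting on a Hilbert space $H$ and let $T\in\mathcal{A}$ be an $\mathcal{A}$-Fredholm operator. Suppose that $\operatorname{Im}T^n$ is closed for all $n\ge 1$ and that $$T\Big(\bigcap_{n=1}^{\infty}\operatorname{Im}T^n\Big)=\bigcap_{n=1}^{\infty}\operatorname{Im}T^n .$$ Then there exist $\epsilon>0$ and a fixed closed subspace $N_1$ of $H$ with $P_{N_1}\in\mathrm{Proj}_0(\mathcal{A})$ such that for every $\lambda\in\mathbb{C}$ with $0<|\lambda|<\epsilon$, $$\dim\ker T=\dim\ker(T-\lambda I)+\dim N_1\quad\text{and}\quad \dim(\operatorname{Im}T)^{\perp}=\dim(\operatorname{Im}(T-\lambda I))^{\perp}+\dim N_1$$ in $I(\mathcal{A})$.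
   Context: $P_L$ denotes the orthogonal projection onto a closed subspace $L$. $\mathrm{Proj}_0(\mathcal{A})$ is the set of finite projections of $\mathcal{A}$ (projections not Murray-von Neumann equivalent to any proper subprojection). $T\in\mathcal{A}$ is $\mathcal{A}$-Fredholm if (i) $P_{\ker T}\in\mathrm{Proj}_0(\mathcal{A})$, and (ii) there is $E\in\mathrm{Proj}_0(\mathcal{A})$ such that $\operatorname{Im}(I-E)\subseteq\operatorname{Im}T$. The index group $I(\mathcal{A})$ is the Grothendieck group of the commutative monoid of all (unitary equivalence classes of) representations of the commutant $\mathcal{A}'$ generated, under direct sum, by the representations $\pi_E:\mathcal{A}'\ni S\mapsto ES$ (on $E(H)$), $E\in\mathrm{Proj}_0(\mathcal{A})$. For a closed subspace $L$ with $P_L\in\mathrm{Proj}_0(\mathcal{A})$, its dimension is $\dim L=[\pi_{P_L}]\in I(\mathcal{A})$. (Part of the conclusion is that the subspaces occurring have projections in $\mathrm{Proj}_0(\mathcal{A})$, so that these dimensions are defined.) *)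

theory Defs
  imports "HOL-Analysis.Analysis" "HOL-Algebra.Group"
begin

text \<open>Complex Hilbert spaces. The inner product is antilinear in its first argument; its real part
  is the real inner product of the superclass, from which norm and topology come.\<close>

class chilbert_space = real_inner + banach +
  fixes scaleC :: "complex \<Rightarrow> 'a \<Rightarrow> 'a"  (infixr "*\<^sub>C" 75)
    and cinner :: "'a \<Rightarrow> 'a \<Rightarrow> complex"
  assumes scaleC_add_right: "c *\<^sub>C (x + y) = c *\<^sub>C x + c *\<^sub>C y"
    and scaleC_add_left: "(c + d) *\<^sub>C x = c *\<^sub>C x + d *\<^sub>C x"
    and scaleC_scaleC: "c *\<^sub>C (d *\<^sub>C x) = (c * d) *\<^sub>C x"
    and scaleC_of_real: "complex_of_real r *\<^sub>C x = r *\<^sub>R x"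
    and cinner_commute: "cinner x y = cnj (cinner y x)"
    and cinner_add_right: "cinner x (y + z) = cinner x y + cinner x z"
    and cinner_scaleC_right: "cinner x (c *\<^sub>C y) = c * cinner x y"
    and inner_eq_Re_cinner: "inner x y = Re (cinner x y)"

definition bounded_clinear :: "('a::chilbert_space \<Rightarrow> 'a) \<Rightarrow> bool" where
  "bounded_clinear T \<longleftrightarrow> bounded_linear T \<and> (\<forall>c x. T (c *\<^sub>C x) = c *\<^sub>C T x)"

definition is_adjoint :: "('a::chilbert_space \<Rightarrow> 'a) \<Rightarrow> ('a \<Rightarrow> 'a) \<Rightarrow> bool" where
  "is_adjoint S T \<longleftrightarrow> (\<forall>x y. cinner (S x) y = cinner x (T y))"

definition closed_csubspace :: "'a::chilbert_space set \<Rightarrow> bool" where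
  "closed_csubspace L \<longleftrightarrow> closed L \<and> 0 \<in> L \<and> (\<forall>x\<in>L. \<forall>y\<in>L. x + y \<in> L) \<and> (\<forall>c. \<forall>x\<in>L. c *\<^sub>C x \<in> L)"

definition orth_compl :: "'a::chilbert_space set \<Rightarrow> 'a set" where
  "orth_compl S = {x. \<forall>y\<in>S. cinner y x = 0}"

definition ker :: "('a::chilbert_space \<Rightarrow> 'a) \<Rightarrow> 'a set" where
  "ker T = {x. T x = 0}"

text \<open>Only meaningful when \<open>L\<close> is a closed complex subspace.\<close>

definition cproj :: "'a::chilbert_space set \<Rightarrow> 'a \<Rightarrow> 'a" where
  "cproj L x = (THE y. y \<in> L \<and> x - y \<in> orth_compl L)"

definition commutant :: "('a::chilbert_space \<Rightarrow> 'a) set \<Rightarrow> ('a \<Rightarrow> 'a) set" where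
  "commutant A = {S. bounded_clinear S \<and> (\<forall>T\<in>A. S \<circ> T = T \<circ> S)}"

definition von_neumann_algebra :: "('a::chilbert_space \<Rightarrow> 'a) set \<Rightarrow> bool" where
  "von_neumann_algebra A \<longleftrightarrow>
     (\<forall>T\<in>A. bounded_clinear T) \<and>
     (\<lambda>x. x) \<in> A \<and>
     (\<forall>S\<in>A. \<forall>T\<in>A. (\<lambda>x. S x + T x) \<in> A) \<and>
     (\<forall>c. \<forall>T\<in>A. (\<lambda>x. c *\<^sub>C T x) \<in> A) \<and>
     (\<forall>S\<in>A. \<forall>T\<in>A. S \<circ> T \<in> A) \<and>
     (\<forall>T\<in>A. \<exists>S\<in>A. is_adjoint S T) \<and>
     commutant (commutant A) = A"

definition projections :: "('a::chilbert_space \<Rightarrow> 'a) set \<Rightarrow> ('a \<Rightarrow> 'a) set" where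
  "projections A = {E \<in> A. bounded_clinear E \<and> E \<circ> E = E \<and> is_adjoint E E}"

definition mvn_equivalent ::
  "('a::chilbert_space \<Rightarrow> 'a) set \<Rightarrow> ('a \<Rightarrow> 'a) \<Rightarrow> ('a \<Rightarrow> 'a) \<Rightarrow> bool" where
  "mvn_equivalent A E F \<longleftrightarrow> (\<exists>V\<in>A. \<exists>W\<in>A. is_adjoint W V \<and> W \<circ> V = E \<and> V \<circ> W = F)"

definition Proj0 :: "('a::chilbert_space \<Rightarrow> 'a) set \<Rightarrow> ('a \<Rightarrow> 'a) set" where
  "Proj0 A = {E \<in> projections A.
     \<not> (\<exists>F\<in>projections A. range F \<subset> range E \<and> mvn_equivalent A E F)}"

definition properly_infinite :: "('a::chilbert_space \<Rightarrow> 'a) set \<Rightarrow> bool" where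
  "properly_infinite A \<longleftrightarrow>
     (\<forall>E \<in> projections A \<inter> commutant A. E \<noteq> (\<lambda>x. 0) \<longrightarrow> E \<notin> Proj0 A)"

definition fredholm :: "('a::chilbert_space \<Rightarrow> 'a) set \<Rightarrow> ('a \<Rightarrow> 'a) \<Rightarrow> bool" where
  "fredholm A T \<longleftrightarrow> T \<in> A \<and> cproj (ker T) \<in> Proj0 A \<and>
     (\<exists>E\<in>Proj0 A. range (\<lambda>x. x - E x) \<subseteq> range T)"

text \<open>
  Representations of the commutant. The finite direct sums of subspaces \<open>E(H)\<close> are all realised
  inside the finitely supported sequences in \<open>H\<close>, with the \<open>\<ell>\<^sup>2\<close> inner product: \<open>E(H)\<close> itself sits in
  position \<open>0\<close>, and a direct sum puts its summands on the even and on the odd positions.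
  Only the values of \<open>rep_act\<close> on operators of the commutant and on vectors of \<open>rep_space\<close> matter.
\<close>

record 'a rep =
  rep_space :: "(nat \<Rightarrow> 'a) set"
  rep_act :: "('a \<Rightarrow> 'a) \<Rightarrow> (nat \<Rightarrow> 'a) \<Rightarrow> (nat \<Rightarrow> 'a)"

definition seq_cinner :: "(nat \<Rightarrow> 'a::chilbert_space) \<Rightarrow> (nat \<Rightarrow> 'a) \<Rightarrow> complex" where
  "seq_cinner f g = (\<Sum>i | f i \<noteq> 0. cinner (f i) (g i))"

definition proj_rep :: "('a::chilbert_space \<Rightarrow> 'a) \<Rightarrow> 'a rep" where
  "proj_rep E = \<lparr>
     rep_space = {f. f 0 \<in> range E \<and> (\<forall>i>0. f i = 0)},
     rep_act = (\<lambda>S f i. if i = 0 then E (S (f 0)) else 0)\<rparr>"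

definition evens :: "(nat \<Rightarrow> 'a) \<Rightarrow> nat \<Rightarrow> 'a" where
  "evens f i = f (2 * i)"

definition odds :: "(nat \<Rightarrow> 'a) \<Rightarrow> nat \<Rightarrow> 'a" where
  "odds f i = f (2 * i + 1)"

definition rep_sum :: "'a rep \<Rightarrow> 'a rep \<Rightarrow> 'a rep" where
  "rep_sum \<rho> \<sigma> = \<lparr>
     rep_space = {f. evens f \<in> rep_space \<rho> \<and> odds f \<in> rep_space \<sigma>},
     rep_act = (\<lambda>S f i. if even i then rep_act \<rho> S (evens f) (i div 2)
                         else rep_act \<sigma> S (odds f) (i div 2))\<rparr>"

definition unitarily_equivalent ::
  "('a::chilbert_space \<Rightarrow> 'a) set \<Rightarrow> 'a rep \<Rightarrow> 'a rep \<Rightarrow> bool" where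
  "unitarily_equivalent B \<rho> \<sigma> \<longleftrightarrow> (\<exists>U.
     bij_betw U (rep_space \<rho>) (rep_space \<sigma>) \<and>
     (\<forall>f\<in>rep_space \<rho>. \<forall>g\<in>rep_space \<rho>. U (\<lambda>i. f i + g i) = (\<lambda>i. U f i + U g i)) \<and>
     (\<forall>c. \<forall>f\<in>rep_space \<rho>. U (\<lambda>i. c *\<^sub>C f i) = (\<lambda>i. c *\<^sub>C U f i)) \<and>
     (\<forall>f\<in>rep_space \<rho>. \<forall>g\<in>rep_space \<rho>. seq_cinner (U f) (U g) = seq_cinner f g) \<and>
     (\<forall>S\<in>B. \<forall>f\<in>rep_space \<rho>. U (rep_act \<rho> S f) = rep_act \<sigma> S (U f)))"

inductive_set generated_reps :: "('a::chilbert_space \<Rightarrow> 'a) set \<Rightarrow> 'a rep set"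
  for A where
  proj: "E \<in> Proj0 A \<Longrightarrow> proj_rep E \<in> generated_reps A"
| sum: "\<rho> \<in> generated_reps A \<Longrightarrow> \<sigma> \<in> generated_reps A \<Longrightarrow> rep_sum \<rho> \<sigma> \<in> generated_reps A"

definition rep_rel :: "('a::chilbert_space \<Rightarrow> 'a) set \<Rightarrow> ('a rep \<times> 'a rep) set" where
  "rep_rel A = {(\<rho>, \<sigma>). \<rho> \<in> generated_reps A \<and> \<sigma> \<in> generated_reps A \<and>
     unitarily_equivalent (commutant A) \<rho> \<sigma>}"

text \<open>The neutral element is the class of the representation on \<open>{0}\<close>, i.e. of \<open>\<pi>\<^sub>0\<close>.\<close>

definition rep_monoid :: "('a::chilbert_space \<Rightarrow> 'a) set \<Rightarrow> 'a rep set monoid" where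
  "rep_monoid A = \<lparr>
     carrier = generated_reps A // rep_rel A,
     mult = (\<lambda>X Y. rep_rel A `` {rep_sum \<rho> \<sigma> | \<rho> \<sigma>. \<rho> \<in> X \<and> \<sigma> \<in> Y}),
     one = rep_rel A `` {proj_rep (\<lambda>x. 0)}\<rparr>"

definition groth_rel :: "('m, 'r) monoid_scheme \<Rightarrow> (('m \<times> 'm) \<times> ('m \<times> 'm)) set" where
  "groth_rel M = {((a, b), (c, d)).
     a \<in> carrier M \<and> b \<in> carrier M \<and> c \<in> carrier M \<and> d \<in> carrier M \<and>
     (\<exists>k\<in>carrier M. a \<otimes>\<^bsub>M\<^esub> d \<otimes>\<^bsub>M\<^esub> k = c \<otimes>\<^bsub>M\<^esub> b \<otimes>\<^bsub>M\<^esub> k)}"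

text \<open>The class of \<open>(a, b)\<close> stands for the formal difference of \<open>a\<close> and \<open>b\<close>.\<close>

definition grothendieck_group :: "('m, 'r) monoid_scheme \<Rightarrow> ('m \<times> 'm) set monoid" where
  "grothendieck_group M = \<lparr>
     carrier = (carrier M \<times> carrier M) // groth_rel M,
     mult = (\<lambda>X Y. groth_rel M `` {(a \<otimes>\<^bsub>M\<^esub> c, b \<otimes>\<^bsub>M\<^esub> d) | a b c d. (a, b) \<in> X \<and> (c, d) \<in> Y}),
     one = groth_rel M `` {(\<one>\<^bsub>M\<^esub>, \<one>\<^bsub>M\<^esub>)}\<rparr>"

definition index_group ::
  "('a::chilbert_space \<Rightarrow> 'a) set \<Rightarrow> ('a rep set \<times> 'a rep set) set monoid" where
  "index_group A = grothendieck_group (rep_monoid A)"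

text \<open>Only meaningful when \<open>L\<close> is a closed subspace with \<open>cproj L \<in> Proj0 A\<close>.\<close>

definition subspace_dim ::
  "('a::chilbert_space \<Rightarrow> 'a) set \<Rightarrow> 'a set \<Rightarrow> ('a rep set \<times> 'a rep set) set" where
  "subspace_dim A L =
     groth_rel (rep_monoid A) `` {(rep_rel A `` {proj_rep (cproj L)}, \<one>\<^bsub>rep_monoid A\<^esub>)}"

end

theory Submission imports Defs begin

text \<open>
  Let \<open>M\<close> be the intersection of the ranges of the powers of \<open>T\<close>, let \<open>K\<close> be the kernel and \<open>C\<close> the
  cokernel of \<open>T\<close>, and let \<open>N\<^sub>1\<close> be the orthogonal complement of \<open>K \<inter> M\<close> in \<open>K\<close>. Every eigenvector of
  \<open>T\<close> for \<open>\<mu> \<noteq> 0\<close> lies in \<open>M\<close>, and \<open>T\<close> maps \<open>M\<close> onto itself, so for small \<open>\<mu>\<close> the kernel of \<open>T - \<mu>\<close> is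
  Murray-von Neumann equivalent to \<open>K \<inter> M\<close>; this gives the first equation.

  For the second one, let \<open>G\<close> be the Moore-Penrose inverse of \<open>T\<close> and \<open>Z = (1 - \<mu> G)\<^sup>-\<^sup>1\<close>. With \<open>Q\<close> the
  projection onto \<open>C\<close> we have \<open>(T - \<mu>) Z = T - \<mu> Q Z\<close>, hence \<open>Z\<close> maps the kernel of \<open>D = Q Z P\<^sub>K\<close> in \<open>K\<close>
  onto the kernel of \<open>T - \<mu>\<close>; dually, the adjoint of \<open>Z\<close> maps the kernel of the adjoint of \<open>D\<close> in \<open>C\<close>
  onto the cokernel of \<open>T - \<mu>\<close>. By polar decomposition the complements of these kernels in \<open>K\<close> and \<open>C\<close>
  are equivalent; call their class \<open>r\<close>. So \<open>[K] = r + a'\<close> and \<open>[C] = r + b'\<close>, where \<open>a'\<close>, \<open>b'\<close> are the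
  classes of the kernel and cokernel of \<open>T - \<mu>\<close>; with \<open>[K] = a' + [N\<^sub>1]\<close> this yields
  \<open>[C] + a' = b' + [N\<^sub>1] + a'\<close>. Only subprojections and equivalent copies of finite projections occur, so
  the finiteness of sums of finite projections is never needed.
\<close>

section \<open>Complex Hilbert spaces\<close>

lemma scaleC_one [simp]: "1 *\<^sub>C (x::'a::chilbert_space) = x"
  using scaleC_of_real[of 1 x] by simp

lemma scaleC_zero_left [simp]: "0 *\<^sub>C (x::'a::chilbert_space) = 0"
  using scaleC_of_real[of 0 x] by simp

lemma scaleC_zero_right [simp]: "c *\<^sub>C (0::'a::chilbert_space) = 0"
  using scaleC_add_right[of c "0::'a" 0] by simp

lemma scaleC_minus_right: "c *\<^sub>C (- x::'a::chilbert_space) = - (c *\<^sub>C x)"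
  using scaleC_add_right[of c x "- x"] by (simp add: eq_neg_iff_add_eq_0 add.commute)

lemma scaleC_diff_right: "c *\<^sub>C (x - y::'a::chilbert_space) = c *\<^sub>C x - c *\<^sub>C y"
  using scaleC_add_right[of c x "- y"] by (simp add: scaleC_minus_right)

lemma scaleC_minus_left: "(- c) *\<^sub>C (x::'a::chilbert_space) = - (c *\<^sub>C x)"
  using scaleC_add_left[of c "- c" x] by (simp add: eq_neg_iff_add_eq_0 add.commute)

lemma scaleC_eq_0_iff [simp]: "c *\<^sub>C (x::'a::chilbert_space) = 0 \<longleftrightarrow> c = 0 \<or> x = 0"
proof
  assume *: "c *\<^sub>C x = 0"
  show "c = 0 \<or> x = 0"
  proof (rule ccontr)
    assume "\<not> (c = 0 \<or> x = 0)"
    then have "x = (1/c) *\<^sub>C (c *\<^sub>C x)" "x \<noteq> 0" by (simp_all add: scaleC_scaleC)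
    then show False using * by simp
  qed
qed auto

lemma cinner_add_left: "cinner (x + y) (z::'a::chilbert_space) = cinner x z + cinner y z"
  by (metis cinner_add_right cinner_commute complex_cnj_add)

lemma cinner_scaleC_left: "cinner (c *\<^sub>C x) (y::'a::chilbert_space) = cnj c * cinner x y"
  by (metis cinner_scaleC_right cinner_commute complex_cnj_mult)

lemma cinner_self: "cinner x (x::'a::chilbert_space) = complex_of_real ((norm x)\<^sup>2)"
proof (rule complex_eqI)
  show "Re (cinner x x) = Re (complex_of_real ((norm x)\<^sup>2))"
    by (simp add: inner_eq_Re_cinner[symmetric] power2_norm_eq_inner)
  show "Im (cinner x x) = Im (complex_of_real ((norm x)\<^sup>2))"
    using arg_cong[OF cinner_commute[of x x], of Im] by simp
qed

lemma norm_scaleC: "norm (c *\<^sub>C (x::'a::chilbert_space)) = cmod c * norm x"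
proof -
  have "complex_of_real ((norm (c *\<^sub>C x))\<^sup>2) = (c * cnj c) * cinner x x"
    unfolding cinner_self[symmetric, of "c *\<^sub>C x"]
    by (simp add: cinner_scaleC_left cinner_scaleC_right)
  also have "\<dots> = complex_of_real ((cmod c * norm x)\<^sup>2)"
    by (simp add: cinner_self complex_norm_square[symmetric] power_mult_distrib)
  finally have "complex_of_real ((norm (c *\<^sub>C x))\<^sup>2) = complex_of_real ((cmod c * norm x)\<^sup>2)" .
  then show ?thesis
    by (metis mult_nonneg_nonneg norm_ge_zero of_real_eq_iff power2_eq_iff_nonneg)
qed

text \<open>Multiplying \<open>y\<close> by a suitable unimodular scalar makes the inner product
  real and nonnegative, which reduces the claim to the real Cauchy-Schwarz inequality.\<close>

lemma norm_cinner_le: "cmod (cinner x (y::'a::chilbert_space)) \<le> norm x * norm y"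
proof (cases "cinner x y = 0")
  case False
  define u where "u = complex_of_real (cmod (cinner x y)) / cinner x y"
  have "cmod u = 1" using False by (simp add: u_def norm_divide)
  have "cinner x (u *\<^sub>C y) = complex_of_real (cmod (cinner x y))"
    using False by (simp add: cinner_scaleC_right u_def)
  then have "cmod (cinner x y) = inner x (u *\<^sub>C y)"
    by (simp add: inner_eq_Re_cinner)
  also have "\<dots> \<le> norm x * norm (u *\<^sub>C y)" by (rule norm_cauchy_schwarz)
  finally show ?thesis by (simp add: norm_scaleC \<open>cmod u = 1\<close>)
qed simp

lemma bounded_bilinear_cinner: "bounded_bilinear (cinner :: 'a::chilbert_space \<Rightarrow> 'a \<Rightarrow> complex)"
proof
  show "\<exists>K. \<forall>a b::'a. norm (cinner a b) \<le> norm a * norm b * K"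
    by (rule exI[of _ 1]) (simp add: norm_cinner_le)
qed (simp_all add: cinner_add_left cinner_add_right scaleC_of_real[symmetric]
    cinner_scaleC_left cinner_scaleC_right scaleR_conv_of_real)

interpretation cinner: bounded_bilinear "cinner :: 'a::chilbert_space \<Rightarrow> 'a \<Rightarrow> complex"
  by (rule bounded_bilinear_cinner)

lemma cinner_eq_0_sym: "cinner x (y::'a::chilbert_space) = 0 \<longleftrightarrow> cinner y x = 0"
  by (metis cinner_commute complex_cnj_zero)

lemma cinner_self_eq_0_iff [simp]: "cinner x (x::'a::chilbert_space) = 0 \<longleftrightarrow> x = 0"
  by (simp add: cinner_self)

text \<open>Operator identities involving adjoints are proved throughout by testing against all
  vectors in this way.\<close>

lemma cinner_ext_left: "(\<And>z. cinner x z = cinner y (z::'a::chilbert_space)) \<Longrightarrow> x = y"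
  by (metis cinner.diff_left cinner_self_eq_0_iff eq_iff_diff_eq_0)

lemma cinner_ext_right: "(\<And>z. cinner z x = cinner z (y::'a::chilbert_space)) \<Longrightarrow> x = y"
  by (metis cinner.diff_right cinner_self_eq_0_iff eq_iff_diff_eq_0)

section \<open>Bounded complex-linear operators\<close>

lemma bounded_clinear_scaleC_id: "bounded_clinear (\<lambda>x::'a::chilbert_space. c *\<^sub>C x)"
  unfolding bounded_clinear_def
proof (intro conjI allI)
  have "c *\<^sub>C r *\<^sub>R x = r *\<^sub>R c *\<^sub>C x" for r and x :: 'a
    by (simp add: scaleC_of_real[symmetric] scaleC_scaleC mult.commute)
  then show "bounded_linear (\<lambda>x::'a. c *\<^sub>C x)"
    by (intro bounded_linear_intro[where K = "cmod c"])
       (simp_all add: scaleC_add_right norm_scaleC mult.commute)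
qed (simp add: scaleC_scaleC mult.commute)

lemma bounded_clinearI:
  fixes T :: "'a::chilbert_space \<Rightarrow> 'a"
  assumes "\<And>x y. T (x + y) = T x + T y" "\<And>c x. T (c *\<^sub>C x) = c *\<^sub>C T x"
    and "\<And>x. norm (T x) \<le> norm x * K"
  shows "bounded_clinear T"
  unfolding bounded_clinear_def
  using assms by (auto intro!: bounded_linear_intro[where K = K] simp flip: scaleC_of_real)

lemma bounded_clinear_bounded_linear: "bounded_clinear T \<Longrightarrow> bounded_linear T"
  by (simp add: bounded_clinear_def)

lemma bounded_clinear_scaleC: "bounded_clinear T \<Longrightarrow> T (c *\<^sub>C x) = c *\<^sub>C T x"
  by (simp add: bounded_clinear_def)

lemma bounded_clinear_add: "bounded_clinear T \<Longrightarrow> T (x + y) = T x + T y"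
  by (simp add: bounded_clinear_def linear_simps)

lemma bounded_clinear_diff: "bounded_clinear T \<Longrightarrow> T (x - y) = T x - T y"
  by (simp add: bounded_clinear_def linear_simps)

lemma bounded_clinear_zero: "bounded_clinear T \<Longrightarrow> T 0 = 0"
  by (simp add: bounded_clinear_def linear_simps)

lemmas bounded_clinear_simps =
  bounded_clinear_scaleC bounded_clinear_add bounded_clinear_diff bounded_clinear_zero

lemma bounded_clinear_tendsto:
  "bounded_clinear T \<Longrightarrow> (f \<longlongrightarrow> l) F \<Longrightarrow> ((\<lambda>n. T (f n)) \<longlongrightarrow> T l) F"
  by (rule bounded_linear.tendsto[OF bounded_clinear_bounded_linear])

lemma bounded_clinear_continuous_on: "bounded_clinear T \<Longrightarrow> continuous_on S T"
  by (rule linear_continuous_on[OF bounded_clinear_bounded_linear])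

lemma bounded_clinear_bound:
  assumes "bounded_clinear T" obtains K where "K > 0" "\<And>x. norm (T x) \<le> K * norm x"
  using bounded_linear.pos_bounded[OF bounded_clinear_bounded_linear[OF assms]]
  by (auto simp: mult.commute)

section \<open>Closed complex subspaces and orthogonal complements\<close>

lemma closed_csubspace_add: "closed_csubspace L \<Longrightarrow> x \<in> L \<Longrightarrow> y \<in> L \<Longrightarrow> x + y \<in> L"
  by (simp add: closed_csubspace_def)

lemma closed_csubspace_scaleC: "closed_csubspace L \<Longrightarrow> x \<in> L \<Longrightarrow> c *\<^sub>C x \<in> L"
  by (simp add: closed_csubspace_def)

lemma closed_csubspace_zero: "closed_csubspace L \<Longrightarrow> 0 \<in> L"
  by (simp add: closed_csubspace_def)

lemma closed_csubspace_closed: "closed_csubspace L \<Longrightarrow> closed L"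
  by (simp add: closed_csubspace_def)

lemma closed_csubspace_diff: "closed_csubspace L \<Longrightarrow> x \<in> L \<Longrightarrow> y \<in> L \<Longrightarrow> x - y \<in> L"
  using closed_csubspace_add[of L x "- y"] closed_csubspace_scaleC[of L y "- 1"]
  by (simp add: scaleC_minus_left)

lemma closed_csubspace_scaleR: "closed_csubspace L \<Longrightarrow> x \<in> L \<Longrightarrow> r *\<^sub>R x \<in> L"
  by (metis closed_csubspace_scaleC scaleC_of_real)

lemma closed_csubspace_Int:
  "closed_csubspace K \<Longrightarrow> closed_csubspace L \<Longrightarrow> closed_csubspace (K \<inter> L)"
  by (auto simp: closed_csubspace_def)

lemma closed_csubspace_INT:
  "(\<And>i. i \<in> I \<Longrightarrow> closed_csubspace (L i)) \<Longrightarrow> closed_csubspace (\<Inter>i\<in>I. L i)"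
  by (auto simp: closed_csubspace_def)

lemma closed_csubspace_ker:
  assumes "bounded_clinear T" shows "closed_csubspace (ker T)"
proof -
  have "closed {x. T x = 0}"
    by (intro closed_Collect_eq bounded_clinear_continuous_on[OF assms] continuous_on_const)
  then show ?thesis
    using assms by (auto simp: closed_csubspace_def ker_def bounded_clinear_simps)
qed

lemma closed_csubspace_range:
  assumes "bounded_clinear T" "closed (range T)" shows "closed_csubspace (range T)"
  unfolding closed_csubspace_def
proof (intro conjI ballI allI)
  show "0 \<in> range T" by (metis assms(1) bounded_clinear_zero rangeI)
  show "x + y \<in> range T" if "x \<in> range T" "y \<in> range T" for x y
    using that by (auto simp: bounded_clinear_add[OF assms(1), symmetric])
  show "c *\<^sub>C x \<in> range T" if "x \<in> range T" for c x
    using that by (auto simp: bounded_clinear_scaleC[OF assms(1), symmetric])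
qed fact

lemma closed_csubspace_closure_range:
  assumes "bounded_clinear T" shows "closed_csubspace (closure (range T))"
  unfolding closed_csubspace_def
proof (intro conjI ballI allI)
  show "0 \<in> closure (range T)"
    by (metis assms bounded_clinear_zero closure_subset rangeI subsetD)
next
  fix x y assume "x \<in> closure (range T)" "y \<in> closure (range T)"
  then obtain u v where u: "\<And>n. u n \<in> range T" "u \<longlonglongrightarrow> x" and v: "\<And>n. v n \<in> range T" "v \<longlonglongrightarrow> y"
    unfolding closure_sequential by blast
  have "u n + v n \<in> range T" for n
    using u(1)[of n] v(1)[of n] by (auto simp: bounded_clinear_add[OF assms, symmetric])
  then show "x + y \<in> closure (range T)"
    unfolding closure_sequential using tendsto_add[OF u(2) v(2)]
    by (intro exI[of _ "\<lambda>n. u n + v n"]) simp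
next
  fix c x assume "x \<in> closure (range T)"
  then obtain u where u: "\<And>n. u n \<in> range T" "u \<longlonglongrightarrow> x"
    unfolding closure_sequential by blast
  have "c *\<^sub>C u n \<in> range T" for n
    using u(1)[of n] by (auto simp: bounded_clinear_scaleC[OF assms, symmetric])
  then show "c *\<^sub>C x \<in> closure (range T)"
    unfolding closure_sequential using bounded_clinear_tendsto[OF bounded_clinear_scaleC_id u(2)]
    by (intro exI[of _ "\<lambda>n. c *\<^sub>C u n"]) simp
qed simp

lemma closed_csubspace_orth_compl: "closed_csubspace (orth_compl (S::'a::chilbert_space set))"
proof -
  have "closed {x. cinner y x = 0}" for y :: 'a
    by (intro closed_Collect_eq continuous_on_const
        linear_continuous_on[OF cinner.bounded_linear_right])
  then have "closed (\<Inter>y\<in>S. {x. cinner y x = 0})" by blast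
  moreover have "(\<Inter>y\<in>S. {x. cinner y x = 0}) = orth_compl S"
    by (auto simp: orth_compl_def)
  ultimately show ?thesis
    by (auto simp: closed_csubspace_def orth_compl_def cinner_add_right cinner_scaleC_right
        cinner.zero_right)
qed

subsection \<open>Orthogonal projections\<close>

text \<open>A variational argument: moving \<open>y\<close> within \<open>L\<close> along
  \<open>z\<close> cannot shorten \<open>x - y\<close>, which forces the real inner product with
  \<open>z\<close> to vanish.\<close>

lemma min_dist_orthogonal:
  fixes x y :: "'a::chilbert_space"
  assumes L: "closed_csubspace L" and y: "y \<in> L"
    and min: "\<And>z. z \<in> L \<Longrightarrow> norm (x - y) \<le> norm (x - z)"
  shows "x - y \<in> orth_compl L"
proof -
  have inner: "inner z (x - y) = 0" if "z \<in> L" for z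
  proof (cases "z = 0")
    case False
    \<comment> \<open>This \<open>t\<close> minimises the quadratic polynomial that gives the
      squared distance from \<open>x\<close> to \<open>y + t *\<^sub>R z\<close>.\<close>
    define t where "t = inner z (x - y) / (norm z)\<^sup>2"
    have "y + t *\<^sub>R z \<in> L"
      using L y that by (simp add: closed_csubspace_add closed_csubspace_scaleR)
    from min[OF this] have "(norm (x - y))\<^sup>2 \<le> (norm ((x - y) - t *\<^sub>R z))\<^sup>2"
      by (simp add: diff_diff_eq)
    also have "\<dots> = (norm (x - y))\<^sup>2 - 2 * t * inner z (x - y) + t\<^sup>2 * (norm z)\<^sup>2"
      unfolding power2_norm_eq_inner
      by (simp add: inner_diff_left inner_diff_right inner_commute power2_eq_square algebra_simps)
    also have "\<dots> = (norm (x - y))\<^sup>2 - (inner z (x - y))\<^sup>2 / (norm z)\<^sup>2"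
      using False by (simp add: t_def field_simps power2_eq_square)
    finally have "(inner z (x - y))\<^sup>2 / (norm z)\<^sup>2 \<le> 0" by simp
    then show ?thesis using False by (simp add: divide_le_0_iff)
  qed simp
  have "cinner z (x - y) = 0" if "z \<in> L" for z
  proof (rule complex_eqI)
    show "Re (cinner z (x - y)) = Re 0"
      using inner[OF that] by (simp add: inner_eq_Re_cinner)
    \<comment> \<open>The real statement for \<i> times \<open>z\<close>, which also lies in
      \<open>L\<close>, controls the imaginary part.\<close>
    show "Im (cinner z (x - y)) = Im 0"
      using inner[OF closed_csubspace_scaleC[OF L that, of \<i>]]
      by (simp add: inner_eq_Re_cinner cinner_scaleC_left)
  qed
  then show ?thesis by (simp add: orth_compl_def)
qed

text \<open>By the parallelogram law every minimising sequence is Cauchy, so completeness and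
  closedness of \<open>L\<close> give a nearest point.\<close>

lemma ex_min_dist:
  fixes x :: "'a::chilbert_space"
  assumes L: "closed_csubspace L"
  obtains y where "y \<in> L" "\<And>z. z \<in> L \<Longrightarrow> norm (x - y) \<le> norm (x - z)"
proof -
  define d where "d = Inf ((\<lambda>y. (norm (x - y))\<^sup>2) ` L)"
  have bdd: "bdd_below ((\<lambda>y. (norm (x - y))\<^sup>2) ` L)" by (rule bdd_belowI[of _ 0]) auto
  have ne: "L \<noteq> {}" using closed_csubspace_zero[OF L] by auto
  have lower: "d \<le> (norm (x - z))\<^sup>2" if "z \<in> L" for z
    unfolding d_def by (rule cInf_lower[OF imageI[OF that] bdd])
  have "\<exists>y\<in>L. (norm (x - y))\<^sup>2 < d + 1 / Suc n" for n
  proof -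
    have "Inf ((\<lambda>y. (norm (x - y))\<^sup>2) ` L) < d + 1 / Suc n" by (simp add: d_def)
    then show ?thesis using cInf_less_iff[OF _ bdd] ne by simp
  qed
  then obtain y where y: "\<And>n. y n \<in> L" "\<And>n. (norm (x - y n))\<^sup>2 < d + 1 / Suc n" by metis
  have near: "(norm (y m - y n))\<^sup>2 \<le> 2 * (1 / Suc m + 1 / Suc n)" for m n
  proof -
    \<comment> \<open>The parallelogram law for \<open>x - y m\<close> and \<open>x - y n\<close>;
      half their sum is \<open>x\<close> minus the midpoint, which lies in \<open>L\<close> and so
      has squared distance at least \<open>d\<close> from \<open>x\<close>.\<close>
    have "(norm (y m - y n))\<^sup>2 + 4 * (norm (x - (1/2) *\<^sub>R (y m + y n)))\<^sup>2
      = 2 * (norm (x - y m))\<^sup>2 + 2 * (norm (x - y n))\<^sup>2"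
      by (simp add: power2_norm_eq_inner algebra_simps inner_commute)
    moreover have "d \<le> (norm (x - (1/2) *\<^sub>R (y m + y n)))\<^sup>2"
      using L y(1) by (intro lower closed_csubspace_scaleR closed_csubspace_add)
    ultimately show ?thesis using y(2)[of m] y(2)[of n] by (simp add: algebra_simps)
  qed
  have "Cauchy y"
  proof (rule metric_CauchyI)
    fix e :: real assume "e > 0"
    then have "e\<^sup>2 / 4 > 0" by simp
    then obtain N where N: "1 / Suc N < e\<^sup>2 / 4" by (rule nat_approx_posE)
    show "\<exists>M. \<forall>m\<ge>M. \<forall>n\<ge>M. dist (y m) (y n) < e"
    proof (intro exI allI impI)
      fix m n assume mn: "m \<ge> N" "n \<ge> N"
      have "1 / Suc m \<le> 1 / Suc N" "1 / Suc n \<le> 1 / Suc N"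
        using mn by (simp_all add: field_simps)
      then have "(norm (y m - y n))\<^sup>2 < e\<^sup>2" using near[of m n] N by simp
      then show "dist (y m) (y n) < e"
        using \<open>e > 0\<close> by (simp add: dist_norm power2_less_imp_less)
    qed
  qed
  then obtain y0 where y0: "y \<longlonglongrightarrow> y0" using Cauchy_convergent convergent_def by blast
  have "y0 \<in> L"
    using closed_csubspace_closed[OF L] y(1) y0 closed_sequentially by blast
  have "(norm (x - y0))\<^sup>2 \<le> d"
  proof (rule LIMSEQ_le)
    show "(\<lambda>n. (norm (x - y n))\<^sup>2) \<longlonglongrightarrow> (norm (x - y0))\<^sup>2" by (intro tendsto_intros y0)
    show "(\<lambda>n. d + 1 / Suc n) \<longlonglongrightarrow> d"
      using tendsto_add[OF tendsto_const[of d] LIMSEQ_inverse_real_of_nat]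
      by (simp add: inverse_eq_divide)
    show "\<exists>N. \<forall>n\<ge>N. (norm (x - y n))\<^sup>2 \<le> d + 1 / Suc n" using y(2) less_imp_le by blast
  qed
  then have "norm (x - y0) \<le> norm (x - z)" if "z \<in> L" for z
    using lower[OF that] by (meson norm_ge_zero order_trans power2_le_imp_le)
  with \<open>y0 \<in> L\<close> show thesis using that by blast
qed

lemma orth_decomposition_unique:
  assumes L: "closed_csubspace L" and "y \<in> L" "x - y \<in> orth_compl L" "z \<in> L" "x - z \<in> orth_compl L"
  shows "y = z"
proof -
  have "y - z \<in> L" using L assms by (simp add: closed_csubspace_diff)
  moreover have "y - z \<in> orth_compl L"
    using closed_csubspace_diff[OF closed_csubspace_orth_compl assms(5,3)] by simp
  ultimately show ?thesis by (auto simp: orth_compl_def)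
qed

text \<open>The working characterisation of \<open>cproj\<close>: concrete projections are computed
  by exhibiting a decomposition.\<close>

lemma cproj_eqI:
  assumes "closed_csubspace L" "y \<in> L" "x - y \<in> orth_compl L"
  shows "cproj L x = y"
  unfolding cproj_def using assms orth_decomposition_unique by blast

lemma
  assumes L: "closed_csubspace L"
  shows cproj_in: "cproj L x \<in> L" and diff_cproj_in: "x - cproj L x \<in> orth_compl L"
proof -
  obtain y where "y \<in> L" "x - y \<in> orth_compl L"
    using ex_min_dist[OF L] min_dist_orthogonal[OF L] by metis
  moreover from cproj_eqI[OF L this] have "cproj L x = y" .
  ultimately show "cproj L x \<in> L" "x - cproj L x \<in> orth_compl L" by auto
qed

lemma cproj_eq_self_iff: "closed_csubspace L \<Longrightarrow> cproj L x = x \<longleftrightarrow> x \<in> L"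
  by (metis closed_csubspace_orth_compl closed_csubspace_zero cproj_eqI cproj_in diff_self)

lemma orth_complD: "x \<in> orth_compl S \<Longrightarrow> y \<in> S \<Longrightarrow> cinner y x = 0"
  by (simp add: orth_compl_def)

lemma orth_complD': "x \<in> orth_compl S \<Longrightarrow> y \<in> S \<Longrightarrow> cinner x y = 0"
  by (metis orth_complD cinner_eq_0_sym)

lemma orth_compl_orth_compl:
  assumes L: "closed_csubspace L" shows "orth_compl (orth_compl L) = L"
proof
  show "L \<subseteq> orth_compl (orth_compl L)"
    by (auto simp: orth_compl_def) (metis cinner_eq_0_sym)
  show "orth_compl (orth_compl L) \<subseteq> L"
  proof
    fix x assume x: "x \<in> orth_compl (orth_compl L)"
    let ?y = "x - cproj L x"
    have "?y \<in> orth_compl L" by (rule diff_cproj_in[OF L])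
    then have "cinner ?y x = 0" "cinner ?y (cproj L x) = 0"
      using x orth_complD cproj_in[OF L] orth_complD' by blast+
    then have "cinner ?y ?y = 0" by (simp add: cinner.diff_right)
    then show "x \<in> L" using cproj_in[OF L, of x] by simp
  qed
qed

lemma cproj_eq_0_iff: "closed_csubspace L \<Longrightarrow> cproj L x = 0 \<longleftrightarrow> x \<in> orth_compl L"
  by (metis closed_csubspace_zero cproj_eqI diff_cproj_in diff_zero)

lemma norm_cproj:
  assumes "closed_csubspace L"
  shows "(norm x)\<^sup>2 = (norm (cproj L x))\<^sup>2 + (norm (x - cproj L x))\<^sup>2"
proof -
  have "cinner (cproj L x) (x - cproj L x) = 0"
    by (rule orth_complD[OF diff_cproj_in[OF assms] cproj_in[OF assms]])
  then have "inner (cproj L x) (x - cproj L x) = 0" by (simp add: inner_eq_Re_cinner)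
  then show ?thesis by (simp add: power2_norm_eq_inner algebra_simps inner_commute)
qed

lemma norm_cproj_le: "closed_csubspace L \<Longrightarrow> norm (cproj L x) \<le> norm x"
  by (rule power2_le_imp_le) (simp_all add: norm_cproj[of L x])

lemma bounded_clinear_cproj:
  assumes L: "closed_csubspace L" shows "bounded_clinear (cproj L)"
proof (rule bounded_clinearI[where K = 1])
  note O = closed_csubspace_orth_compl[of L]
  show "cproj L (x + y) = cproj L x + cproj L y" for x y
    using closed_csubspace_add[OF O diff_cproj_in[OF L, of x] diff_cproj_in[OF L, of y]]
    by (intro cproj_eqI L closed_csubspace_add cproj_in) (simp add: algebra_simps)
  show "cproj L (c *\<^sub>C x) = c *\<^sub>C cproj L x" for c x
    using closed_csubspace_scaleC[OF O diff_cproj_in[OF L, of x], of c]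
    by (intro cproj_eqI L closed_csubspace_scaleC cproj_in) (simp add: scaleC_diff_right)
qed (simp add: norm_cproj_le L)

lemma is_adjoint_cproj:
  assumes L: "closed_csubspace L" shows "is_adjoint (cproj L) (cproj L)"
  unfolding is_adjoint_def
proof (intro allI)
  fix x y
  have "cinner (cproj L x) (y - cproj L y) = 0" "cinner (x - cproj L x) (cproj L y) = 0"
    using cproj_in[OF L] diff_cproj_in[OF L] orth_complD orth_complD' by blast+
  then show "cinner (cproj L x) y = cinner x (cproj L y)"
    by (simp add: cinner.diff_left cinner.diff_right)
qed

lemma cproj_cproj: "closed_csubspace L \<Longrightarrow> cproj L (cproj L x) = cproj L x"
  by (simp add: cproj_eq_self_iff cproj_in)

lemma range_cproj: "closed_csubspace L \<Longrightarrow> range (cproj L) = L"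
  using cproj_in cproj_eq_self_iff by (metis image_subset_iff rangeI subsetI subset_antisym)

lemma orth_compl_antimono: "S \<subseteq> S' \<Longrightarrow> orth_compl S' \<subseteq> orth_compl S"
  by (auto simp: orth_compl_def)

lemma orth_compl_closure: "orth_compl (closure S) = orth_compl (S::'a::chilbert_space set)"
proof
  show "orth_compl (closure S) \<subseteq> orth_compl S" by (simp add: closure_subset orth_compl_antimono)
  show "orth_compl S \<subseteq> orth_compl (closure S)"
  proof
    fix x assume x: "x \<in> orth_compl S"
    have "closed {y. cinner y x = 0}"
      by (intro closed_Collect_eq continuous_on_const
          linear_continuous_on[OF cinner.bounded_linear_left])
    moreover have "S \<subseteq> {y. cinner y x = 0}" using x by (auto simp: orth_compl_def)
    ultimately have "closure S \<subseteq> {y. cinner y x = 0}" by (rule closure_minimal[rotated])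
    then show "x \<in> orth_compl (closure S)" by (auto simp: orth_compl_def)
  qed
qed

subsection \<open>Adjoints\<close>

lemma is_adjointD: "is_adjoint S T \<Longrightarrow> cinner (S x) y = cinner x (T y)"
  by (simp add: is_adjoint_def)

lemma is_adjoint_sym: "is_adjoint S T \<Longrightarrow> is_adjoint T S"
  by (metis cinner_commute is_adjoint_def)

text \<open>Linearity follows by testing against vectors; boundedness follows from the identity of
  the squared norm of \<open>S x\<close> with \<open>cinner x (T (S x))\<close>.\<close>

lemma bounded_clinear_adjoint:
  assumes adj: "is_adjoint S T" and T: "bounded_clinear T"
  shows "bounded_clinear S"
proof -
  obtain K where K: "K > 0" "\<And>x. norm (T x) \<le> K * norm x"
    using bounded_clinear_bound[OF T] by blast
  show ?thesis
  proof (rule bounded_clinearI[where K = K])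
    show "S (x + y) = S x + S y" for x y
      by (rule cinner_ext_left) (simp add: cinner_add_left is_adjointD[OF adj])
    show "S (c *\<^sub>C x) = c *\<^sub>C S x" for c x
      by (rule cinner_ext_left) (simp add: cinner_scaleC_left is_adjointD[OF adj])
    show "norm (S x) \<le> norm x * K" for x
    proof (cases "S x = 0")
      case False
      have "(norm (S x))\<^sup>2 = cmod (cinner (S x) (S x))" by (simp add: cinner_self norm_power)
      also have "\<dots> = cmod (cinner x (T (S x)))" by (simp add: is_adjointD[OF adj])
      also have "\<dots> \<le> norm x * norm (T (S x))" by (rule norm_cinner_le)
      also have "\<dots> \<le> norm x * (K * norm (S x))" by (intro mult_left_mono K) simp
      finally show ?thesis using False by (simp add: power2_eq_square mult.assoc)
    qed (use K in simp)
  qed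
qed

text \<open>A nonzero functional has a closed kernel, and a vector \<open>u\<close> orthogonal to
  that kernel represents it after scaling.\<close>

lemma Riesz_representation:
  fixes \<phi> :: "'a::chilbert_space \<Rightarrow> complex"
  assumes \<phi>: "bounded_linear \<phi>" "\<And>c x. \<phi> (c *\<^sub>C x) = c * \<phi> x"
  obtains z where "\<And>x. \<phi> x = cinner z x"
proof (cases "\<forall>x. \<phi> x = 0")
  case True
  then show thesis using that[of 0] by (simp add: cinner.zero_left)
next
  case False
  then obtain w where w: "\<phi> w \<noteq> 0" by blast
  define L where "L = {x. \<phi> x = 0}"
  have "closed L"
    unfolding L_def by (intro closed_Collect_eq linear_continuous_on[OF \<phi>(1)] continuous_on_const)
  then have L: "closed_csubspace L"
    using \<phi> by (auto simp: closed_csubspace_def L_def linear_simps)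
  define u where "u = w - cproj L w"
  have "\<phi> (cproj L w) = 0" using cproj_in[OF L] by (simp add: L_def)
  then have u: "\<phi> u = \<phi> w" by (simp add: u_def \<phi> linear_simps)
  then have "u \<noteq> 0" using w \<phi>(1) by (auto simp: linear_simps)
  have orth: "u \<in> orth_compl L" unfolding u_def by (rule diff_cproj_in[OF L])
  \<comment> \<open>The combination of \<open>u\<close> and \<open>x\<close> below is chosen to be
    killed by \<open>\<phi>\<close>, hence it is orthogonal to \<open>u\<close>.\<close>
  have key: "\<phi> x * cinner u u = \<phi> u * cinner u x" for x
  proof -
    have "\<phi> x *\<^sub>C u - \<phi> u *\<^sub>C x \<in> L" by (simp add: L_def \<phi> linear_simps)
    then have "cinner u (\<phi> x *\<^sub>C u - \<phi> u *\<^sub>C x) = 0" by (rule orth_complD'[OF orth])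
    then show ?thesis by (simp add: cinner.diff_right cinner_scaleC_right)
  qed
  show thesis
  proof (rule that)
    fix x
    show "\<phi> x = cinner (cnj (\<phi> u / cinner u u) *\<^sub>C u) x"
      using key[of x] \<open>u \<noteq> 0\<close> by (simp add: cinner_scaleC_left field_simps)
  qed
qed

lemma ex_adjoint:
  assumes T: "bounded_clinear T"
  obtains S where "bounded_clinear S" "is_adjoint S T"
proof -
  have "\<exists>z. \<forall>y. cinner x (T y) = cinner z y" for x
  proof -
    have "bounded_linear (\<lambda>y. cinner x (T y))"
      by (rule bounded_linear_compose[OF cinner.bounded_linear_right
          bounded_clinear_bounded_linear[OF T]])
    then obtain z where "\<And>y. cinner x (T y) = cinner z y"
      using T by (rule_tac Riesz_representation) (auto simp: bounded_clinear_simps cinner_scaleC_right)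
    then show ?thesis by blast
  qed
  then obtain S where "\<And>x y. cinner x (T y) = cinner (S x) y" by metis
  then have "is_adjoint S T" by (simp add: is_adjoint_def)
  then show thesis using that bounded_clinear_adjoint[OF _ T] by blast
qed

text \<open>Turns statements about cokernels into statements about kernels of adjoints.\<close>

lemma orth_compl_range: "is_adjoint S T \<Longrightarrow> orth_compl (range T) = ker S"
  by (auto simp: orth_compl_def ker_def is_adjoint_def)
     (metis cinner_commute cinner_self_eq_0_iff, metis cinner.zero_left cinner_eq_0_sym)

lemma closure_range_eq:
  assumes "is_adjoint S T" "bounded_clinear T"
  shows "closure (range T) = orth_compl (ker S)"
  using orth_compl_orth_compl[OF closed_csubspace_closure_range[OF assms(2)]]
  by (simp add: orth_compl_closure orth_compl_range[OF assms(1)])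

subsection \<open>Operators with closed range\<close>

text \<open>
  By Baire, some closed set \<open>closure (T ` cball 0 n)\<close> has an interior point relative to the range of \<open>T\<close>.
  This makes the adjoint bounded below on the range, and that bound passes to \<open>T\<close> by duality.
\<close>

lemma closed_range_bounded_below:
  fixes T :: "'a::chilbert_space \<Rightarrow> 'a"
  assumes T: "bounded_clinear T" and closed: "closed (range T)"
  obtains c where "c > 0" "\<And>x. x \<in> orth_compl (ker T) \<Longrightarrow> norm x \<le> c * norm (T x)"
proof -
  obtain S where S: "bounded_clinear S" "is_adjoint S T" by (rule ex_adjoint[OF T])
  note adj = is_adjointD[OF is_adjoint_sym[OF S(2)]] is_adjointD[OF S(2)]
  define R where "R = range T"
  define F where "F n = R \<inter> closure (T ` cball 0 (real n))" for n
  have R: "closed_csubspace R" unfolding R_def by (rule closed_csubspace_range[OF T closed])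
  have "\<exists>n. top_of_set R interior_of F n \<noteq> {}"
  proof (rule ccontr)
    assume "\<not> ?thesis"
    then have empty: "top_of_set R interior_of F n = {}" for n by blast
    have "top_of_set R interior_of \<Union>(range F) = {}"
    proof (rule Baire_category_alt)
      show "completely_metrizable_space (top_of_set R) \<or>
          locally_compact_space (top_of_set R) \<and> regular_space (top_of_set R)"
        using closed unfolding R_def
        by (simp add: completely_metrizable_space_closedin completely_metrizable_space_euclidean)
      show "closedin (top_of_set R) X \<and> top_of_set R interior_of X = {}" if "X \<in> range F" for X
        using that empty by (auto simp: F_def closedin_closed_Int)
    qed simp
    moreover have "\<Union>(range F) = R"
    proof
      show "R \<subseteq> \<Union>(range F)"
      proof
        fix y assume "y \<in> R"
        then obtain x where x: "y = T x" by (auto simp: R_def)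
        obtain n :: nat where "norm x \<le> n" using real_arch_simple by blast
        then have "y \<in> closure (T ` cball 0 (real n))" using x closure_subset by fastforce
        then show "y \<in> \<Union>(range F)" using \<open>y \<in> R\<close> by (auto simp: F_def)
      qed
    qed (auto simp: F_def)
    moreover have "top_of_set R interior_of R = R" by (simp add: interior_of_openin)
    ultimately show False using closed_csubspace_zero[OF R] by auto
  qed
  then obtain n y0 where "y0 \<in> top_of_set R interior_of F n" by blast
  then obtain U where U: "openin (top_of_set R) U" "y0 \<in> U" "U \<subseteq> F n"
    by (auto simp: interior_of_def)
  then obtain r where r: "r > 0" "ball y0 r \<inter> R \<subseteq> U"
    by (meson openin_contains_ball)
  have y0: "y0 \<in> R" using U by (auto simp: F_def)
  \<comment> \<open>For \<open>w = T x\<close> with \<open>norm x\<close> at most \<open>n\<close>,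
    move \<open>T\<close> across the inner product; the set of \<open>w\<close> obeying the bound is
    closed, so the bound extends to the closure.\<close>
  have bound: "cmod (cinner w z) \<le> n * norm (S z)" if "w \<in> F n" for w z
  proof -
    have "closed {w. cmod (cinner w z) \<le> n * norm (S z)}"
      by (intro closed_Collect_le continuous_on_const continuous_on_norm
          linear_continuous_on[OF cinner.bounded_linear_left])
    moreover have "T ` cball 0 (real n) \<subseteq> {w. cmod (cinner w z) \<le> n * norm (S z)}"
    proof clarsimp
      fix x :: 'a assume "norm x \<le> n"
      then have "norm x * norm (S z) \<le> n * norm (S z)" by (intro mult_right_mono) auto
      then show "cmod (cinner (T x) z) \<le> n * norm (S z)"
        using norm_cinner_le[of x "S z"] by (simp add: adj(1))
    qed
    ultimately have "closure (T ` cball 0 (real n)) \<subseteq> {w. cmod (cinner w z) \<le> n * norm (S z)}"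
      by (rule closure_minimal[rotated])
    then show ?thesis using that by (auto simp: F_def)
  qed
  have below: "norm z \<le> (2 * n / r) * norm (S z)" if "z \<in> R" for z
  proof (cases "z = 0")
    case False
    \<comment> \<open>A multiple of \<open>z\<close> of length \<open>r / 2\<close>, so that
      \<open>y0 + y\<close> and \<open>y0 - y\<close> both stay in the ball; subtracting their
      bounds eliminates the unknown centre \<open>y0\<close>.\<close>
    define y where "y = (r / 2 / norm z) *\<^sub>R z"
    have "norm y < r" using False r by (simp add: y_def)
    have yR: "y \<in> R" unfolding y_def by (rule closed_csubspace_scaleR[OF R that])
    have "y0 + y \<in> ball y0 r" "y0 - y \<in> ball y0 r"
      using \<open>norm y < r\<close> by (simp_all add: dist_norm)
    moreover have "y0 + y \<in> R" "y0 - y \<in> R"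
      by (rule closed_csubspace_add[OF R y0 yR], rule closed_csubspace_diff[OF R y0 yR])
    ultimately have "y0 + y \<in> F n" "y0 - y \<in> F n" using U(3) r(2) by blast+
    then have "cmod (cinner (y0 + y) z - cinner (y0 - y) z) \<le> n * norm (S z) + n * norm (S z)"
      by (intro order_trans[OF norm_triangle_ineq4] add_mono bound)
    also have "cinner (y0 + y) z - cinner (y0 - y) z = 2 * cinner y z"
      by (simp add: cinner_add_left cinner.diff_left)
    also have "cinner y z = complex_of_real (r / 2 * norm z)"
      using False
      by (simp add: y_def cinner.scaleR_left cinner_self scaleR_conv_of_real power2_eq_square)
    finally have "r * norm z \<le> 2 * n * norm (S z)" using r by (simp add: norm_mult)
    then show ?thesis using r by (simp add: field_simps)
  qed (use bounded_clinear_zero[OF S(1)] in simp)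
  \<comment> \<open>Adding \<open>1\<close> keeps the constant positive also when
    \<open>n = 0\<close>.\<close>
  define c where "c = 2 * n / r + 1"
  have c: "c > 0" using r by (simp add: c_def add_nonneg_pos)
  have below': "norm z \<le> c * norm (S z)" if "z \<in> R" for z
    using below[OF that] norm_ge_zero[of "S z"] unfolding c_def distrib_right by linarith
  \<comment> \<open>Duality: write \<open>x = S z\<close> with \<open>z\<close> in \<open>R\<close>;
    the squared norm of \<open>x\<close> equals \<open>cinner z (T x)\<close>, and
    \<open>norm z\<close> is bounded by \<open>c * norm x\<close>.\<close>
  have rangeS: "norm x \<le> c * norm (T x)" if x: "x \<in> range S" for x
  proof (cases "x = 0")
    case False
    obtain z0 where z0: "x = S z0" using x by blast
    define z where "z = cproj R z0"
    have "z \<in> R" unfolding z_def by (rule cproj_in[OF R])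
    have "z0 - z \<in> ker S"
      unfolding orth_compl_range[OF S(2), symmetric] z_def using diff_cproj_in[OF R] R_def by blast
    then have x: "x = S z" using z0 by (simp add: ker_def bounded_clinear_diff[OF S(1)])
    have "(norm x)\<^sup>2 = cmod (cinner (S z) x)" by (simp add: x cinner_self norm_power)
    also have "\<dots> \<le> norm z * norm (T x)" unfolding adj by (rule norm_cinner_le)
    also have "\<dots> \<le> (c * norm x) * norm (T x)"
      using below'[OF \<open>z \<in> R\<close>] by (intro mult_right_mono) (simp_all add: x)
    finally have "norm x * norm x \<le> norm x * (c * norm (T x))"
      by (simp add: power2_eq_square mult_ac)
    then show ?thesis using False by simp
  qed (use bounded_clinear_zero[OF T] in simp)
  \<comment> \<open>The estimate is a closed condition, so it passes to the closure of the range of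
    \<open>S\<close>, which is the orthogonal complement of the kernel of \<open>T\<close>.\<close>
  have "closed {x. norm x \<le> c * norm (T x)}"
    by (intro closed_Collect_le continuous_on_norm continuous_on_mult continuous_on_const
        continuous_on_id bounded_clinear_continuous_on[OF T])
  then have "closure (range S) \<subseteq> {x. norm x \<le> c * norm (T x)}"
    using rangeS by (intro closure_minimal) auto
  then have "orth_compl (ker T) \<subseteq> {x. norm x \<le> c * norm (T x)}"
    by (simp add: closure_range_eq[OF is_adjoint_sym[OF S(2)] S(1)])
  then show thesis using that[OF c] by blast
qed

text \<open>The assumptions on \<open>Z\<close> say that it inverts \<open>1 - \<mu> G\<close>. Then
  \<open>(T - \<mu>) Z y\<close> is the difference of \<open>T y\<close>, which lies in
  \<open>R\<close>, and a multiple of the component of \<open>Z y\<close> orthogonal to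
  \<open>R\<close>, so it vanishes only if both do. The lemma serves an operator, its adjoint, and
  its restriction to an invariant subspace.\<close>

lemma ker_diff_scaleC:
  fixes T :: "'a::chilbert_space \<Rightarrow> 'a"
  assumes T: "bounded_clinear T" and Z: "bounded_clinear Z"
    and R: "closed_csubspace R" "range T \<subseteq> R" and TG: "\<And>x. T (G x) = cproj R x"
    and ZG: "\<And>x. Z x = x + \<mu> *\<^sub>C G (Z x)" "\<And>x. Z x = x + \<mu> *\<^sub>C Z (G x)" and \<mu>: "\<mu> \<noteq> 0"
  shows "ker (\<lambda>x. T x - \<mu> *\<^sub>C x) = Z ` {y \<in> ker T. Z y \<in> R}"
proof -
  have key: "T (Z y) - \<mu> *\<^sub>C Z y = T y - \<mu> *\<^sub>C (Z y - cproj R (Z y))" for y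
  proof -
    have "T (Z y) = T (y + \<mu> *\<^sub>C G (Z y))" using ZG(1) by metis
    also have "\<dots> = T y + \<mu> *\<^sub>C cproj R (Z y)" by (simp add: bounded_clinear_simps[OF T] TG)
    finally show ?thesis by (simp add: scaleC_diff_right)
  qed
  show ?thesis
  proof (intro Set.set_eqI iffI)
    fix x assume "x \<in> ker (\<lambda>x. T x - \<mu> *\<^sub>C x)"
    then have x: "T x - \<mu> *\<^sub>C x = 0" by (simp add: ker_def)
    define y where "y = x - \<mu> *\<^sub>C G x"
    have Zy: "Z y = x" using ZG(2)[of x] by (simp add: y_def bounded_clinear_simps[OF Z])
    \<comment> \<open>The left side lies in \<open>R\<close> and the right side in its orthogonal
      complement, so both are zero.\<close>
    have eq: "T y = \<mu> *\<^sub>C (x - cproj R x)" using key[of y] x by (simp add: Zy)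
    moreover have "T y \<in> R" using R(2) by blast
    moreover have "T y \<in> orth_compl R"
      unfolding eq by (rule closed_csubspace_scaleC[OF closed_csubspace_orth_compl diff_cproj_in[OF R(1)]])
    ultimately have "T y = 0" by (auto simp: orth_compl_def)
    moreover have "x \<in> R" using eq \<open>T y = 0\<close> \<mu> cproj_in[OF R(1), of x] by simp
    ultimately show "x \<in> Z ` {y \<in> ker T. Z y \<in> R}" using Zy by (auto simp: ker_def)
  next
    fix x assume "x \<in> Z ` {y \<in> ker T. Z y \<in> R}"
    then obtain y where y: "x = Z y" "T y = 0" "Z y \<in> R" by (auto simp: ker_def)
    then have "cproj R (Z y) = Z y" by (simp add: cproj_eq_self_iff[OF R(1)])
    then show "x \<in> ker (\<lambda>x. T x - \<mu> *\<^sub>C x)" using key[of y] y by (simp add: ker_def)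
  qed
qed

section \<open>Operators and invariant subspaces of a von Neumann algebra\<close>

locale vna =
  fixes A :: "('a::chilbert_space \<Rightarrow> 'a) set"
  assumes vna: "von_neumann_algebra A"
begin

lemma bounded_clinear_mem: "X \<in> A \<Longrightarrow> bounded_clinear X"
  using vna by (simp add: von_neumann_algebra_def)

lemma commute_mem: "X \<in> A \<Longrightarrow> S \<in> commutant A \<Longrightarrow> S (X x) = X (S x)"
  by (simp add: commutant_def fun_eq_iff)

text \<open>The double commutant property, in the form used to place operators defined by limits or
  by unique solvability in \<open>A\<close>.\<close>

lemma mem_if_commute:
  assumes "bounded_clinear X" "\<And>S x. S \<in> commutant A \<Longrightarrow> S (X x) = X (S x)"
  shows "X \<in> A"
proof -
  have "X \<in> commutant (commutant A)"
    using assms unfolding commutant_def[of "commutant A"] by (simp add: fun_eq_iff)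
  then show ?thesis using vna by (simp add: von_neumann_algebra_def)
qed

lemma mem_compose: "X \<in> A \<Longrightarrow> Y \<in> A \<Longrightarrow> (\<lambda>x. X (Y x)) \<in> A"
  using vna by (fastforce simp: von_neumann_algebra_def comp_def)

lemma mem_id: "(\<lambda>x. x) \<in> A"
  using vna by (simp add: von_neumann_algebra_def)

lemma mem_add: "X \<in> A \<Longrightarrow> Y \<in> A \<Longrightarrow> (\<lambda>x. X x + Y x) \<in> A"
  using vna by (simp add: von_neumann_algebra_def)

lemma mem_scaleC: "X \<in> A \<Longrightarrow> (\<lambda>x. c *\<^sub>C X x) \<in> A"
  using vna by (simp add: von_neumann_algebra_def)

lemma mem_diff: "X \<in> A \<Longrightarrow> Y \<in> A \<Longrightarrow> (\<lambda>x. X x - Y x) \<in> A"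
  using mem_add[of X "\<lambda>x. (- 1) *\<^sub>C Y x"] mem_scaleC[of Y "- 1"]
  by (simp add: scaleC_minus_left)

lemma mem_power: "X \<in> A \<Longrightarrow> X ^^ n \<in> A"
proof (induction n)
  case 0
  then show ?case using mem_id by (simp add: id_def)
next
  case (Suc n)
  then show ?case using mem_compose[of X "X ^^ n"] by (simp add: comp_def)
qed

lemma ex_adjoint_mem:
  assumes "X \<in> A" obtains X' where "X' \<in> A" "is_adjoint X' X"
  using vna assms by (auto simp: von_neumann_algebra_def)

text \<open>Taking adjoints in the relation that \<open>S\<close> commutes with the adjoint of
  \<open>X\<close>, which again lies in \<open>A\<close>. This is what makes invariance of
  \<open>L\<close> pass to its orthogonal complement.\<close>

lemma commutant_adjoint:
  assumes S: "S \<in> commutant A" obtains S' where "S' \<in> commutant A" "is_adjoint S' S"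
proof -
  have "bounded_clinear S" using S by (simp add: commutant_def)
  then obtain S' where S': "bounded_clinear S'" "is_adjoint S' S" by (rule ex_adjoint)
  have "S' (X x) = X (S' x)" if X: "X \<in> A" for X x
  proof -
    obtain Y where Y: "Y \<in> A" "is_adjoint Y X" by (rule ex_adjoint_mem[OF X])
    note adj = is_adjointD[OF S'(2)] is_adjointD[OF is_adjoint_sym[OF Y(2)]]
    show ?thesis
      by (rule cinner_ext_left) (simp add: adj commute_mem[OF Y(1) S])
  qed
  then have "S' \<in> commutant A" using S' by (simp add: commutant_def fun_eq_iff)
  then show thesis using that S' by blast
qed

text \<open>
  Invariance under the commutant is how we express that the orthogonal projection onto \<open>L\<close> belongs to \<open>A\<close>.
\<close>

definition affil :: "'a set \<Rightarrow> bool" where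
  "affil L \<longleftrightarrow> closed_csubspace L \<and> (\<forall>S\<in>commutant A. \<forall>x\<in>L. S x \<in> L)"

lemma affil_closed_csubspace: "affil L \<Longrightarrow> closed_csubspace L"
  by (simp add: affil_def)

lemma affil_orth_compl:
  assumes "affil L" shows "affil (orth_compl L)"
  unfolding affil_def
proof (intro conjI ballI)
  fix S x assume S: "S \<in> commutant A" and x: "x \<in> orth_compl L"
  obtain S' where S': "S' \<in> commutant A" "is_adjoint S' S" by (rule commutant_adjoint[OF S])
  have "cinner y (S x) = 0" if "y \<in> L" for y
    using assms S' that orth_complD[OF x] by (simp add: affil_def flip: is_adjointD[OF S'(2)])
  then show "S x \<in> orth_compl L" by (simp add: orth_compl_def)
qed (rule closed_csubspace_orth_compl)

lemma affil_Int: "affil K \<Longrightarrow> affil L \<Longrightarrow> affil (K \<inter> L)"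
  by (simp add: affil_def closed_csubspace_Int)

lemma affil_ker: "X \<in> A \<Longrightarrow> affil (ker X)"
  by (auto simp: affil_def closed_csubspace_ker bounded_clinear_mem)
     (auto simp: ker_def commutant_def fun_eq_iff bounded_clinear_zero, metis bounded_clinear_zero)

lemma affil_orth_compl_range:
  assumes "X \<in> A" shows "affil (orth_compl (range X))"
  by (metis affil_ker assms ex_adjoint_mem orth_compl_range)

lemma affil_closure_range: "X \<in> A \<Longrightarrow> affil (closure (range X))"
  by (metis affil_ker affil_orth_compl bounded_clinear_mem closure_range_eq ex_adjoint_mem)

lemma affil_range: "X \<in> A \<Longrightarrow> closed (range X) \<Longrightarrow> affil (range X)"
  by (metis affil_closure_range closure_closed)

text \<open>An operator \<open>S\<close> of the commutant preserves both \<open>L\<close> and its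
  complement, so it carries the orthogonal decomposition of \<open>x\<close> to that of
  \<open>S x\<close>.\<close>

lemma cproj_mem:
  assumes "affil L" shows "cproj L \<in> A"
proof (rule mem_if_commute)
  note L = affil_closed_csubspace[OF assms]
  show "bounded_clinear (cproj L)" by (rule bounded_clinear_cproj[OF L])
  fix S x assume S: "S \<in> commutant A"
  then have lin: "bounded_clinear S" by (simp add: commutant_def)
  have "S (cproj L x) \<in> L" using assms S cproj_in[OF L] by (simp add: affil_def)
  moreover have "S (x - cproj L x) \<in> orth_compl L"
    using affil_orth_compl[OF assms] S diff_cproj_in[OF L] by (simp add: affil_def)
  ultimately show "S (cproj L x) = cproj L (S x)"
    by (intro cproj_eqI[symmetric] L) (simp_all add: bounded_clinear_diff[OF lin])
qed

lemma cproj_projections: "affil L \<Longrightarrow> cproj L \<in> projections A"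
  using affil_closed_csubspace
  by (auto simp: projections_def cproj_mem bounded_clinear_cproj is_adjoint_cproj cproj_cproj)

text \<open>The range of \<open>E\<close> is the kernel of \<open>1 - E\<close>, hence closed and
  invariant. Projections of \<open>A\<close> and \<open>affil\<close> subspaces thus correspond to
  each other.\<close>

lemma projections_cproj:
  assumes "E \<in> projections A" shows "affil (range E)" "E = cproj (range E)"
proof -
  have E: "E \<in> A" "bounded_clinear E" "\<And>x. E (E x) = E x" "is_adjoint E E"
    using assms by (auto simp: projections_def fun_eq_iff)
  have "ker (\<lambda>x. x - E x) = range E"
    using E(3) by (force simp: ker_def)
  then show aff: "affil (range E)" using affil_ker[OF mem_diff[OF mem_id E(1)]] by simp
  have "cproj (range E) x = E x" for x
  proof (rule cproj_eqI)
    show "x - E x \<in> orth_compl (range E)"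
      using E(3) by (auto simp: orth_compl_def is_adjointD[OF E(4)] bounded_clinear_diff[OF E(2)]
          cinner.zero_right)
  qed (simp_all add: affil_closed_csubspace[OF aff])
  then show "E = cproj (range E)" by auto
qed

subsection \<open>Square roots and polar decomposition\<close>

text \<open>
  With \<open>R = 1 - X\<^sup>* X\<close>, the iteration \<open>Y\<^sub>n\<^sub>+\<^sub>1 = (R + Y\<^sub>n\<^sup>2) / 2\<close> is dominated in norm by the scalar iteration
  \<open>y\<^sub>n\<^sub>+\<^sub>1 = (1 + y\<^sub>n\<^sup>2) / 2\<close>, which increases and stays below \<open>1\<close>. The limit \<open>Q\<close> satisfies \<open>2 Q = R + Q\<^sup>2\<close>,
  that is \<open>(1 - Q)\<^sup>2 = X\<^sup>* X\<close>. The square root is not claimed to be positive.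
\<close>

lemma mem_contraction_sqrt:
  assumes X: "X \<in> A" and X': "is_adjoint X' X" "X' \<in> A" and le: "\<And>x. norm (X x) \<le> norm x"
  obtains B where "B \<in> A" "is_adjoint B B" "\<And>x. B (B x) = X' (X x)"
proof -
  have adj: "cinner (X' x) y = cinner x (X y)" "cinner (X x) y = cinner x (X' y)" for x y
    by (rule is_adjointD[OF X'(1)], rule is_adjointD[OF is_adjoint_sym[OF X'(1)]])
  define R0 where "R0 = (\<lambda>x. x - X' (X x))"
  have R0: "R0 \<in> A" unfolding R0_def by (rule mem_diff[OF mem_id mem_compose[OF X'(2) X]])
  have le': "norm (X' x) \<le> norm x" for x
  proof (cases "X' x = 0")
    case False
    have "(norm (X' x))\<^sup>2 = cmod (cinner (X' x) (X' x))" by (simp add: cinner_self norm_power)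
    also have "\<dots> = cmod (cinner x (X (X' x)))" by (simp add: adj)
    also have "\<dots> \<le> norm x * norm (X (X' x))" by (rule norm_cinner_le)
    also have "\<dots> \<le> norm x * norm (X' x)" by (intro mult_left_mono le) simp
    finally show ?thesis using False by (simp add: power2_eq_square)
  qed simp
  \<comment> \<open>When the square is expanded, the negative cross term outweighs the squared norm
    of \<open>X' (X x)\<close>, because \<open>X'\<close> is a contraction too.\<close>
  have leR: "norm (R0 x) \<le> norm x" for x
  proof (rule power2_le_imp_le)
    have "inner x (X' (X x)) = (norm (X x))\<^sup>2"
      by (simp add: inner_eq_Re_cinner adj(2)[symmetric] cinner_self)
    then have "(norm (R0 x))\<^sup>2 = (norm x)\<^sup>2 - 2 * (norm (X x))\<^sup>2 + (norm (X' (X x)))\<^sup>2"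
      unfolding R0_def by (simp add: power2_norm_eq_inner inner_diff inner_commute)
    moreover have "(norm (X' (X x)))\<^sup>2 \<le> (norm (X x))\<^sup>2"
      by (intro power_mono le') simp
    ultimately show "(norm (R0 x))\<^sup>2 \<le> (norm x)\<^sup>2"
      using zero_le_power2[of "norm (X x)"] by linarith
  qed simp
  \<comment> \<open>The iteration runs in the Banach space of bounded operators, where summable
    increments give norm convergence.\<close>
  define R where "R = Blinfun R0"
  have R: "blinfun_apply R = R0"
    unfolding R_def
    by (rule bounded_linear_Blinfun_apply[OF bounded_clinear_bounded_linear[OF bounded_clinear_mem[OF R0]]])
  have normR: "norm R \<le> 1" by (rule norm_blinfun_bound) (simp_all add: R leR)
  define Y where "Y = rec_nat 0 (\<lambda>_ Z. (1/2) *\<^sub>R (R + (Z o\<^sub>L Z)))"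
  define y where "y = rec_nat 0 (\<lambda>_ z. (1/2) * (1 + z * z :: real))"
  have Y_simps: "Y 0 = 0" "Y (Suc n) = (1/2) *\<^sub>R (R + (Y n o\<^sub>L Y n))" for n by (simp_all add: Y_def)
  have y_simps: "y 0 = 0" "y (Suc n) = (1/2) * (1 + y n * y n)" for n by (simp_all add: y_def)
  have y01: "0 \<le> y n \<and> y n \<le> 1" for n
  proof (induction n)
    case (Suc n)
    then have "y n * y n \<le> 1 * 1" by (intro mult_mono) auto
    then show ?case using Suc by (simp add: y_simps)
  qed (simp add: y_simps)
  have Yy: "norm (Y n) \<le> y n" for n
  proof (induction n)
    case (Suc n)
    have "norm (Y n o\<^sub>L Y n) \<le> norm (Y n) * norm (Y n)" by (rule norm_blinfun_compose)
    also have "\<dots> \<le> y n * y n" using Suc y01 by (intro mult_mono) auto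
    finally have "norm (R + (Y n o\<^sub>L Y n)) \<le> 1 + y n * y n"
      using norm_triangle_mono[OF normR] by blast
    then show ?case by (simp add: Y_simps y_simps)
  qed (simp add: Y_simps y_simps)
  have step: "norm (Y (Suc n) - Y n) \<le> y (Suc n) - y n" for n
  proof (induction n)
    case 0
    then show ?case using normR by (simp add: Y_simps y_simps)
  next
    case (Suc n)
    let ?d = "Y (Suc n) - Y n"
    \<comment> \<open>The difference of two squares is split as \<open>Y (Suc n)\<close> composed
      with \<open>?d\<close> plus \<open>?d\<close> composed with \<open>Y n\<close>, which needs no
      commutation.\<close>
    have eq: "Y (Suc (Suc n)) - Y (Suc n)
        = (1/2) *\<^sub>R ((Y (Suc n) o\<^sub>L ?d) + (?d o\<^sub>L Y n))"
      unfolding Y_simps(2)[of "Suc n"] Y_simps(2)[of n, THEN arg_cong, of "\<lambda>Z. W - Z" for W]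
      by (simp add: bounded_bilinear.diff_left[OF bounded_bilinear_blinfun_compose]
          bounded_bilinear.diff_right[OF bounded_bilinear_blinfun_compose] algebra_simps
          flip: scaleR_diff_right)
    have a: "norm (Y (Suc n) o\<^sub>L ?d) \<le> y (Suc n) * (y (Suc n) - y n)"
      using Suc Yy[of "Suc n"] y01[of "Suc n"]
      by (intro order_trans[OF norm_blinfun_compose] mult_mono) auto
    have b: "norm (?d o\<^sub>L Y n) \<le> (y (Suc n) - y n) * y n"
      using Suc Yy[of n] order_trans[OF norm_ge_zero Suc]
      by (intro order_trans[OF norm_blinfun_compose] mult_mono) auto
    have "norm (Y (Suc (Suc n)) - Y (Suc n))
        \<le> (1/2) * (y (Suc n) * (y (Suc n) - y n) + (y (Suc n) - y n) * y n)"
      unfolding eq using norm_triangle_mono[OF a b] by simp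
    also have "\<dots> = y (Suc (Suc n)) - y (Suc n)"
      unfolding y_simps(2)[of "Suc n"] by (simp add: y_simps(2)[of n] algebra_simps)
    finally show ?case .
  qed
  have "summable (\<lambda>n. y (Suc n) - y n)"
  proof (rule summableI_nonneg_bounded)
    show "0 \<le> y (Suc n) - y n" for n using order_trans[OF norm_ge_zero step] .
    show "(\<Sum>i<n. y (Suc i) - y i) \<le> 1" for n
      using y01[of n] by (simp add: sum_lessThan_telescope y_simps(1))
  qed
  then have "summable (\<lambda>n. Y (Suc n) - Y n)"
    by (rule summable_comparison_test') (use step in auto)
  then have "convergent Y"
    by (simp add: summable_iff_convergent sum_lessThan_telescope Y_simps(1))
  then obtain Q where Q: "Y \<longlonglongrightarrow> Q" by (auto simp: convergent_def)
  have "(\<lambda>n. Y (Suc n)) \<longlonglongrightarrow> (1/2) *\<^sub>R (R + (Q o\<^sub>L Q))"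
    unfolding Y_simps
    by (intro tendsto_intros bounded_bilinear.tendsto[OF bounded_bilinear_blinfun_compose] Q)
  from LIMSEQ_unique[OF this LIMSEQ_Suc[OF Q]] have Q_fix: "R + (Q o\<^sub>L Q) = 2 *\<^sub>R Q"
    by (metis (no_types) scaleR_one scaleR_scaleR divide_self_if mult.commute
        nonzero_mult_div_cancel_left times_divide_eq_right zero_neq_numeral)
  have Qx: "(\<lambda>n. Y n x) \<longlonglongrightarrow> Q x" for x
    by (intro blinfun.tendsto Q tendsto_const)
  have Q_fix_apply: "R0 x + Q (Q x) = 2 *\<^sub>R Q x" for x
    using arg_cong[OF Q_fix, of "\<lambda>Z. Z x"] by (simp add: blinfun.bilinear_simps R)
  have YA: "blinfun_apply (Y n) \<in> A" for n
  proof (induction n)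
    case 0
    then show ?case using mem_scaleC[OF mem_id, of 0] by (simp add: Y_simps zero_blinfun.rep_eq)
  next
    case (Suc n)
    have "blinfun_apply (Y (Suc n)) = (\<lambda>x. complex_of_real (1/2) *\<^sub>C (R0 x + Y n (Y n x)))"
      by (auto simp: Y_simps blinfun.bilinear_simps R fun_eq_iff simp flip: scaleC_of_real)
    then show ?case using mem_scaleC[OF mem_add[OF R0 mem_compose[OF Suc Suc]]] by simp
  qed
  have Yadj: "cinner (Y n u) v = cinner u (Y n v)" for n u v
  proof (induction n arbitrary: u v)
    case (Suc n)
    then show ?case
      by (simp add: Y_simps blinfun.bilinear_simps R R0_def cinner.scaleR_left cinner.scaleR_right
          cinner_add_left cinner_add_right cinner.diff_left cinner.diff_right adj)
  qed (simp add: Y_simps cinner.zero_left cinner.zero_right)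
  have QA: "blinfun_apply Q \<in> A"
  proof (rule mem_if_commute)
    have "Q (c *\<^sub>C x) = c *\<^sub>C Q x" for c x
    proof (rule LIMSEQ_unique[OF Qx])
      show "(\<lambda>n. Y n (c *\<^sub>C x)) \<longlonglongrightarrow> c *\<^sub>C Q x"
        using bounded_clinear_tendsto[OF bounded_clinear_scaleC_id Qx]
        by (simp add: bounded_clinear_scaleC[OF bounded_clinear_mem[OF YA]])
    qed
    then show "bounded_clinear Q"
      by (simp add: bounded_clinear_def blinfun.bounded_linear_right)
    fix S x assume S: "S \<in> commutant A"
    then have lin: "bounded_clinear S" by (simp add: commutant_def)
    show "S (Q x) = Q (S x)"
      using LIMSEQ_unique[OF bounded_clinear_tendsto[OF lin Qx] Qx[of "S x", folded commute_mem[OF YA S]]]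
      by simp
  qed
  have Qadj: "cinner (Q u) v = cinner u (Q v)" for u v
  proof (rule LIMSEQ_unique)
    show "(\<lambda>n. cinner (Y n u) v) \<longlonglongrightarrow> cinner (Q u) v"
      by (intro cinner.tendsto Qx tendsto_const)
    show "(\<lambda>n. cinner (Y n u) v) \<longlonglongrightarrow> cinner u (Q v)"
      unfolding Yadj by (intro cinner.tendsto Qx tendsto_const)
  qed
  define B where "B = (\<lambda>x. x - Q x)"
  show thesis
  proof (rule that)
    show "B \<in> A" unfolding B_def by (rule mem_diff[OF mem_id QA])
    show "is_adjoint B B" by (simp add: is_adjoint_def B_def cinner.diff_left cinner.diff_right Qadj)
    show "B (B x) = X' (X x)" for x
      using Q_fix_apply[of x] by (simp add: B_def R0_def blinfun.bilinear_simps algebra_simps scaleR_2)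
  qed
qed


text \<open>If \<open>B\<close> is self-adjoint with square \<open>X' X\<close>, then
  \<open>B x\<close> and \<open>X x\<close> have equal norms, so \<open>B x\<close> is sent to
  \<open>X x\<close> by an isometry, which extends to the closure of the range of \<open>B\<close>.
  That closure is the orthogonal complement of \<open>ker X\<close>; composing with the projection
  onto it gives the partial isometry \<open>V\<close>.\<close>

lemma mvn_equivalent_polar_contraction:
  assumes X: "X \<in> A" and le: "\<And>x. norm (X x) \<le> norm x"
  shows "mvn_equivalent A (cproj (orth_compl (ker X))) (cproj (closure (range X)))"
proof -
  obtain X' where X': "X' \<in> A" "is_adjoint X' X" by (rule ex_adjoint_mem[OF X])
  obtain B where B: "B \<in> A" "is_adjoint B B" "\<And>x. B (B x) = X' (X x)"
    using mem_contraction_sqrt[OF X X'(2,1) le] by blast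
  note linX = bounded_clinear_mem[OF X] and linB = bounded_clinear_mem[OF B(1)]
  have BX: "cinner (B u) (B v) = cinner (X u) (X v)" for u v
    using is_adjointD[OF B(2), of "B u" v] is_adjointD[OF X'(2), of "X u" v] by (simp add: B(3))
  have normBX: "norm (B u) = norm (X u)" for u
    using BX[of u u] by (simp add: cinner_self flip: of_real_power)
  have kerBX: "ker B = ker X" by (auto simp: ker_def) (metis normBX norm_eq_zero)+
  define L where "L = orth_compl (ker X)"
  have L: "affil L" unfolding L_def by (intro affil_orth_compl affil_ker X)
  note L' = affil_closed_csubspace[OF L]
  have L_closure: "L = closure (range B)"
    using closure_range_eq[OF B(2) linB] by (simp add: L_def kerBX)
  \<comment> \<open>The closure of the graph of the isometry sending \<open>B x\<close> to \<open>X x\<close>.\<close>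
  define G where "G y v \<longleftrightarrow> (\<exists>u::nat \<Rightarrow> 'a. (\<lambda>n. B (u n)) \<longlonglongrightarrow> y \<and> (\<lambda>n. X (u n)) \<longlonglongrightarrow> v)" for y v
  \<comment> \<open>Equality of norms carries the Cauchy property from \<open>B (u n)\<close> to
    \<open>X (u n)\<close>.\<close>
  have G_ex: "\<exists>v. G y v" if yL: "y \<in> L" for y
  proof -
    obtain f where f: "\<And>n. f n \<in> range B" "f \<longlonglongrightarrow> y"
      using yL unfolding L_closure closure_sequential by blast
    then have "\<exists>x. f n = B x" for n by blast
    then obtain u where "\<And>n. f n = B (u n)" by metis
    then have u: "f = (\<lambda>n. B (u n))" by blast
    have "Cauchy f" using f(2) by (rule LIMSEQ_imp_Cauchy)
    then have "Cauchy (\<lambda>n. X (u n))"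
      by (simp add: Cauchy_def dist_norm u normBX
          flip: bounded_clinear_diff[OF linX] bounded_clinear_diff[OF linB])
    then obtain v where "(\<lambda>n. X (u n)) \<longlonglongrightarrow> v" using Cauchy_convergent convergent_def by blast
    then show ?thesis using f(2) unfolding G_def u by blast
  qed
  \<comment> \<open>Preservation of inner products yields both that the relation \<open>G\<close> is
    single-valued and that the map it defines is isometric.\<close>
  have G_cinner: "cinner v v' = cinner y y'" if G: "G y v" "G y' v'" for y v y' v'
  proof -
    obtain u u' where u: "(\<lambda>n. B (u n)) \<longlonglongrightarrow> y" "(\<lambda>n. X (u n)) \<longlonglongrightarrow> v"
        "(\<lambda>n. B (u' n)) \<longlonglongrightarrow> y'" "(\<lambda>n. X (u' n)) \<longlonglongrightarrow> v'"
      using G by (auto simp: G_def)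
    show ?thesis
      using LIMSEQ_unique[OF cinner.tendsto[OF u(2,4)] cinner.tendsto[OF u(1,3), unfolded BX]] .
  qed
  have G_unique: "v = v'" if "G y v" "G y v'" for y v v'
  proof -
    have "cinner (v - v') (v - v') = 0"
      by (simp add: cinner.diff_left cinner.diff_right G_cinner[OF that(1,1)] G_cinner[OF that(1,2)]
          G_cinner[OF that(2,1)] G_cinner[OF that(2,2)])
    then show ?thesis by simp
  qed
  have G_add: "G (y + y') (v + v')" if G: "G y v" "G y' v'" for y v y' v'
  proof -
    obtain u u' where u: "(\<lambda>n. B (u n)) \<longlonglongrightarrow> y" "(\<lambda>n. X (u n)) \<longlonglongrightarrow> v"
        "(\<lambda>n. B (u' n)) \<longlonglongrightarrow> y'" "(\<lambda>n. X (u' n)) \<longlonglongrightarrow> v'"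
      using G by (auto simp: G_def)
    show ?thesis
      unfolding G_def using tendsto_add[OF u(1,3)] tendsto_add[OF u(2,4)]
      by (intro exI[of _ "\<lambda>n. u n + u' n"]) (simp add: bounded_clinear_add linX linB)
  qed
  \<comment> \<open>One argument covers scalar multiplication and the operators of the commutant:
    the former gives homogeneity of \<open>V\<close>, the latter membership in
    \<open>A\<close>.\<close>
  have G_map: "G (S y) (S v)"
    if G: "G y v" and S: "bounded_clinear S" "\<And>x. S (B x) = B (S x)" "\<And>x. S (X x) = X (S x)" for S y v
  proof -
    obtain u where u: "(\<lambda>n. B (u n)) \<longlonglongrightarrow> y" "(\<lambda>n. X (u n)) \<longlonglongrightarrow> v"
      using G by (auto simp: G_def)
    show ?thesis
      unfolding G_def
      using bounded_clinear_tendsto[OF S(1) u(1)] bounded_clinear_tendsto[OF S(1) u(2)]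
      by (intro exI[of _ "\<lambda>n. S (u n)"]) (simp add: S(2,3))
  qed
  have G_closure: "v \<in> closure (range X)" if G: "G y v" for y v
  proof -
    obtain u where "(\<lambda>n. X (u n)) \<longlonglongrightarrow> v" using G by (auto simp: G_def)
    then show ?thesis unfolding closure_sequential by (intro exI[of _ "\<lambda>n. X (u n)"]) simp
  qed
  define P where "P = cproj L"
  have P: "P \<in> A" "bounded_clinear P" "is_adjoint P P" "\<And>x. P (P x) = P x" "\<And>x. P x \<in> L"
    "\<And>x. norm (P x) \<le> norm x"
    unfolding P_def
    by (fact cproj_mem[OF L] bounded_clinear_cproj[OF L'] is_adjoint_cproj[OF L'] cproj_cproj[OF L']
        cproj_in[OF L'] norm_cproj_le[OF L'])+
  define V where "V x = (THE v. G (P x) v)" for x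
  have GV: "G (P x) (V x)" for x
    unfolding V_def by (rule theI', rule ex_ex1I, rule G_ex[OF P(5)], rule G_unique)
  have V_eq: "V x = v" if "G (P x) v" for x v by (rule G_unique[OF GV that])
  have V_cinner: "cinner (V x) (V y) = cinner (P x) (P y)" for x y by (rule G_cinner[OF GV GV])
  have V_norm: "norm (V x) = norm (P x)" for x
    using V_cinner[of x x] by (simp add: cinner_self flip: of_real_power)
  have linV: "bounded_clinear V"
  proof (rule bounded_clinearI[where K = 1])
    show "V (x + y) = V x + V y" for x y
      by (rule V_eq) (simp add: bounded_clinear_add[OF P(2)] G_add[OF GV GV])
    show "V (c *\<^sub>C x) = c *\<^sub>C V x" for c x
      by (rule V_eq)
         (simp add: bounded_clinear_scaleC[OF P(2)] bounded_clinear_scaleC[OF linB]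
           bounded_clinear_scaleC[OF linX] G_map[OF GV bounded_clinear_scaleC_id])
  qed (simp add: V_norm P(6))
  have VA: "V \<in> A"
  proof (rule mem_if_commute[OF linV])
    fix S x assume S: "S \<in> commutant A"
    then have "bounded_clinear S" by (simp add: commutant_def)
    from G_map[OF GV this commute_mem[OF B(1) S] commute_mem[OF X S]]
    show "S (V x) = V (S x)" by (intro V_eq[symmetric]) (simp add: commute_mem[OF P(1) S])
  qed
  have VB: "V (B x) = X x" for x
  proof (rule V_eq)
    have "B x \<in> L" unfolding L_closure by (rule subsetD[OF closure_subset]) simp
    then have "P (B x) = B x" by (simp add: P_def cproj_eq_self_iff[OF L'])
    then show "G (P (B x)) (X x)" unfolding G_def by (intro exI[of _ "\<lambda>_. x"]) simp
  qed
  obtain W where W: "W \<in> A" "is_adjoint W V" by (rule ex_adjoint_mem[OF VA])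
  note adj = is_adjointD[OF W(2)] is_adjointD[OF is_adjoint_sym[OF W(2)]]
  have WV: "W (V x) = P x" for x
    by (rule cinner_ext_left) (simp add: adj(1) V_cinner is_adjointD[OF P(3), symmetric] P(4))
  \<comment> \<open>The adjoint form of \<open>V P = V\<close>.\<close>
  have PW: "P (W x) = W x" for x
  proof (rule cinner_ext_left)
    have "V (P y) = V y" for y by (simp add: V_def P(4))
    then show "cinner (P (W x)) y = cinner (W x) y" for y
      by (simp add: is_adjointD[OF P(3)] adj(1))
  qed
  have VW: "cproj (closure (range X)) x = V (W x)" for x
  proof (rule cproj_eqI)
    \<comment> \<open>Since \<open>X y = V (B y)\<close>, moving \<open>V\<close> across leaves
      \<open>W x - W (V (W x))\<close>, which is zero because \<open>W V = P\<close> and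
      \<open>P W = W\<close>.\<close>
    have "cinner (X y) (x - V (W x)) = 0" for y
    proof -
      have "cinner (V (B y)) (x - V (W x)) = cinner (B y) (W x - W (V (W x)))"
        by (simp add: adj(2) bounded_clinear_diff[OF bounded_clinear_mem[OF W(1)]])
      then show ?thesis by (simp add: VB WV PW cinner.zero_right)
    qed
    then show "x - V (W x) \<in> orth_compl (closure (range X))"
      unfolding orth_compl_closure by (auto simp: orth_compl_def)
  qed (simp_all add: closed_csubspace_closure_range linX G_closure[OF GV])
  show ?thesis
    unfolding mvn_equivalent_def
    by (intro bexI[OF _ VA] bexI[OF _ W(1)] conjI W(2))
       (simp_all add: fun_eq_iff WV VW P_def L_def)
qed

text \<open>Dividing by a norm bound gives a contraction with the same kernel and the same
  range.\<close>

lemma mvn_equivalent_polar: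
  assumes X: "X \<in> A"
  shows "mvn_equivalent A (cproj (orth_compl (ker X))) (cproj (closure (range X)))"
proof -
  obtain c where c: "c > 0" "\<And>x. norm (X x) \<le> c * norm x"
    using bounded_clinear_bound[OF bounded_clinear_mem[OF X]] by blast
  define Y where "Y = (\<lambda>x. complex_of_real (1 / c) *\<^sub>C X x)"
  have "mvn_equivalent A (cproj (orth_compl (ker Y))) (cproj (closure (range Y)))"
  proof (rule mvn_equivalent_polar_contraction)
    show "Y \<in> A" unfolding Y_def by (rule mem_scaleC[OF X])
    show "norm (Y x) \<le> norm x" for x
      using c by (simp add: Y_def norm_scaleC norm_divide divide_le_eq mult.commute)
  qed
  moreover have "ker Y = ker X" using c by (auto simp: ker_def Y_def)
  moreover have "range Y = range X"
  proof -
    have "X x = Y (complex_of_real c *\<^sub>C x)" "Y x = X (complex_of_real (1 / c) *\<^sub>C x)" for x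
      using c by (simp_all add: Y_def bounded_clinear_scaleC[OF bounded_clinear_mem[OF X]] scaleC_scaleC
          flip: of_real_mult)
    then have "X x \<in> range Y" "Y x \<in> range X" for x by (metis rangeI)+
    then show ?thesis by blast
  qed
  ultimately show ?thesis by simp
qed

text \<open>The polar decomposition of \<open>Z\<close> composed with \<open>cproj L\<close>
  replaces an injective map that is not isometric by a partial isometry with the same initial and
  final spaces.\<close>

lemma mvn_equivalent_image:
  assumes L: "affil L" and Z: "Z \<in> A" and inj: "\<And>x. x \<in> L \<Longrightarrow> Z x = 0 \<Longrightarrow> x = 0"
    and closed: "closed (Z ` L)"
  shows "mvn_equivalent A (cproj L) (cproj (Z ` L))"
proof -
  note L' = affil_closed_csubspace[OF L]
  define X where "X = (\<lambda>x. Z (cproj L x))"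
  have "X \<in> A" unfolding X_def by (rule mem_compose[OF Z cproj_mem[OF L]])
  moreover have "ker X = orth_compl L"
    using inj[OF cproj_in[OF L']] bounded_clinear_zero[OF bounded_clinear_mem[OF Z]]
    by (auto simp: ker_def X_def cproj_eq_0_iff[OF L', symmetric])
  moreover have "range X = Z ` L" unfolding X_def by (metis image_image range_cproj[OF L'])
  ultimately show ?thesis using mvn_equivalent_polar[of X] closed by (simp add: orth_compl_orth_compl[OF L'])
qed

subsection \<open>Inverses\<close>

text \<open>\<open>X\<close> maps the complement of its kernel bijectively onto its range, with a
  bounded inverse because the range is closed. The inverse is determined by its values' defining
  equation, so it commutes with the commutant.\<close>

lemma moore_penrose_mem:
  assumes X: "X \<in> A" and closed: "closed (range X)"
  obtains G where "G \<in> A" "\<And>x. X (G x) = cproj (range X) x"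
    "\<And>x. G (X x) = cproj (orth_compl (ker X)) x"
proof -
  note linX = bounded_clinear_mem[OF X]
  define L where "L = orth_compl (ker X)"
  have L: "affil L" unfolding L_def by (intro affil_orth_compl affil_ker X)
  note L' = affil_closed_csubspace[OF L]
  have R: "affil (range X)" by (rule affil_range[OF X closed])
  note R' = affil_closed_csubspace[OF R]
  have XL: "X (cproj L u) = X u" for u
  proof -
    have "u - cproj L u \<in> orth_compl L" by (rule diff_cproj_in[OF L'])
    then have "u - cproj L u \<in> ker X"
      unfolding L_def orth_compl_orth_compl[OF closed_csubspace_ker[OF linX]] .
    then show ?thesis by (simp add: ker_def bounded_clinear_diff[OF linX])
  qed
  obtain c where c: "c > 0" "\<And>x. x \<in> L \<Longrightarrow> norm x \<le> c * norm (X x)"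
    unfolding L_def using closed_range_bounded_below[OF linX closed] by blast
  have unique: "x = x'" if "x \<in> L" "x' \<in> L" "X x = X x'" for x x'
    using c(2)[OF closed_csubspace_diff[OF L' that(1,2)]] that(3)
    by (simp add: bounded_clinear_diff[OF linX])
  define G where "G y = (THE x. x \<in> L \<and> X x = cproj (range X) y)" for y
  have G: "G y \<in> L \<and> X (G y) = cproj (range X) y" for y
    unfolding G_def
  proof (rule theI')
    obtain u where "cproj (range X) y = X u" using cproj_in[OF R', of y] by blast
    then have "X (cproj L u) = cproj (range X) y" by (simp add: XL)
    then show "\<exists>!x. x \<in> L \<and> X x = cproj (range X) y"
      using unique cproj_in[OF L'] by metis
  qed
  have G_eq: "G y = x" if "x \<in> L" "X x = cproj (range X) y" for x y
    using unique G that by metis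
  note linR = bounded_clinear_cproj[OF R']
  have linG: "bounded_clinear G"
  proof (rule bounded_clinearI[where K = c])
    show "G (x + y) = G x + G y" for x y
      by (rule G_eq) (simp_all add: G closed_csubspace_add[OF L'] bounded_clinear_add linX linR)
    show "G (a *\<^sub>C x) = a *\<^sub>C G x" for a x
      by (rule G_eq) (simp_all add: G closed_csubspace_scaleC[OF L'] bounded_clinear_scaleC linX linR)
    show "norm (G x) \<le> norm x * c" for x
    proof -
      have "norm (G x) \<le> c * norm (cproj (range X) x)" using c(2)[of "G x"] G by simp
      also have "\<dots> \<le> c * norm x" using c(1) norm_cproj_le[OF R'] by (intro mult_left_mono) auto
      finally show ?thesis by (simp add: mult.commute)
    qed
  qed
  have "G \<in> A"
  proof (rule mem_if_commute[OF linG])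
    fix S x assume S: "S \<in> commutant A"
    show "S (G x) = G (S x)"
    proof (rule G_eq[symmetric])
      show "S (G x) \<in> L" using L S G by (simp add: affil_def)
      show "X (S (G x)) = cproj (range X) (S x)"
        using commute_mem[OF X S] commute_mem[OF cproj_mem[OF R] S] G by metis
    qed
  qed
  moreover have "G (X x) = cproj L x" for x
    by (rule G_eq) (simp_all add: cproj_in[OF L'] XL cproj_eq_self_iff[OF R', THEN iffD2])
  ultimately show thesis using that G by (simp add: L_def)
qed

text \<open>\<open>Z x\<close> is the fixed point of the contraction sending \<open>z\<close> to
  \<open>x + \<mu> *\<^sub>C G z\<close>. Uniqueness of the fixed point gives linearity and
  commutation with the commutant without summing a series.\<close>

lemma neumann_inverse_mem:
  assumes G: "G \<in> A" and g: "\<And>x. norm (G x) \<le> g * norm x" "g > 0" "cmod \<mu> * g < 1"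
  obtains Z where "Z \<in> A" "\<And>x. Z x = x + \<mu> *\<^sub>C G (Z x)" "\<And>x. Z x = x + \<mu> *\<^sub>C Z (G x)"
proof -
  note linG = bounded_clinear_mem[OF G]
  have ex1: "\<exists>!z. x + \<mu> *\<^sub>C G z = z" for x
  proof (rule banach_fix_type[of "cmod \<mu> * g" "\<lambda>z. x + \<mu> *\<^sub>C G z"])
    show "\<forall>y z. dist (x + \<mu> *\<^sub>C G y) (x + \<mu> *\<^sub>C G z) \<le> cmod \<mu> * g * dist y z"
    proof (intro allI)
      fix y z
      have "dist (x + \<mu> *\<^sub>C G y) (x + \<mu> *\<^sub>C G z) = cmod \<mu> * norm (G (y - z))"
        by (simp add: dist_norm bounded_clinear_diff[OF linG] flip: norm_scaleC scaleC_diff_right)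
      also have "\<dots> \<le> cmod \<mu> * (g * norm (y - z))" by (intro mult_left_mono g) simp
      finally show "dist (x + \<mu> *\<^sub>C G y) (x + \<mu> *\<^sub>C G z) \<le> cmod \<mu> * g * dist y z"
        by (simp add: dist_norm mult.assoc)
    qed
  qed (use g in auto)
  define Z where "Z x = (THE z. x + \<mu> *\<^sub>C G z = z)" for x
  have Z: "x + \<mu> *\<^sub>C G (Z x) = Z x" for x unfolding Z_def by (rule theI'[OF ex1])
  have Z_eq: "Z x = z" if "x + \<mu> *\<^sub>C G z = z" for x z using ex1 Z that by blast
  have linZ: "bounded_clinear Z"
  proof (rule bounded_clinearI[where K = "1 / (1 - cmod \<mu> * g)"])
    show "Z (x + y) = Z x + Z y" for x y
    proof (rule Z_eq)
      have "(x + y) + \<mu> *\<^sub>C G (Z x + Z y) = (x + \<mu> *\<^sub>C G (Z x)) + (y + \<mu> *\<^sub>C G (Z y))"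
        by (simp add: bounded_clinear_add[OF linG] scaleC_add_right)
      then show "(x + y) + \<mu> *\<^sub>C G (Z x + Z y) = Z x + Z y" by (simp add: Z)
    qed
    show "Z (c *\<^sub>C x) = c *\<^sub>C Z x" for c x
    proof (rule Z_eq)
      have "c *\<^sub>C x + \<mu> *\<^sub>C G (c *\<^sub>C Z x) = c *\<^sub>C (x + \<mu> *\<^sub>C G (Z x))"
        by (simp add: bounded_clinear_scaleC[OF linG] scaleC_add_right scaleC_scaleC mult.commute)
      then show "c *\<^sub>C x + \<mu> *\<^sub>C G (c *\<^sub>C Z x) = c *\<^sub>C Z x" by (simp add: Z)
    qed
    show "norm (Z x) \<le> norm x * (1 / (1 - cmod \<mu> * g))" for x
    proof -
      have "norm (Z x) \<le> norm x + norm (\<mu> *\<^sub>C G (Z x))"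
        using norm_triangle_ineq[of x "\<mu> *\<^sub>C G (Z x)"] by (simp add: Z)
      also have "norm (\<mu> *\<^sub>C G (Z x)) \<le> cmod \<mu> * (g * norm (Z x))"
        unfolding norm_scaleC by (intro mult_left_mono g) simp
      finally show ?thesis using g(3) by (simp add: field_simps)
    qed
  qed
  have ZA: "Z \<in> A"
  proof (rule mem_if_commute[OF linZ])
    fix S x assume S: "S \<in> commutant A"
    then have linS: "bounded_clinear S" by (simp add: commutant_def)
    have "S x + \<mu> *\<^sub>C G (S (Z x)) = S (x + \<mu> *\<^sub>C G (Z x))"
      by (simp add: bounded_clinear_simps[OF linS] commute_mem[OF G S])
    then show "S (Z x) = Z (S x)" by (intro Z_eq[symmetric]) (simp add: Z)
  qed
  \<comment> \<open>Uniqueness also makes \<open>Z\<close> a left inverse of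
    \<open>1 - \<mu> G\<close>, which is the second identity.\<close>
  have "Z (x - \<mu> *\<^sub>C G x) = x" for x by (rule Z_eq) simp
  then have "Z x = x + \<mu> *\<^sub>C Z (G x)" for x
    by (metis bounded_clinear_diff bounded_clinear_scaleC diff_add_cancel linZ)
  then show thesis using that ZA Z by metis
qed


subsection \<open>Finite projections\<close>

lemma projectionsD:
  assumes "E \<in> projections A"
  shows "E \<in> A" "bounded_clinear E" "E (E x) = E x" "cinner (E x) y = cinner x (E y)"
  using assms by (simp_all add: projections_def fun_eq_iff is_adjoint_def)

lemma projections_range_eqI:
  "E \<in> projections A \<Longrightarrow> F \<in> projections A \<Longrightarrow> range E = range F \<Longrightarrow> E = F"
  using projections_cproj(2) by metis

lemma projections_subset:
  assumes E: "E \<in> projections A" and F: "F \<in> projections A" and sub: "range F \<subseteq> range E"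
  shows "E (F x) = F x" "F (E x) = F x"
proof -
  show *: "E (F x) = F x" for x
    using sub projectionsD(3)[OF E] by (metis imageE rangeI subsetD)
  show "F (E x) = F x"
    by (rule cinner_ext_left) (simp add: projectionsD(4)[OF E] projectionsD(4)[OF F] *)
qed

text \<open>Adds the support relations of the partial isometry: \<open>V\<close> kills
  \<open>x - E x\<close> because the squared norm of the image is the inner product of
  \<open>E (x - E x) = 0\<close> with \<open>x - E x\<close>. The same argument with the roles
  exchanged treats \<open>W\<close>.\<close>

lemma mvn_equivalentE:
  assumes E: "E \<in> projections A" and F: "F \<in> projections A" and "mvn_equivalent A E F"
  obtains V W where "V \<in> A" "W \<in> A" "\<And>x y. cinner (W x) y = cinner x (V y)"
    "\<And>x. W (V x) = E x" "\<And>x. V (W x) = F x" "\<And>x. V (E x) = V x" "\<And>x. F (V x) = V x"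
    "\<And>x. W (F x) = W x" "\<And>x. E (W x) = W x"
proof -
  obtain V W where VW: "V \<in> A" "W \<in> A" "is_adjoint W V" "\<And>x. W (V x) = E x" "\<And>x. V (W x) = F x"
    using assms(3) by (auto simp: mvn_equivalent_def fun_eq_iff)
  have initial: "V (E x) = V x"
    if E: "E \<in> projections A" and V: "V \<in> A" "is_adjoint W V" "\<And>x. W (V x) = E x" for V W E x
  proof -
    have "cinner (V (x - E x)) (V (x - E x)) = cinner (W (V (x - E x))) (x - E x)"
      by (simp add: is_adjointD[OF V(2)])
    also have "\<dots> = 0"
      by (simp add: V(3) bounded_clinear_diff[OF projectionsD(2)[OF E]] projectionsD(3)[OF E] cinner.zero_left)
    finally show ?thesis by (simp add: bounded_clinear_diff[OF bounded_clinear_mem[OF V(1)]])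
  qed
  have V: "V (E x) = V x" for x by (rule initial[OF E VW(1,3,4)])
  have W: "W (F x) = W x" for x by (rule initial[OF F VW(2) is_adjoint_sym[OF VW(3)] VW(5)])
  show thesis
  proof (rule that[OF VW(1,2) is_adjointD[OF VW(3)] VW(4,5) V _ W])
    show "F (V x) = V x" for x using VW(4,5) V by metis
    show "E (W x) = W x" for x using VW(4,5) W by metis
  qed
qed

lemma Proj0_projections: "E \<in> Proj0 A \<Longrightarrow> E \<in> projections A"
  by (simp add: Proj0_def)

lemma mvn_equivalentI:
  assumes "V \<in> A" "W \<in> A" "\<And>x y. cinner (W x) y = cinner x (V y)"
    "\<And>x. W (V x) = E x" "\<And>x. V (W x) = F x"
  shows "mvn_equivalent A E F"
  unfolding mvn_equivalent_def
  by (rule bexI[OF _ assms(1)], rule bexI[OF _ assms(2)])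
     (simp add: is_adjoint_def fun_eq_iff assms(3-))

text \<open>An equivalence of \<open>F\<close> with a proper subprojection is transported to \<open>E\<close> by conjugation.\<close>

lemma Proj0_mvn_equivalent:
  assumes E: "E \<in> Proj0 A" and F: "F \<in> projections A" and EF: "mvn_equivalent A E F"
  shows "F \<in> Proj0 A"
proof (rule ccontr)
  assume "F \<notin> Proj0 A"
  then obtain F' where F': "F' \<in> projections A" "range F' \<subset> range F" "mvn_equivalent A F F'"
    using F unfolding Proj0_def by blast
  note E' = Proj0_projections[OF E]
  obtain V W where V: "V \<in> A" "W \<in> A" "\<And>x y. cinner (W x) y = cinner x (V y)"
    "\<And>x. W (V x) = E x" "\<And>x. V (W x) = F x" "\<And>x. V (E x) = V x" "\<And>x. F (V x) = V x"
    "\<And>x. W (F x) = W x" "\<And>x. E (W x) = W x"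
    using mvn_equivalentE[OF E' F EF] by blast
  obtain V2 W2 where V2: "V2 \<in> A" "W2 \<in> A" "\<And>x y. cinner (W2 x) y = cinner x (V2 y)"
    "\<And>x. W2 (V2 x) = F x" "\<And>x. V2 (W2 x) = F' x" "\<And>x. V2 (F x) = V2 x" "\<And>x. F' (V2 x) = V2 x"
    "\<And>x. W2 (F' x) = W2 x" "\<And>x. F (W2 x) = W2 x"
    using mvn_equivalentE[OF F F'(1,3)] by blast
  have FF': "F (F' x) = F' x" "F' (F x) = F' x" for x
    using projections_subset[OF F F'(1)] F'(2) by auto
  have FV2: "F (V2 x) = V2 x" for x by (metis FF'(1) V2(7))
  have Vadj: "cinner (V x) y = cinner x (W y)" for x y by (metis V(3) cinner_commute)
  define H where "H x = W (F' (V x))" for x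
  have "H \<in> A"
    unfolding H_def by (rule mem_compose[OF V(2) mem_compose[OF projectionsD(1)[OF F'(1)] V(1)]])
  moreover have "H (H x) = H x" for x
    by (simp add: H_def V(5) FF' projectionsD(3)[OF F'(1)])
  moreover have "cinner (H x) y = cinner x (H y)" for x y
    by (simp add: H_def V(3) Vadj projectionsD(4)[OF F'(1)])
  ultimately have H: "H \<in> projections A"
    by (simp add: projections_def bounded_clinear_mem fun_eq_iff is_adjoint_def)
  \<comment> \<open>The equivalence is \<open>V2\<close>, which implements that of \<open>F\<close>
    with \<open>F'\<close>, conjugated by \<open>V\<close>.\<close>
  have "mvn_equivalent A E H"
  proof (rule mvn_equivalentI)
    show "(\<lambda>x. W (V2 (V x))) \<in> A" "(\<lambda>x. W (W2 (V x))) \<in> A"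
      by (rule mem_compose[OF V(2) mem_compose[OF V2(1) V(1)]],
          rule mem_compose[OF V(2) mem_compose[OF V2(2) V(1)]])
    show "cinner (W (W2 (V x))) y = cinner x (W (V2 (V y)))" for x y
      by (simp add: V(3) V2(3) Vadj)
    show "W (W2 (V (W (V2 (V x))))) = E x" for x by (simp add: V V2 FV2)
    show "W (V2 (V (W (W2 (V x))))) = H x" for x by (simp add: V V2 H_def)
  qed
  moreover have "range H \<subseteq> range E" unfolding H_def by (metis V(9) image_subsetI rangeI)
  ultimately have "range H = range E" using E H unfolding Proj0_def by blast
  then have "H = E" by (rule projections_range_eqI[OF H E'])
  \<comment> \<open>Conjugating back turns \<open>H = E\<close> into \<open>F' = F\<close>, against
    properness of the subprojection.\<close>
  have "F' x = F x" for x
  proof -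
    have "F' x = V (H (W x))" by (simp add: H_def V(5) FF')
    then show ?thesis by (simp add: \<open>H = E\<close> V)
  qed
  then show False using F'(2) by (simp add: image_def)
qed

text \<open>An equivalence of \<open>F\<close> with a proper subprojection extends to \<open>E\<close> by the identity on \<open>E - F\<close>.\<close>

lemma Proj0_subset:
  assumes E: "E \<in> Proj0 A" and F: "F \<in> projections A" and FE: "range F \<subseteq> range E"
  shows "F \<in> Proj0 A"
proof (rule ccontr)
  assume "F \<notin> Proj0 A"
  then obtain F' where F': "F' \<in> projections A" "range F' \<subset> range F" "mvn_equivalent A F F'"
    using F unfolding Proj0_def by blast
  note E' = Proj0_projections[OF E]
  obtain V W where V: "V \<in> A" "W \<in> A" "\<And>x y. cinner (W x) y = cinner x (V y)"
    "\<And>x. W (V x) = F x" "\<And>x. V (W x) = F' x" "\<And>x. V (F x) = V x" "\<And>x. F' (V x) = V x"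
    "\<And>x. W (F' x) = W x" "\<And>x. F (W x) = W x"
    using mvn_equivalentE[OF F F'(1,3)] by blast
  note absorb = projections_subset[OF E' F FE]
    projections_subset[OF F F'(1) psubset_imp_subset[OF F'(2)]]
    projections_subset[OF E' F'(1) order_trans[OF psubset_imp_subset[OF F'(2)] FE]]
    projectionsD(3)[OF E'] projectionsD(3)[OF F] projectionsD(3)[OF F'(1)]
  note lin = bounded_clinear_add bounded_clinear_diff projectionsD(2)[OF E'] projectionsD(2)[OF F]
    projectionsD(2)[OF F'(1)] bounded_clinear_mem[OF V(1)] bounded_clinear_mem[OF V(2)]
  note self_adjoint = projectionsD(4)[OF E'] projectionsD(4)[OF F] projectionsD(4)[OF F'(1)]
  note cinner_lin = cinner_add_left cinner_add_right cinner.diff_left cinner.diff_right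
  note memE = projectionsD(1)[OF E'] and memF = projectionsD(1)[OF F]
  \<comment> \<open>These absorption rules cancel the cross terms between \<open>V\<close>,
    \<open>W\<close> and \<open>E - F\<close> in the products below.\<close>
  have VE: "V (E x) = V x" for x by (metis V(6) absorb(2))
  have WE: "W (E x) = W x" for x by (metis V(8) absorb(6))
  have WF: "W (F x) = W x" for x by (metis V(8) absorb(4))
  have EV: "E (V x) = V x" for x by (metis V(7) absorb(5))
  have FV: "F (V x) = V x" for x by (metis V(7) absorb(3))
  have EW: "E (W x) = W x" for x by (metis V(9) absorb(1))
  define H where "H x = F' x + (E x - F x)" for x
  have "H \<in> A"
    unfolding H_def by (rule mem_add[OF projectionsD(1)[OF F'(1)] mem_diff[OF memE memF]])
  moreover have "H (H x) = H x" for x by (simp add: H_def lin absorb)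
  moreover have "cinner (H x) y = cinner x (H y)" for x y
    by (simp add: H_def cinner_lin self_adjoint)
  ultimately have H: "H \<in> projections A"
    by (simp add: projections_def bounded_clinear_mem fun_eq_iff is_adjoint_def)
  have "mvn_equivalent A E H"
  proof (rule mvn_equivalentI)
    show "(\<lambda>x. V x + (E x - F x)) \<in> A" "(\<lambda>x. W x + (E x - F x)) \<in> A"
      by (rule mem_add[OF V(1) mem_diff[OF memE memF]], rule mem_add[OF V(2) mem_diff[OF memE memF]])
    show "cinner (W x + (E x - F x)) y = cinner x (V y + (E y - F y))" for x y
      by (simp add: cinner_lin self_adjoint V(3))
    show "W (V x + (E x - F x)) + (E (V x + (E x - F x)) - F (V x + (E x - F x))) = E x" for x
      by (simp add: lin absorb V(4) WE WF EV FV)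
    show "V (W x + (E x - F x)) + (E (W x + (E x - F x)) - F (W x + (E x - F x))) = H x" for x
      by (simp add: lin absorb V(5,6,9) VE EW H_def)
  qed
  moreover have "range H \<subseteq> range E"
  proof -
    have "H x = E (H x)" for x by (simp add: H_def lin absorb)
    then show ?thesis by (metis image_subsetI rangeI)
  qed
  ultimately have "range H = range E" using E H unfolding Proj0_def by blast
  then have "H = E" by (rule projections_range_eqI[OF H E'])
  then have "F' x = F x" for x
    using H_def[of x] by (simp add: algebra_simps)
  then show False using F'(2) by (simp add: image_def)
qed

lemma cproj_Proj0_subset:
  assumes "cproj K \<in> Proj0 A" "closed_csubspace K" "affil L" "L \<subseteq> K"
  shows "cproj L \<in> Proj0 A"
  using Proj0_subset[OF assms(1) cproj_projections[OF assms(3)]] assms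
  by (simp add: range_cproj affil_closed_csubspace)

subsection \<open>Perturbation of closed-range operators\<close>

lemma diff_scaleC_mem: "T \<in> A \<Longrightarrow> (\<lambda>x. T x - \<mu> *\<^sub>C x) \<in> A"
  by (rule mem_diff[OF _ mem_scaleC[OF mem_id]])

text \<open>The bound \<epsilon> depends only on the norm of the Moore-Penrose inverse, hence is
  uniform in \<mu>. The operator \<open>D\<close> is the compression of \<open>Z\<close> from the
  kernel to the cokernel; the two inclusions make the complement of its kernel and the closure of
  its range orthogonal summands of these spaces.\<close>

lemma closed_range_perturbation:
  assumes T: "T \<in> A" and closed: "closed (range T)"
  obtains \<epsilon> where "\<epsilon> > 0"
    "\<And>\<mu>. 0 < cmod \<mu> \<Longrightarrow> cmod \<mu> < \<epsilon> \<Longrightarrow> \<exists>D\<in>A. \<exists>D'. is_adjoint D' D \<and>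
      orth_compl (ker D) \<subseteq> ker T \<and> closure (range D) \<subseteq> orth_compl (range T) \<and>
      mvn_equivalent A (cproj (ker T \<inter> ker D)) (cproj (ker (\<lambda>x. T x - \<mu> *\<^sub>C x))) \<and>
      mvn_equivalent A (cproj (orth_compl (range T) \<inter> ker D'))
        (cproj (orth_compl (range (\<lambda>x. T x - \<mu> *\<^sub>C x))))"
proof -
  define K where "K = ker T"
  define C where "C = orth_compl (range T)"
  have K: "affil K" unfolding K_def by (rule affil_ker[OF T])
  have C: "affil C" unfolding C_def by (rule affil_orth_compl_range[OF T])
  have R: "affil (range T)" by (rule affil_range[OF T closed])
  note K' = affil_closed_csubspace[OF K] and C' = affil_closed_csubspace[OF C]
    and R' = affil_closed_csubspace[OF R]
  note KO = closed_csubspace_orth_compl[of K]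
  obtain G where G: "G \<in> A" "\<And>x. T (G x) = cproj (range T) x" "\<And>x. G (T x) = cproj (orth_compl K) x"
    unfolding K_def using moore_penrose_mem[OF T closed] by blast
  obtain g where g: "g > 0" "\<And>x. norm (G x) \<le> g * norm x"
    using bounded_clinear_bound[OF bounded_clinear_mem[OF G(1)]] by blast
  obtain T' where T': "T' \<in> A" "is_adjoint T' T" by (rule ex_adjoint_mem[OF T])
  obtain G' where G': "G' \<in> A" "is_adjoint G' G" by (rule ex_adjoint_mem[OF G(1)])
  have C_ker: "C = ker T'" unfolding C_def by (rule orth_compl_range[OF T'(2)])
  show thesis
  proof (rule that)
    show "1 / g > 0" using g by simp
  next
    fix \<mu> :: complex assume \<mu>: "0 < cmod \<mu>" "cmod \<mu> < 1 / g"
    have "cmod \<mu> * g < 1" using \<mu> g by (simp add: field_simps)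
    then obtain Z where Z: "Z \<in> A" "\<And>x. Z x = x + \<mu> *\<^sub>C G (Z x)" "\<And>x. Z x = x + \<mu> *\<^sub>C Z (G x)"
      using neumann_inverse_mem[OF G(1) g(2,1)] by blast
    obtain Z' where Z': "Z' \<in> A" "is_adjoint Z' Z" by (rule ex_adjoint_mem[OF Z(1)])
    note adj = is_adjointD[OF T'(2)] is_adjointD[OF G'(2)] is_adjointD[OF Z'(2)]
      is_adjointD[OF is_adjoint_cproj[OF K']] is_adjointD[OF is_adjoint_cproj[OF C']]
      is_adjointD[OF is_adjoint_cproj[OF KO]]
    \<comment> \<open>Adjoints reverse products, so each of the two identities for \<open>Z\<close>
      yields the other one for \<open>Z'\<close>.\<close>
    have Z'G': "Z' x = x + cnj \<mu> *\<^sub>C G' (Z' x)" "Z' x = x + cnj \<mu> *\<^sub>C Z' (G' x)" for x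
    proof -
      show "Z' x = x + cnj \<mu> *\<^sub>C G' (Z' x)"
      proof (rule cinner_ext_left)
        fix y
        have "cinner (Z' x) y = cinner x (y + \<mu> *\<^sub>C Z (G y))" using Z(3) adj(3) by metis
        then show "cinner (Z' x) y = cinner (x + cnj \<mu> *\<^sub>C G' (Z' x)) y"
          by (simp add: cinner_add_left cinner_add_right cinner_scaleC_left cinner_scaleC_right adj)
      qed
      show "Z' x = x + cnj \<mu> *\<^sub>C Z' (G' x)"
      proof (rule cinner_ext_left)
        fix y
        have "cinner (Z' x) y = cinner x (y + \<mu> *\<^sub>C G (Z y))" using Z(2) adj(3) by metis
        then show "cinner (Z' x) y = cinner (x + cnj \<mu> *\<^sub>C Z' (G' x)) y"
          by (simp add: cinner_add_left cinner_add_right cinner_scaleC_left cinner_scaleC_right adj)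
      qed
    qed
    note linZ = bounded_clinear_mem[OF Z(1)] and linZ' = bounded_clinear_mem[OF Z'(1)]
    define D where "D x = cproj C (Z (cproj K x))" for x
    define D' where "D' x = cproj K (Z' (cproj C x))" for x
    have D: "D \<in> A"
      unfolding D_def by (rule mem_compose[OF cproj_mem[OF C] mem_compose[OF Z(1) cproj_mem[OF K]]])
    have D': "D' \<in> A"
      unfolding D'_def by (rule mem_compose[OF cproj_mem[OF K] mem_compose[OF Z'(1) cproj_mem[OF C]]])
    have DD': "is_adjoint D' D" by (simp add: is_adjoint_def D_def D'_def adj)
    have orth_ker: "orth_compl (ker D) \<subseteq> K"
    proof -
      have "orth_compl K \<subseteq> ker D"
        by (auto simp: ker_def D_def cproj_eq_0_iff[OF K', THEN iffD2] bounded_clinear_zero[OF linZ]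
            bounded_clinear_zero[OF bounded_clinear_cproj[OF C']])
      then show ?thesis using orth_compl_antimono orth_compl_orth_compl[OF K'] by metis
    qed
    have closure_D: "closure (range D) \<subseteq> C"
      by (intro closure_minimal closed_csubspace_closed[OF C']) (auto simp: D_def cproj_in[OF C'])
    \<comment> \<open>For \<open>y\<close> in the kernel, \<open>D y\<close> is the cokernel
      component of \<open>Z y\<close>, and it vanishes exactly when \<open>Z y\<close> lies in the
      closed range.\<close>
    have KD: "K \<inter> ker D = {y \<in> ker T. Z y \<in> range T}"
    proof -
      have "D y = 0 \<longleftrightarrow> Z y \<in> range T" if "y \<in> K" for y
        using that
        by (simp add: D_def cproj_eq_self_iff[OF K', THEN iffD2] cproj_eq_0_iff[OF C'])
           (simp add: C_def orth_compl_orth_compl[OF R'])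
      then show ?thesis by (auto simp: K_def ker_def)
    qed
    have CD': "C \<inter> ker D' = {y \<in> ker T'. Z' y \<in> orth_compl K}"
    proof -
      have "D' y = 0 \<longleftrightarrow> Z' y \<in> orth_compl K" if "y \<in> C" for y
        using that
        by (simp add: D'_def cproj_eq_self_iff[OF C', THEN iffD2] cproj_eq_0_iff[OF K'])
      then show ?thesis unfolding C_ker[symmetric] by (auto simp: ker_def)
    qed
    have ker_eq: "ker (\<lambda>x. T x - \<mu> *\<^sub>C x) = Z ` (K \<inter> ker D)"
      unfolding KD using \<mu>
      by (intro ker_diff_scaleC[OF bounded_clinear_mem[OF T] linZ R' _ G(2) Z(2,3)]) auto
    \<comment> \<open>The kernel computation applied to \<open>T'\<close>, \<open>G'\<close>,
      \<open>Z'\<close> and the conjugate of \<mu>, with the complement of \<open>K\<close> in the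
      role of the range; \<open>T' G'\<close> is the adjoint of the projection
      \<open>G T\<close>.\<close>
    have coker_eq: "orth_compl (range (\<lambda>x. T x - \<mu> *\<^sub>C x)) = Z' ` (C \<inter> ker D')"
    proof -
      have "is_adjoint (\<lambda>x. T' x - cnj \<mu> *\<^sub>C x) (\<lambda>x. T x - \<mu> *\<^sub>C x)"
        by (simp add: is_adjoint_def cinner.diff_left cinner.diff_right cinner_scaleC_left
            cinner_scaleC_right adj)
      then have "orth_compl (range (\<lambda>x. T x - \<mu> *\<^sub>C x)) = ker (\<lambda>x. T' x - cnj \<mu> *\<^sub>C x)"
        by (rule orth_compl_range)
      also have "\<dots> = Z' ` {y \<in> ker T'. Z' y \<in> orth_compl K}"
      proof (rule ker_diff_scaleC[OF bounded_clinear_mem[OF T'(1)] linZ' KO _ _ Z'G'])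
        show "range T' \<subseteq> orth_compl K"
          using closure_subset[of "range T'"]
            closure_range_eq[OF is_adjoint_sym[OF T'(2)] bounded_clinear_mem[OF T'(1)]]
          by (simp add: K_def)
        show "T' (G' x) = cproj (orth_compl K) x" for x
          by (rule cinner_ext_left) (simp add: adj G(3))
      qed (use \<mu> in auto)
      finally show ?thesis by (simp add: CD')
    qed
    have "mvn_equivalent A (cproj (K \<inter> ker D)) (cproj (Z ` (K \<inter> ker D)))"
    proof (rule mvn_equivalent_image[OF affil_Int[OF K affil_ker[OF D]] Z(1)])
      show "x = 0" if "Z x = 0" for x
        using Z(2)[of x] that bounded_clinear_zero[OF bounded_clinear_mem[OF G(1)]] by simp
      show "closed (Z ` (K \<inter> ker D))"
        unfolding ker_eq[symmetric]
        by (intro closed_csubspace_closed closed_csubspace_ker bounded_clinear_mem diff_scaleC_mem T)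
    qed
    moreover have "mvn_equivalent A (cproj (C \<inter> ker D')) (cproj (Z' ` (C \<inter> ker D')))"
    proof (rule mvn_equivalent_image[OF affil_Int[OF C affil_ker[OF D']] Z'(1)])
      show "x = 0" if "Z' x = 0" for x
        using Z'G'(1)[of x] that bounded_clinear_zero[OF bounded_clinear_mem[OF G'(1)]] by simp
      show "closed (Z' ` (C \<inter> ker D'))"
        unfolding coker_eq[symmetric] by (intro closed_csubspace_closed closed_csubspace_orth_compl)
    qed
    ultimately show "\<exists>D\<in>A. \<exists>D'. is_adjoint D' D \<and>
      orth_compl (ker D) \<subseteq> ker T \<and> closure (range D) \<subseteq> orth_compl (range T) \<and>
      mvn_equivalent A (cproj (ker T \<inter> ker D)) (cproj (ker (\<lambda>x. T x - \<mu> *\<^sub>C x))) \<and>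
      mvn_equivalent A (cproj (orth_compl (range T) \<inter> ker D'))
        (cproj (orth_compl (range (\<lambda>x. T x - \<mu> *\<^sub>C x))))"
      using DD' orth_ker closure_D
      unfolding ker_eq coker_eq K_def[symmetric] C_def[symmetric] by (intro bexI[OF _ D] exI[of _ D']) simp
  qed
qed

text \<open>On \<open>M\<close> the operator is onto, so the cokernel obstruction disappears: all of
  \<open>ker T \<inter> M\<close> is carried by \<open>Z\<close> onto the perturbed kernel.\<close>

lemma ker_perturbation_invariant:
  assumes T: "T \<in> A" and M: "affil M" "T ` M = M"
    and eigen: "\<And>\<mu> x. \<mu> \<noteq> 0 \<Longrightarrow> T x = \<mu> *\<^sub>C x \<Longrightarrow> x \<in> M"
  obtains \<epsilon> where "\<epsilon> > 0"
    "\<And>\<mu>. 0 < cmod \<mu> \<Longrightarrow> cmod \<mu> < \<epsilon> \<Longrightarrow>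
      mvn_equivalent A (cproj (ker T \<inter> M)) (cproj (ker (\<lambda>x. T x - \<mu> *\<^sub>C x)))"
proof -
  note M' = affil_closed_csubspace[OF M(1)]
  define X where "X x = T (cproj M x)" for x
  have X: "X \<in> A" unfolding X_def by (rule mem_compose[OF T cproj_mem[OF M(1)]])
  have rangeX: "range X = M" unfolding X_def using range_cproj[OF M'] M(2) by (metis image_image)
  have XM: "X x = T x" if "x \<in> M" for x using that by (simp add: X_def cproj_eq_self_iff[OF M', THEN iffD2])
  obtain G0 where G0: "G0 \<in> A" "\<And>x. X (G0 x) = cproj M x"
  proof (rule moore_penrose_mem[OF X, unfolded rangeX, OF closed_csubspace_closed[OF M']])
    fix G assume "G \<in> A" "\<And>x. X (G x) = cproj M x"
    then show thesis by (rule that)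
  qed
  \<comment> \<open>Projecting the right inverse into \<open>M\<close> leaves \<open>X G\<close>
    unchanged, since \<open>X\<close> begins with the projection onto \<open>M\<close>.\<close>
  define G where "G x = cproj M (G0 x)" for x
  have G: "G \<in> A" unfolding G_def by (rule mem_compose[OF cproj_mem[OF M(1)] G0(1)])
  have XG: "X (G x) = cproj M x" for x using G0(2)[of x] by (simp add: X_def G_def cproj_cproj[OF M'])
  have GM: "G x \<in> M" for x by (simp add: G_def cproj_in[OF M'])
  obtain g where g: "g > 0" "\<And>x. norm (G x) \<le> g * norm x"
    using bounded_clinear_bound[OF bounded_clinear_mem[OF G(1)]] by blast
  show thesis
  proof (rule that)
    show "1 / g > 0" using g by simp
  next
    fix \<mu> :: complex assume \<mu>: "0 < cmod \<mu>" "cmod \<mu> < 1 / g"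
    then have "\<mu> \<noteq> 0" by auto
    have "cmod \<mu> * g < 1" using \<mu> g by (simp add: field_simps)
    then obtain Z where Z: "Z \<in> A" "\<And>x. Z x = x + \<mu> *\<^sub>C G (Z x)" "\<And>x. Z x = x + \<mu> *\<^sub>C Z (G x)"
      using neumann_inverse_mem[OF G(1) g(2,1)] by blast
    \<comment> \<open>\<open>Z y\<close> and \<open>y\<close> differ by a vector of
      \<open>M\<close>, because \<open>G\<close> takes values there.\<close>
    have ZM: "Z y \<in> M \<longleftrightarrow> y \<in> M" for y
    proof -
      have m: "\<mu> *\<^sub>C G (Z y) \<in> M" by (rule closed_csubspace_scaleC[OF M' GM])
      have "y = Z y - \<mu> *\<^sub>C G (Z y)" using Z(2)[of y] by (simp add: eq_diff_eq)
      then show ?thesis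
        using Z(2)[of y] closed_csubspace_add[OF M' _ m, of y] closed_csubspace_diff[OF M' _ m, of "Z y"]
        by metis
    qed
    \<comment> \<open>Eigenvectors of \<open>X\<close> for \<mu> lie in its range \<open>M\<close>,
      and those of \<open>T\<close> lie in \<open>M\<close> by assumption; on \<open>M\<close> both
      operators agree.\<close>
    have "ker (\<lambda>x. T x - \<mu> *\<^sub>C x) = ker (\<lambda>x. X x - \<mu> *\<^sub>C x)"
    proof -
      have "x \<in> M" if "X x = \<mu> *\<^sub>C x" for x
      proof -
        have "\<mu> *\<^sub>C x \<in> M" using rangeX that by (metis rangeI)
        from closed_csubspace_scaleC[OF M' this, of "1 / \<mu>"] show ?thesis
          using \<open>\<mu> \<noteq> 0\<close> by (simp add: scaleC_scaleC)
      qed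
      then have "X x = \<mu> *\<^sub>C x \<longleftrightarrow> T x = \<mu> *\<^sub>C x" for x
        using eigen[OF \<open>\<mu> \<noteq> 0\<close>] XM by metis
      then show ?thesis by (simp add: ker_def)
    qed
    also have "\<dots> = Z ` {y \<in> ker X. Z y \<in> M}"
      using rangeX \<open>\<mu> \<noteq> 0\<close>
      by (intro ker_diff_scaleC[OF bounded_clinear_mem[OF X] bounded_clinear_mem[OF Z(1)] M' _ XG Z(2,3)]) auto
    also have "{y \<in> ker X. Z y \<in> M} = ker T \<inter> M" using XM by (auto simp: ZM ker_def)
    finally have eq: "ker (\<lambda>x. T x - \<mu> *\<^sub>C x) = Z ` (ker T \<inter> M)" .
    show "mvn_equivalent A (cproj (ker T \<inter> M)) (cproj (ker (\<lambda>x. T x - \<mu> *\<^sub>C x)))"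
      unfolding eq
    proof (rule mvn_equivalent_image[OF affil_Int[OF affil_ker[OF T] M(1)] Z(1)])
      show "x = 0" if "Z x = 0" for x
        using Z(2)[of x] that bounded_clinear_zero[OF bounded_clinear_mem[OF G(1)]] by simp
      show "closed (Z ` (ker T \<inter> M))"
        unfolding eq[symmetric]
        by (intro closed_csubspace_closed closed_csubspace_ker bounded_clinear_mem diff_scaleC_mem T)
    qed
  qed
qed

end

section \<open>The Grothendieck group of a commutative monoid\<close>

context comm_monoid begin

text \<open>The middle entry \<open>d\<close> cannot be cancelled in a general monoid, so it is
  absorbed into the new witness \<open>d \<otimes> k \<otimes> l\<close>.\<close>

lemma groth_rel_trans:
  assumes "((a, b), (c, d)) \<in> groth_rel G" "((c, d), (e, f)) \<in> groth_rel G"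
  shows "((a, b), (e, f)) \<in> groth_rel G"
proof -
  obtain k l where kl: "k \<in> carrier G" "l \<in> carrier G" "a \<otimes> d \<otimes> k = c \<otimes> b \<otimes> k" "c \<otimes> f \<otimes> l = e \<otimes> d \<otimes> l"
    and mem: "a \<in> carrier G" "b \<in> carrier G" "c \<in> carrier G" "d \<in> carrier G" "e \<in> carrier G" "f \<in> carrier G"
    using assms by (auto simp: groth_rel_def)
  have "a \<otimes> f \<otimes> (d \<otimes> k \<otimes> l) = (a \<otimes> d \<otimes> k) \<otimes> (f \<otimes> l)" using kl(1,2) mem by (simp add: m_ac)
  also have "\<dots> = (c \<otimes> f \<otimes> l) \<otimes> (b \<otimes> k)" unfolding kl(3) using kl(1,2) mem by (simp add: m_ac)
  also have "\<dots> = e \<otimes> b \<otimes> (d \<otimes> k \<otimes> l)" unfolding kl(4) using kl(1,2) mem by (simp add: m_ac)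
  finally show ?thesis using kl(1,2) mem unfolding groth_rel_def by blast
qed

lemma equiv_groth_rel: "equiv (carrier G \<times> carrier G) (groth_rel G)"
proof (rule equivI)
  show "groth_rel G \<subseteq> (carrier G \<times> carrier G) \<times> (carrier G \<times> carrier G)"
    by (auto simp: groth_rel_def)
  show "refl_on (carrier G \<times> carrier G) (groth_rel G)"
    by (auto simp: refl_on_def groth_rel_def)
  show "sym (groth_rel G)" by (auto simp: sym_def groth_rel_def) metis
  show "trans (groth_rel G)" by (rule transI) (auto intro: groth_rel_trans)
qed

lemma groth_rel_mult:
  assumes "((a, b), (a', b')) \<in> groth_rel G" "((c, d), (c', d')) \<in> groth_rel G"
  shows "((a \<otimes> c, b \<otimes> d), (a' \<otimes> c', b' \<otimes> d')) \<in> groth_rel G"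
proof -
  obtain k l where kl: "k \<in> carrier G" "l \<in> carrier G" "a \<otimes> b' \<otimes> k = a' \<otimes> b \<otimes> k" "c \<otimes> d' \<otimes> l = c' \<otimes> d \<otimes> l"
    and mem: "a \<in> carrier G" "b \<in> carrier G" "c \<in> carrier G" "d \<in> carrier G"
      "a' \<in> carrier G" "b' \<in> carrier G" "c' \<in> carrier G" "d' \<in> carrier G"
    using assms by (auto simp: groth_rel_def)
  have "a \<otimes> c \<otimes> (b' \<otimes> d') \<otimes> (k \<otimes> l) = (a \<otimes> b' \<otimes> k) \<otimes> (c \<otimes> d' \<otimes> l)"
    using kl(1,2) mem by (simp add: m_ac)
  also have "\<dots> = a' \<otimes> c' \<otimes> (b \<otimes> d) \<otimes> (k \<otimes> l)"
    unfolding kl(3,4) using kl(1,2) mem by (simp add: m_ac)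
  finally show ?thesis using kl(1,2) mem unfolding groth_rel_def by blast
qed

text \<open>The product collects the sums of all pairs of representatives; compatibility of the
  relation puts them in one class.\<close>

lemma grothendieck_mult_class:
  assumes "a \<in> carrier G" "b \<in> carrier G" "c \<in> carrier G" "d \<in> carrier G"
  shows "groth_rel G `` {(a, b)} \<otimes>\<^bsub>grothendieck_group G\<^esub> groth_rel G `` {(c, d)}
    = groth_rel G `` {(a \<otimes> c, b \<otimes> d)}"
proof -
  let ?P = "{(a' \<otimes> c', b' \<otimes> d') | a' b' c' d'.
    (a', b') \<in> groth_rel G `` {(a, b)} \<and> (c', d') \<in> groth_rel G `` {(c, d)}}"
  have "(a, b) \<in> groth_rel G `` {(a, b)}" "(c, d) \<in> groth_rel G `` {(c, d)}"
    by (rule equiv_class_self[OF equiv_groth_rel], simp add: assms)+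
  then have "(a \<otimes> c, b \<otimes> d) \<in> ?P" by blast
  moreover have "groth_rel G `` {p} = groth_rel G `` {(a \<otimes> c, b \<otimes> d)}" if "p \<in> ?P" for p
    using that groth_rel_mult by (auto intro!: equiv_class_eq[OF equiv_groth_rel, symmetric])
  ultimately have "groth_rel G `` ?P = groth_rel G `` {(a \<otimes> c, b \<otimes> d)}" by blast
  then show ?thesis by (simp add: grothendieck_group_def)
qed

text \<open>The form in which monoid identities enter the group: a common summand \<open>k\<close>
  disappears.\<close>

lemma grothendieck_class_eq_mult:
  assumes mem: "a \<in> carrier G" "b \<in> carrier G" "c \<in> carrier G" "k \<in> carrier G"
    and eq: "a \<otimes> k = b \<otimes> c \<otimes> k"
  shows "groth_rel G `` {(a, \<one>)} =
    groth_rel G `` {(b, \<one>)} \<otimes>\<^bsub>grothendieck_group G\<^esub> groth_rel G `` {(c, \<one>)}"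
proof -
  have "((a, \<one>), (b \<otimes> c, \<one>)) \<in> groth_rel G" using mem eq by (auto simp: groth_rel_def)
  then show ?thesis
    using mem by (simp add: grothendieck_mult_class equiv_class_eq[OF equiv_groth_rel])
qed

end

section \<open>The monoid of representations\<close>

text \<open>The inverse of splitting a sequence into its even and odd parts; it forms a vector of a
  direct sum from its two components.\<close>

definition interleave :: "(nat \<Rightarrow> 'a) \<Rightarrow> (nat \<Rightarrow> 'a) \<Rightarrow> nat \<Rightarrow> 'a" where
  "interleave a b i = (if even i then a (i div 2) else b (i div 2))"

lemma evens_interleave [simp]: "evens (interleave a b) = a"
  by (simp add: evens_def interleave_def fun_eq_iff)

lemma odds_interleave [simp]: "odds (interleave a b) = b"
  by (simp add: odds_def interleave_def fun_eq_iff)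

lemma interleave_evens_odds [simp]: "interleave (evens f) (odds f) = f"
  by (auto simp: evens_def odds_def interleave_def fun_eq_iff)



lemma evens_add: "evens (\<lambda>i. f i + g i) = (\<lambda>i. evens f i + evens g i)"
  and odds_add: "odds (\<lambda>i. f i + g i) = (\<lambda>i. odds f i + odds g i)"
  and evens_scaleC: "evens (\<lambda>i. c *\<^sub>C h i) = (\<lambda>i. c *\<^sub>C evens h i)"
  and odds_scaleC: "odds (\<lambda>i. c *\<^sub>C h i) = (\<lambda>i. c *\<^sub>C odds h i)"
  by (simp_all add: evens_def odds_def fun_eq_iff)

lemma interleave_add:
    "(\<lambda>i. interleave a b i + interleave c d i) = interleave (\<lambda>i. a i + c i) (\<lambda>i. b i + d i)"
  and interleave_scaleC:
    "(\<lambda>i. z *\<^sub>C interleave f g i) = interleave (\<lambda>i. z *\<^sub>C f i) (\<lambda>i. z *\<^sub>C g i)"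
  by (simp_all add: interleave_def fun_eq_iff)

lemmas evens_odds_lin =
  evens_add odds_add evens_scaleC odds_scaleC interleave_add interleave_scaleC

lemma rep_space_sum: "f \<in> rep_space (rep_sum \<rho> \<sigma>) \<longleftrightarrow> evens f \<in> rep_space \<rho> \<and> odds f \<in> rep_space \<sigma>"
  by (simp add: rep_sum_def)

lemma rep_act_sum:
  "rep_act (rep_sum \<rho> \<sigma>) S f = interleave (rep_act \<rho> S (evens f)) (rep_act \<sigma> S (odds f))"
  by (simp add: rep_sum_def interleave_def fun_eq_iff)

lemma support_evens_odds:
  "{i. f i \<noteq> 0} = (\<lambda>i. 2 * i) ` {i. evens f i \<noteq> 0} \<union> (\<lambda>i. 2 * i + 1) ` {i. odds f i \<noteq> 0}"
proof (rule Set.set_eqI)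
  fix i show "i \<in> {i. f i \<noteq> 0} \<longleftrightarrow>
    i \<in> (\<lambda>i. 2 * i) ` {i. evens f i \<noteq> 0} \<union> (\<lambda>i. 2 * i + 1) ` {i. odds f i \<noteq> 0}"
    by (cases "even i") (auto simp: evens_def odds_def image_iff elim!: evenE oddE)
qed

lemma finite_support_iff:
  "finite {i. f i \<noteq> 0} \<longleftrightarrow> finite {i. evens f i \<noteq> 0} \<and> finite {i. odds f i \<noteq> 0}"
  unfolding support_evens_odds[of f] finite_Un
  by (simp add: finite_image_iff inj_on_def)

text \<open>Finite support matters because a sum over an infinite index set is \<open>0\<close> by
  default.\<close>

lemma seq_cinner_evens_odds:
  assumes "finite {i. f i \<noteq> 0}"
  shows "seq_cinner f g = seq_cinner (evens f) (evens g) + seq_cinner (odds f) (odds g)"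
proof -
  have fin: "finite {i. evens f i \<noteq> 0}" "finite {i. odds f i \<noteq> 0}"
    using assms finite_support_iff by blast+
  have disj: "(\<lambda>i. 2 * i) ` {i. evens f i \<noteq> 0} \<inter> (\<lambda>i. 2 * i + 1) ` {i. odds f i \<noteq> 0} = {}"
    by auto presburger
  have "seq_cinner f g = (\<Sum>i\<in>(\<lambda>i. 2 * i) ` {i. evens f i \<noteq> 0}. cinner (f i) (g i))
      + (\<Sum>i\<in>(\<lambda>i. 2 * i + 1) ` {i. odds f i \<noteq> 0}. cinner (f i) (g i))"
    unfolding seq_cinner_def support_evens_odds[of f]
    by (rule sum.union_disjoint[OF _ _ disj]) (intro finite_imageI fin)+
  then show ?thesis
    by (simp add: sum.reindex inj_on_def) (simp add: seq_cinner_def evens_def odds_def)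
qed

section \<open>Unitary equivalence and direct sums of representations\<close>

text \<open>The closure properties of generated representations that the arguments on unitary
  equivalence use, isolated so that these arguments need no induction on the generation.\<close>

definition regular_rep :: "('a::chilbert_space \<Rightarrow> 'a) set \<Rightarrow> 'a rep \<Rightarrow> bool" where
  "regular_rep B \<rho> \<longleftrightarrow> (\<forall>f\<in>rep_space \<rho>. finite {i. f i \<noteq> 0}) \<and>
     (\<forall>f\<in>rep_space \<rho>. \<forall>g\<in>rep_space \<rho>. (\<lambda>i. f i + g i) \<in> rep_space \<rho>) \<and>
     (\<forall>c. \<forall>f\<in>rep_space \<rho>. (\<lambda>i. c *\<^sub>C f i) \<in> rep_space \<rho>) \<and>
     (\<forall>S\<in>B. \<forall>f\<in>rep_space \<rho>. rep_act \<rho> S f \<in> rep_space \<rho>)"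

lemma
  assumes "regular_rep B \<rho>"
  shows regular_rep_finite: "f \<in> rep_space \<rho> \<Longrightarrow> finite {i. f i \<noteq> 0}"
    and regular_rep_add: "f \<in> rep_space \<rho> \<Longrightarrow> g \<in> rep_space \<rho> \<Longrightarrow> (\<lambda>i. f i + g i) \<in> rep_space \<rho>"
    and regular_rep_scaleC: "f \<in> rep_space \<rho> \<Longrightarrow> (\<lambda>i. c *\<^sub>C f i) \<in> rep_space \<rho>"
    and regular_rep_act: "S \<in> B \<Longrightarrow> f \<in> rep_space \<rho> \<Longrightarrow> rep_act \<rho> S f \<in> rep_space \<rho>"
  using assms by (auto simp: regular_rep_def)

lemma regular_rep_sum:
  assumes "regular_rep B \<rho>" "regular_rep B \<sigma>" shows "regular_rep B (rep_sum \<rho> \<sigma>)"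
  unfolding regular_rep_def
proof (intro conjI ballI allI)
  show "finite {i. f i \<noteq> 0}" if "f \<in> rep_space (rep_sum \<rho> \<sigma>)" for f
    using that assms unfolding rep_space_sum finite_support_iff[of f] by (simp add: regular_rep_finite)
qed (use assms in \<open>simp_all add: rep_space_sum rep_act_sum evens_odds_lin regular_rep_add
  regular_rep_scaleC regular_rep_act\<close>)

definition unitary_intertwiner ::
  "('a::chilbert_space \<Rightarrow> 'a) set \<Rightarrow> 'a rep \<Rightarrow> 'a rep \<Rightarrow> ((nat \<Rightarrow> 'a) \<Rightarrow> (nat \<Rightarrow> 'a)) \<Rightarrow> bool" where
  "unitary_intertwiner B \<rho> \<sigma> U \<longleftrightarrow>
     bij_betw U (rep_space \<rho>) (rep_space \<sigma>) \<and>
     (\<forall>f\<in>rep_space \<rho>. \<forall>g\<in>rep_space \<rho>. U (\<lambda>i. f i + g i) = (\<lambda>i. U f i + U g i)) \<and>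
     (\<forall>c. \<forall>f\<in>rep_space \<rho>. U (\<lambda>i. c *\<^sub>C f i) = (\<lambda>i. c *\<^sub>C U f i)) \<and>
     (\<forall>f\<in>rep_space \<rho>. \<forall>g\<in>rep_space \<rho>. seq_cinner (U f) (U g) = seq_cinner f g) \<and>
     (\<forall>S\<in>B. \<forall>f\<in>rep_space \<rho>. U (rep_act \<rho> S f) = rep_act \<sigma> S (U f))"

lemma unitarily_equivalent_iff: "unitarily_equivalent B \<rho> \<sigma> \<longleftrightarrow> (\<exists>U. unitary_intertwiner B \<rho> \<sigma> U)"
  by (simp add: unitarily_equivalent_def unitary_intertwiner_def)

lemma unitarily_equivalentI:
  assumes "\<And>f. f \<in> rep_space \<rho> \<Longrightarrow> U f \<in> rep_space \<sigma>"
    and "\<And>f. f \<in> rep_space \<sigma> \<Longrightarrow> U' f \<in> rep_space \<rho>"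
    and "\<And>f. f \<in> rep_space \<rho> \<Longrightarrow> U' (U f) = f"
    and "\<And>f. f \<in> rep_space \<sigma> \<Longrightarrow> U (U' f) = f"
    and "\<And>f g. f \<in> rep_space \<rho> \<Longrightarrow> g \<in> rep_space \<rho> \<Longrightarrow> U (\<lambda>i. f i + g i) = (\<lambda>i. U f i + U g i)"
    and "\<And>c f. f \<in> rep_space \<rho> \<Longrightarrow> U (\<lambda>i. c *\<^sub>C f i) = (\<lambda>i. c *\<^sub>C U f i)"
    and "\<And>f g. f \<in> rep_space \<rho> \<Longrightarrow> g \<in> rep_space \<rho> \<Longrightarrow> seq_cinner (U f) (U g) = seq_cinner f g"
    and "\<And>S f. S \<in> B \<Longrightarrow> f \<in> rep_space \<rho> \<Longrightarrow> U (rep_act \<rho> S f) = rep_act \<sigma> S (U f)"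
  shows "unitarily_equivalent B \<rho> \<sigma>"
  unfolding unitarily_equivalent_def
proof (intro exI[of _ U] conjI)
  show "bij_betw U (rep_space \<rho>) (rep_space \<sigma>)"
    by (rule bij_betw_byWitness[where f' = U']) (use assms(1-4) in auto)
qed (use assms(5-) in auto)

lemma unitarily_equivalentE:
  assumes "unitarily_equivalent B \<rho> \<sigma>" and reg: "regular_rep B \<rho>"
  obtains U U' where "\<And>f. f \<in> rep_space \<rho> \<Longrightarrow> U f \<in> rep_space \<sigma>"
    and "\<And>f. f \<in> rep_space \<sigma> \<Longrightarrow> U' f \<in> rep_space \<rho>"
    and "\<And>f. f \<in> rep_space \<rho> \<Longrightarrow> U' (U f) = f"
    and "\<And>f. f \<in> rep_space \<sigma> \<Longrightarrow> U (U' f) = f"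
    and "\<And>f g. f \<in> rep_space \<rho> \<Longrightarrow> g \<in> rep_space \<rho> \<Longrightarrow> U (\<lambda>i. f i + g i) = (\<lambda>i. U f i + U g i)"
    and "\<And>c f. f \<in> rep_space \<rho> \<Longrightarrow> U (\<lambda>i. c *\<^sub>C f i) = (\<lambda>i. c *\<^sub>C U f i)"
    and "\<And>f g. f \<in> rep_space \<rho> \<Longrightarrow> g \<in> rep_space \<rho> \<Longrightarrow> seq_cinner (U f) (U g) = seq_cinner f g"
    and "\<And>S f. S \<in> B \<Longrightarrow> f \<in> rep_space \<rho> \<Longrightarrow> U (rep_act \<rho> S f) = rep_act \<sigma> S (U f)"
proof -
  obtain U where U: "bij_betw U (rep_space \<rho>) (rep_space \<sigma>)"
    "\<forall>f\<in>rep_space \<rho>. \<forall>g\<in>rep_space \<rho>. U (\<lambda>i. f i + g i) = (\<lambda>i. U f i + U g i)"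
    "\<forall>c. \<forall>f\<in>rep_space \<rho>. U (\<lambda>i. c *\<^sub>C f i) = (\<lambda>i. c *\<^sub>C U f i)"
    "\<forall>f\<in>rep_space \<rho>. \<forall>g\<in>rep_space \<rho>. seq_cinner (U f) (U g) = seq_cinner f g"
    "\<forall>S\<in>B. \<forall>f\<in>rep_space \<rho>. U (rep_act \<rho> S f) = rep_act \<sigma> S (U f)"
    using assms(1) unfolding unitarily_equivalent_def by (elim exE conjE) (rule that)
  show thesis
  proof (rule that[of U "inv_into (rep_space \<rho>) U"])
    show "f \<in> rep_space \<rho> \<Longrightarrow> U f \<in> rep_space \<sigma>" for f using U(1) bij_betwE by blast
    show "f \<in> rep_space \<sigma> \<Longrightarrow> inv_into (rep_space \<rho>) U f \<in> rep_space \<rho>" for f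
      using bij_betw_inv_into[OF U(1)] bij_betwE by blast
    show "f \<in> rep_space \<rho> \<Longrightarrow> inv_into (rep_space \<rho>) U (U f) = f" for f
      by (rule bij_betw_inv_into_left[OF U(1)])
    show "f \<in> rep_space \<sigma> \<Longrightarrow> U (inv_into (rep_space \<rho>) U f) = f" for f
      by (rule bij_betw_inv_into_right[OF U(1)])
  qed (use U(2-) in auto)
qed

lemma unitarily_equivalent_refl: "unitarily_equivalent B \<rho> \<rho>"
  by (rule unitarily_equivalentI[where U = id and U' = id]) simp_all

lemma unitarily_equivalent_sym:
  assumes "unitarily_equivalent B \<rho> \<sigma>" "regular_rep B \<rho>" shows "unitarily_equivalent B \<sigma> \<rho>"
proof (rule unitarily_equivalentE[OF assms])
  fix U U'
  assume U: "\<And>f. f \<in> rep_space \<rho> \<Longrightarrow> U f \<in> rep_space \<sigma>" "\<And>f. f \<in> rep_space \<sigma> \<Longrightarrow> U' f \<in> rep_space \<rho>"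
    "\<And>f. f \<in> rep_space \<rho> \<Longrightarrow> U' (U f) = f" "\<And>f. f \<in> rep_space \<sigma> \<Longrightarrow> U (U' f) = f"
    and add: "\<And>f g. f \<in> rep_space \<rho> \<Longrightarrow> g \<in> rep_space \<rho> \<Longrightarrow> U (\<lambda>i. f i + g i) = (\<lambda>i. U f i + U g i)"
    and scaleC: "\<And>c f. f \<in> rep_space \<rho> \<Longrightarrow> U (\<lambda>i. c *\<^sub>C f i) = (\<lambda>i. c *\<^sub>C U f i)"
    and cinner: "\<And>f g. f \<in> rep_space \<rho> \<Longrightarrow> g \<in> rep_space \<rho> \<Longrightarrow> seq_cinner (U f) (U g) = seq_cinner f g"
    and act: "\<And>S f. S \<in> B \<Longrightarrow> f \<in> rep_space \<rho> \<Longrightarrow> U (rep_act \<rho> S f) = rep_act \<sigma> S (U f)"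
  show ?thesis
  proof (rule unitarily_equivalentI[where U = U' and U' = U])
    fix f g assume f: "f \<in> rep_space \<sigma>" and g: "g \<in> rep_space \<sigma>"
    show "U' (\<lambda>i. f i + g i) = (\<lambda>i. U' f i + U' g i)"
      using U(3)[OF regular_rep_add[OF assms(2) U(2)[OF f] U(2)[OF g]]]
      by (simp add: add[OF U(2)[OF f] U(2)[OF g]] U(4) f g)
    show "seq_cinner (U' f) (U' g) = seq_cinner f g"
      using cinner[OF U(2)[OF f] U(2)[OF g]] by (simp add: U(4) f g)
  next
    fix c f assume f: "f \<in> rep_space \<sigma>"
    show "U' (\<lambda>i. c *\<^sub>C f i) = (\<lambda>i. c *\<^sub>C U' f i)"
      using U(3)[OF regular_rep_scaleC[OF assms(2) U(2)[OF f]]]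
      by (simp add: scaleC[OF U(2)[OF f]] U(4) f)
  next
    fix S f assume S: "S \<in> B" and f: "f \<in> rep_space \<sigma>"
    show "U' (rep_act \<sigma> S f) = rep_act \<rho> S (U' f)"
      using U(3)[OF regular_rep_act[OF assms(2) S U(2)[OF f]]]
      by (simp add: act[OF S U(2)[OF f]] U(4) f)
  qed (fact U)+
qed

lemma unitarily_equivalent_trans:
  assumes "unitarily_equivalent B \<rho> \<sigma>" "unitarily_equivalent B \<sigma> \<tau>"
  shows "unitarily_equivalent B \<rho> \<tau>"
proof -
  obtain U V where U: "unitary_intertwiner B \<rho> \<sigma> U" and V: "unitary_intertwiner B \<sigma> \<tau> V"
    using assms by (auto simp: unitarily_equivalent_iff)
  have bij: "bij_betw U (rep_space \<rho>) (rep_space \<sigma>)" "bij_betw V (rep_space \<sigma>) (rep_space \<tau>)"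
    using U V by (simp_all add: unitary_intertwiner_def)
  have "U f \<in> rep_space \<sigma>" if "f \<in> rep_space \<rho>" for f using bij_betwE[OF bij(1)] that by blast
  then have "unitary_intertwiner B \<rho> \<tau> (V \<circ> U)"
    using U V bij_betw_trans[OF bij] by (simp add: unitary_intertwiner_def)
  then show ?thesis using unitarily_equivalent_iff by blast
qed

text \<open>The two unitaries act separately on the even and the odd parts.\<close>

lemma unitarily_equivalent_sum:
  assumes "unitarily_equivalent B \<rho> \<rho>'" "unitarily_equivalent B \<sigma> \<sigma>'"
    and reg: "regular_rep B \<rho>" "regular_rep B \<rho>'" "regular_rep B \<sigma>" "regular_rep B \<sigma>'"
  shows "unitarily_equivalent B (rep_sum \<rho> \<sigma>) (rep_sum \<rho>' \<sigma>')"
proof (rule unitarily_equivalentE[OF assms(1) reg(1)], rule unitarily_equivalentE[OF assms(2) reg(3)])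
  fix U U' V V'
  assume U: "\<And>f. f \<in> rep_space \<rho> \<Longrightarrow> U f \<in> rep_space \<rho>'" "\<And>f. f \<in> rep_space \<rho>' \<Longrightarrow> U' f \<in> rep_space \<rho>"
    "\<And>f. f \<in> rep_space \<rho> \<Longrightarrow> U' (U f) = f" "\<And>f. f \<in> rep_space \<rho>' \<Longrightarrow> U (U' f) = f"
    "\<And>f g. f \<in> rep_space \<rho> \<Longrightarrow> g \<in> rep_space \<rho> \<Longrightarrow> U (\<lambda>i. f i + g i) = (\<lambda>i. U f i + U g i)"
    "\<And>c f. f \<in> rep_space \<rho> \<Longrightarrow> U (\<lambda>i. c *\<^sub>C f i) = (\<lambda>i. c *\<^sub>C U f i)"
    "\<And>f g. f \<in> rep_space \<rho> \<Longrightarrow> g \<in> rep_space \<rho> \<Longrightarrow> seq_cinner (U f) (U g) = seq_cinner f g"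
    "\<And>S f. S \<in> B \<Longrightarrow> f \<in> rep_space \<rho> \<Longrightarrow> U (rep_act \<rho> S f) = rep_act \<rho>' S (U f)"
  assume V: "\<And>f. f \<in> rep_space \<sigma> \<Longrightarrow> V f \<in> rep_space \<sigma>'" "\<And>f. f \<in> rep_space \<sigma>' \<Longrightarrow> V' f \<in> rep_space \<sigma>"
    "\<And>f. f \<in> rep_space \<sigma> \<Longrightarrow> V' (V f) = f" "\<And>f. f \<in> rep_space \<sigma>' \<Longrightarrow> V (V' f) = f"
    "\<And>f g. f \<in> rep_space \<sigma> \<Longrightarrow> g \<in> rep_space \<sigma> \<Longrightarrow> V (\<lambda>i. f i + g i) = (\<lambda>i. V f i + V g i)"
    "\<And>c f. f \<in> rep_space \<sigma> \<Longrightarrow> V (\<lambda>i. c *\<^sub>C f i) = (\<lambda>i. c *\<^sub>C V f i)"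
    "\<And>f g. f \<in> rep_space \<sigma> \<Longrightarrow> g \<in> rep_space \<sigma> \<Longrightarrow> seq_cinner (V f) (V g) = seq_cinner f g"
    "\<And>S f. S \<in> B \<Longrightarrow> f \<in> rep_space \<sigma> \<Longrightarrow> V (rep_act \<sigma> S f) = rep_act \<sigma>' S (V f)"
  note regs = regular_rep_sum[OF reg(1,3)] regular_rep_sum[OF reg(2,4)]
  let ?W = "\<lambda>f. interleave (U (evens f)) (V (odds f))"
  have W: "?W f \<in> rep_space (rep_sum \<rho>' \<sigma>')" if "f \<in> rep_space (rep_sum \<rho> \<sigma>)" for f
    using that by (simp add: rep_space_sum U(1) V(1))
  show ?thesis
  proof (rule unitarily_equivalentI[where U = ?W and U' = "\<lambda>f. interleave (U' (evens f)) (V' (odds f))"])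
    fix f g assume f: "f \<in> rep_space (rep_sum \<rho> \<sigma>)" and g: "g \<in> rep_space (rep_sum \<rho> \<sigma>)"
    then have fg: "evens f \<in> rep_space \<rho>" "odds f \<in> rep_space \<sigma>" "evens g \<in> rep_space \<rho>" "odds g \<in> rep_space \<sigma>"
      by (simp_all add: rep_space_sum)
    show "?W (\<lambda>i. f i + g i) = (\<lambda>i. ?W f i + ?W g i)"
      by (simp add: evens_odds_lin U(5)[OF fg(1,3)] V(5)[OF fg(2,4)])
    show "seq_cinner (?W f) (?W g) = seq_cinner f g"
      by (simp add: seq_cinner_evens_odds[OF regular_rep_finite[OF regs(1) f]]
          seq_cinner_evens_odds[OF regular_rep_finite[OF regs(2) W[OF f]]]
          U(7)[OF fg(1,3)] V(7)[OF fg(2,4)])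
  next
    fix c f assume "f \<in> rep_space (rep_sum \<rho> \<sigma>)"
    then have f: "evens f \<in> rep_space \<rho>" "odds f \<in> rep_space \<sigma>" by (simp_all add: rep_space_sum)
    show "?W (\<lambda>i. c *\<^sub>C f i) = (\<lambda>i. c *\<^sub>C ?W f i)"
      by (simp add: evens_odds_lin U(6)[OF f(1)] V(6)[OF f(2)])
  qed (simp_all add: rep_space_sum rep_act_sum U(1-4,8) V(1-4,8))
qed

text \<open>Exchanging even and odd parts is its own inverse and serves in both directions.\<close>

lemma unitarily_equivalent_sum_commute:
  assumes reg: "regular_rep B \<rho>" "regular_rep B \<sigma>"
  shows "unitarily_equivalent B (rep_sum \<rho> \<sigma>) (rep_sum \<sigma> \<rho>)"
proof (rule unitarily_equivalentI[where U = "\<lambda>f. interleave (odds f) (evens f)"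
      and U' = "\<lambda>f. interleave (odds f) (evens f)"])
  fix f g assume f: "f \<in> rep_space (rep_sum \<rho> \<sigma>)"
  have fin: "finite {i. f i \<noteq> 0}" by (rule regular_rep_finite[OF regular_rep_sum[OF reg] f])
  then have "finite {i. interleave (odds f) (evens f) i \<noteq> 0}"
    using finite_support_iff[of f] finite_support_iff[of "interleave (odds f) (evens f)"] by simp
  then show "seq_cinner (interleave (odds f) (evens f)) (interleave (odds g) (evens g)) = seq_cinner f g"
    by (simp add: seq_cinner_evens_odds fin)
qed (simp_all add: rep_space_sum rep_act_sum evens_odds_lin)

text \<open>The two bracketings place the three components at different positions; the unitary only
  rearranges positions.\<close>

lemma unitarily_equivalent_sum_assoc:
  assumes reg: "regular_rep B \<rho>" "regular_rep B \<sigma>" "regular_rep B \<tau>"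
  shows "unitarily_equivalent B (rep_sum (rep_sum \<rho> \<sigma>) \<tau>) (rep_sum \<rho> (rep_sum \<sigma> \<tau>))"
proof (rule unitarily_equivalentI[where
      U = "\<lambda>f. interleave (evens (evens f)) (interleave (odds (evens f)) (odds f))" and
      U' = "\<lambda>f. interleave (interleave (evens f) (evens (odds f))) (odds (odds f))"])
  let ?U = "\<lambda>f. interleave (evens (evens f)) (interleave (odds (evens f)) (odds f))"
  fix f g assume f: "f \<in> rep_space (rep_sum (rep_sum \<rho> \<sigma>) \<tau>)"
  have fin: "finite {i. f i \<noteq> 0}"
    by (rule regular_rep_finite[OF regular_rep_sum[OF regular_rep_sum[OF reg(1,2)] reg(3)] f])
  then have fin': "finite {i. evens f i \<noteq> 0}" "finite {i. odds f i \<noteq> 0}"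
    "finite {i. evens (evens f) i \<noteq> 0}" "finite {i. odds (evens f) i \<noteq> 0}"
    using finite_support_iff[of f] finite_support_iff[of "evens f"] by simp_all
  have fin_odds: "finite {i. interleave (odds (evens f)) (odds f) i \<noteq> 0}"
    using fin' finite_support_iff[of "interleave (odds (evens f)) (odds f)"] by simp
  have "finite {i. ?U f i \<noteq> 0}" using fin' fin_odds finite_support_iff[of "?U f"] by simp
  then show "seq_cinner (?U f) (?U g) = seq_cinner f g"
    by (simp add: seq_cinner_evens_odds[of f, OF fin] seq_cinner_evens_odds[of "evens f", OF fin'(1)]
        seq_cinner_evens_odds[of "?U f"] seq_cinner_evens_odds[OF fin_odds])
qed (simp_all add: rep_space_sum rep_act_sum evens_odds_lin)

lemma unitarily_equivalent_zero_sum: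
  assumes reg: "regular_rep B \<rho>"
  shows "unitarily_equivalent B (rep_sum (proj_rep (\<lambda>x. 0)) \<rho>) \<rho>"
proof -
  have zero: "evens f = (\<lambda>_. 0)" if f: "f \<in> rep_space (rep_sum (proj_rep (\<lambda>x. 0)) \<rho>)" for f
  proof
    show "evens f i = 0" for i using f by (cases i) (auto simp: rep_space_sum proj_rep_def)
  qed
  show ?thesis
  proof (rule unitarily_equivalentI[where U = odds and U' = "\<lambda>f. interleave (\<lambda>_. 0) f"])
    fix f g assume f: "f \<in> rep_space (rep_sum (proj_rep (\<lambda>x. 0)) \<rho>)"
    have "finite {i. odds f i \<noteq> 0}"
      using f by (intro regular_rep_finite[OF reg]) (simp add: rep_space_sum)
    then have "finite {i. f i \<noteq> 0}" using finite_support_iff[of f] by (simp add: zero[OF f])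
    then show "seq_cinner (odds f) (odds g) = seq_cinner f g"
      by (simp add: seq_cinner_evens_odds[of f] zero[OF f]) (simp add: seq_cinner_def)
  next
    fix f assume "f \<in> rep_space (rep_sum (proj_rep (\<lambda>x. 0)) \<rho>)"
    then show "interleave (\<lambda>_. 0) (odds f) = f" using zero interleave_evens_odds by metis
  qed (auto simp: rep_space_sum rep_act_sum evens_odds_lin proj_rep_def)
qed

section \<open>The monoid of classes and the classes of finite projections\<close>

context vna begin

text \<open>Makes the neutral element the class of a generated representation. Every projection has
  \<open>0\<close> in its range, so none has a range properly inside \<open>{0}\<close>.\<close>

lemma zero_Proj0: "(\<lambda>x. 0) \<in> Proj0 A"
proof -
  have "(\<lambda>x. 0) \<in> A" using mem_scaleC[OF mem_id, of 0] by simp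
  then have "(\<lambda>x. 0) \<in> projections A"
    by (simp add: projections_def bounded_clinear_mem is_adjoint_def fun_eq_iff
        cinner.zero_left cinner.zero_right)
  moreover have "0 \<in> range F" if "F \<in> projections A" for F
    using bounded_clinear_zero[OF projectionsD(2)[OF that]] by (metis rangeI)
  ultimately show ?thesis unfolding Proj0_def by fastforce
qed

lemma regular_rep_generated: "\<rho> \<in> generated_reps A \<Longrightarrow> regular_rep (commutant A) \<rho>"
proof (induction rule: generated_reps.induct)
  case (proj E)
  then have E: "bounded_clinear E" by (simp add: Proj0_def projectionsD(2))
  show ?case
    unfolding regular_rep_def proj_rep_def rep.simps
  proof (intro conjI ballI allI)
    fix f :: "nat \<Rightarrow> 'a" assume f: "f \<in> {f. f 0 \<in> range E \<and> (\<forall>i>0. f i = 0)}"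
    then have "{i. f i \<noteq> 0} \<subseteq> {0}" by auto
    then show "finite {i. f i \<noteq> 0}" by (rule finite_subset) simp
    show "(\<lambda>i. c *\<^sub>C f i) \<in> {f. f 0 \<in> range E \<and> (\<forall>i>0. f i = 0)}" for c
      using f by (auto simp flip: bounded_clinear_scaleC[OF E])
    show "(\<lambda>i. f i + g i) \<in> {f. f 0 \<in> range E \<and> (\<forall>i>0. f i = 0)}"
      if "g \<in> {f. f 0 \<in> range E \<and> (\<forall>i>0. f i = 0)}" for g
      using f that by (auto simp flip: bounded_clinear_add[OF E])
  qed auto
qed (rule regular_rep_sum)

lemma equiv_rep_rel: "equiv (generated_reps A) (rep_rel A)"
proof (rule equivI)
  show "rep_rel A \<subseteq> generated_reps A \<times> generated_reps A" by (auto simp: rep_rel_def)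
  show "refl_on (generated_reps A) (rep_rel A)"
    by (auto simp: refl_on_def rep_rel_def unitarily_equivalent_refl)
  show "sym (rep_rel A)"
    by (auto simp: sym_def rep_rel_def intro: unitarily_equivalent_sym regular_rep_generated)
  show "trans (rep_rel A)"
    by (rule transI) (auto simp: rep_rel_def intro: unitarily_equivalent_trans)
qed

lemma rep_class_eqI:
  "\<rho> \<in> generated_reps A \<Longrightarrow> \<sigma> \<in> generated_reps A \<Longrightarrow> unitarily_equivalent (commutant A) \<rho> \<sigma> \<Longrightarrow>
    rep_rel A `` {\<rho>} = rep_rel A `` {\<sigma>}"
  by (rule equiv_class_eq[OF equiv_rep_rel]) (simp add: rep_rel_def)

text \<open>Sums of equivalent representatives are equivalent, so the set of all such sums spans a
  single class.\<close>

lemma rep_monoid_mult_class: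
  assumes \<rho>: "\<rho> \<in> generated_reps A" and \<sigma>: "\<sigma> \<in> generated_reps A"
  shows "rep_rel A `` {\<rho>} \<otimes>\<^bsub>rep_monoid A\<^esub> rep_rel A `` {\<sigma>} = rep_rel A `` {rep_sum \<rho> \<sigma>}"
proof -
  let ?P = "{rep_sum \<rho>' \<sigma>' | \<rho>' \<sigma>'. \<rho>' \<in> rep_rel A `` {\<rho>} \<and> \<sigma>' \<in> rep_rel A `` {\<sigma>}}"
  have "rep_sum \<rho> \<sigma> \<in> ?P"
    using equiv_class_self[OF equiv_rep_rel \<rho>] equiv_class_self[OF equiv_rep_rel \<sigma>] by blast
  moreover have "rep_rel A `` {p} = rep_rel A `` {rep_sum \<rho> \<sigma>}" if "p \<in> ?P" for p
  proof -
    obtain \<rho>' \<sigma>' where p: "p = rep_sum \<rho>' \<sigma>'" and rel: "(\<rho>, \<rho>') \<in> rep_rel A" "(\<sigma>, \<sigma>') \<in> rep_rel A"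
      using \<open>p \<in> ?P\<close> by blast
    then have gen: "\<rho>' \<in> generated_reps A" "\<sigma>' \<in> generated_reps A"
      and "unitarily_equivalent (commutant A) \<rho> \<rho>'" "unitarily_equivalent (commutant A) \<sigma> \<sigma>'"
      by (simp_all add: rep_rel_def)
    then have "unitarily_equivalent (commutant A) (rep_sum \<rho> \<sigma>) (rep_sum \<rho>' \<sigma>')"
      by (intro unitarily_equivalent_sum regular_rep_generated \<rho> \<sigma>)
    then show ?thesis
      unfolding p by (intro rep_class_eqI[symmetric] generated_reps.sum \<rho> \<sigma> gen)
  qed
  ultimately have "rep_rel A `` ?P = rep_rel A `` {rep_sum \<rho> \<sigma>}" by blast
  then show ?thesis by (simp add: rep_monoid_def)
qed

lemma rep_class_carrier: "\<rho> \<in> generated_reps A \<Longrightarrow> rep_rel A `` {\<rho>} \<in> carrier (rep_monoid A)"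
  by (simp add: rep_monoid_def quotientI)

lemma rep_monoid_carrierE:
  assumes "X \<in> carrier (rep_monoid A)"
  obtains \<rho> where "\<rho> \<in> generated_reps A" "X = rep_rel A `` {\<rho>}"
  using assms by (auto simp: rep_monoid_def elim: quotientE)

lemma rep_monoid_one: "\<one>\<^bsub>rep_monoid A\<^esub> = rep_rel A `` {proj_rep (\<lambda>x. 0)}"
  by (simp add: rep_monoid_def)

lemma comm_monoid_rep_monoid: "comm_monoid (rep_monoid A)"
proof (rule comm_monoidI)
  note gen = generated_reps.sum generated_reps.proj[OF zero_Proj0]
  note reg = regular_rep_generated
  fix X Y Z
  assume "X \<in> carrier (rep_monoid A)"
  then obtain \<rho> where \<rho>: "\<rho> \<in> generated_reps A" "X = rep_rel A `` {\<rho>}" by (rule rep_monoid_carrierE)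
  show "\<one>\<^bsub>rep_monoid A\<^esub> \<otimes>\<^bsub>rep_monoid A\<^esub> X = X"
    unfolding \<rho>(2) rep_monoid_one
    by (simp add: rep_monoid_mult_class gen \<rho> rep_class_eqI unitarily_equivalent_zero_sum reg)
  assume "Y \<in> carrier (rep_monoid A)"
  then obtain \<sigma> where \<sigma>: "\<sigma> \<in> generated_reps A" "Y = rep_rel A `` {\<sigma>}" by (rule rep_monoid_carrierE)
  show "X \<otimes>\<^bsub>rep_monoid A\<^esub> Y \<in> carrier (rep_monoid A)"
    unfolding \<rho>(2) \<sigma>(2) by (simp add: rep_monoid_mult_class gen \<rho> \<sigma> rep_class_carrier)
  show "X \<otimes>\<^bsub>rep_monoid A\<^esub> Y = Y \<otimes>\<^bsub>rep_monoid A\<^esub> X"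
    unfolding \<rho>(2) \<sigma>(2)
    by (simp add: rep_monoid_mult_class \<rho> \<sigma> rep_class_eqI gen unitarily_equivalent_sum_commute reg)
  assume "Z \<in> carrier (rep_monoid A)"
  then obtain \<tau> where \<tau>: "\<tau> \<in> generated_reps A" "Z = rep_rel A `` {\<tau>}" by (rule rep_monoid_carrierE)
  show "X \<otimes>\<^bsub>rep_monoid A\<^esub> Y \<otimes>\<^bsub>rep_monoid A\<^esub> Z = X \<otimes>\<^bsub>rep_monoid A\<^esub> (Y \<otimes>\<^bsub>rep_monoid A\<^esub> Z)"
    unfolding \<rho>(2) \<sigma>(2) \<tau>(2)
    by (simp add: rep_monoid_mult_class \<rho> \<sigma> \<tau> rep_class_eqI gen unitarily_equivalent_sum_assoc reg)
qed (simp add: rep_monoid_one rep_class_carrier generated_reps.proj zero_Proj0)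

definition proj_class :: "('a \<Rightarrow> 'a) \<Rightarrow> 'a rep set" where
  "proj_class E = rep_rel A `` {proj_rep E}"

lemma proj_class_carrier: "E \<in> Proj0 A \<Longrightarrow> proj_class E \<in> carrier (rep_monoid A)"
  by (simp add: proj_class_def rep_class_carrier generated_reps.proj)

lemma rep_space_proj_rep: "f \<in> rep_space (proj_rep E) \<longleftrightarrow> f 0 \<in> range E \<and> (\<forall>i>0. f i = 0)"
  by (simp add: proj_rep_def)

lemma seq_cinner_proj_rep:
  assumes "f \<in> rep_space (proj_rep E)"
  shows "seq_cinner f g = cinner (f 0) (g (0::nat) :: 'a)"
proof -
  have sub: "{i. f i \<noteq> 0} \<subseteq> {0}" using assms by (auto simp: rep_space_proj_rep)
  have "seq_cinner f g = (\<Sum>i\<in>{0}. cinner (f i) (g i))"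
    unfolding seq_cinner_def by (rule sum.mono_neutral_left[OF _ sub]) (auto simp: cinner.zero_left)
  then show ?thesis by simp
qed

text \<open>The partial isometry restricts to a unitary from the range of \<open>E\<close> onto that
  of \<open>F\<close>; lying in \<open>A\<close>, it commutes with the commutant and so intertwines
  the two representations.\<close>

lemma proj_class_mvn_equivalent:
  assumes E: "E \<in> Proj0 A" and F: "F \<in> Proj0 A" and EF: "mvn_equivalent A E F"
  shows "proj_class E = proj_class F"
proof -
  note E' = Proj0_projections[OF E] and F' = Proj0_projections[OF F]
  obtain V W where V: "V \<in> A" "W \<in> A" "\<And>x y. cinner (W x) y = cinner x (V y)"
    "\<And>x. W (V x) = E x" "\<And>x. V (W x) = F x" "\<And>x. V (E x) = V x" "\<And>x. F (V x) = V x"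
    "\<And>x. W (F x) = W x" "\<And>x. E (W x) = W x"
    using mvn_equivalentE[OF E' F' EF] by blast
  have fix_range: "E x = x" if "x \<in> range E" for x using that projectionsD(3)[OF E'] by auto
  have fix_range': "F x = x" if "x \<in> range F" for x using that projectionsD(3)[OF F'] by auto
  have ranges: "V x \<in> range F" "W x \<in> range E" for x by (metis V(7) rangeI, metis V(9) rangeI)
  note linV = bounded_clinear_mem[OF V(1)]
  have "unitarily_equivalent (commutant A) (proj_rep E) (proj_rep F)"
  proof (rule unitarily_equivalentI[where U = "\<lambda>f i. if i = 0 then V (f 0) else 0"
        and U' = "\<lambda>f i. if i = 0 then W (f 0) else 0"])
    let ?U = "\<lambda>f (i::nat). if i = (0::nat) then V (f (0::nat)) else 0"
    show U: "?U f \<in> rep_space (proj_rep F)" for f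
      by (simp add: rep_space_proj_rep ranges)
    show "seq_cinner (?U f) (?U g) = seq_cinner f g" if f: "f \<in> rep_space (proj_rep E)" for f g
    proof -
      have "E (f 0) = f 0" by (rule fix_range) (use f rep_space_proj_rep in blast)
      then have "cinner (V (f 0)) (V (g 0)) = cinner (f 0) (g 0)"
        using V(3)[of "V (f 0)" "g 0"] by (simp add: V(4))
      then show ?thesis by (simp add: seq_cinner_proj_rep[OF f] seq_cinner_proj_rep[OF U])
    qed
    show "?U (rep_act (proj_rep E) S f) = rep_act (proj_rep F) S (?U f)"
      if S: "S \<in> commutant A" and f: "f \<in> rep_space (proj_rep E)" for S f
    proof -
      have "V (E (S (f 0))) = F (S (V (f 0)))"
        by (simp add: V(6,7) commute_mem[OF V(1) S])
      then show ?thesis by (simp add: proj_rep_def fun_eq_iff)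
    qed
    show "(\<lambda>i. if i = 0 then W (?U f 0) else 0) = f" if "f \<in> rep_space (proj_rep E)" for f
      using that fix_range[of "f 0"] by (auto simp: rep_space_proj_rep fun_eq_iff V(4))
    show "?U (\<lambda>i. if i = 0 then W (f 0) else 0) = f" if "f \<in> rep_space (proj_rep F)" for f
      using that fix_range'[of "f 0"] by (auto simp: rep_space_proj_rep fun_eq_iff V(5))
  qed (simp_all add: rep_space_proj_rep ranges fun_eq_iff bounded_clinear_simps[OF linV])
  then show ?thesis
    unfolding proj_class_def by (intro rep_class_eqI generated_reps.proj E F)
qed

text \<open>Adding the two components is the intertwining unitary; orthogonality of the ranges makes
  it isometric, and \<open>E\<close> and \<open>F\<close> recover the components.\<close>

lemma proj_class_sum:
  assumes E: "E \<in> Proj0 A" and F: "F \<in> Proj0 A" and P: "P \<in> Proj0 A"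
    and sum: "\<And>x. P x = E x + F x" and orth: "\<And>x. E (F x) = 0" "\<And>x. F (E x) = 0"
  shows "proj_class P = proj_class E \<otimes>\<^bsub>rep_monoid A\<^esub> proj_class F"
proof -
  note E' = Proj0_projections[OF E] and F' = Proj0_projections[OF F] and P' = Proj0_projections[OF P]
  note lin = bounded_clinear_add[OF projectionsD(2)[OF E']] bounded_clinear_add[OF projectionsD(2)[OF F']]
  have fix_E: "E x = x" "F x = 0" if "x \<in> range E" for x using that projectionsD(3)[OF E'] orth by auto
  have fix_F: "F x = x" "E x = 0" if "x \<in> range F" for x using that projectionsD(3)[OF F'] orth by auto
  have fix_P: "E x + F x = x" if "x \<in> range P" for x using that projectionsD(3)[OF P'] sum by auto
  have range_P: "x + y \<in> range P" if "x \<in> range E" "y \<in> range F" for x y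
  proof -
    have "P (x + y) = x + y" by (simp add: sum lin fix_E[OF that(1)] fix_F[OF that(2)])
    then show ?thesis by (metis rangeI)
  qed
  let ?\<rho> = "rep_sum (proj_rep E) (proj_rep F)"
  \<comment> \<open>The entry of the first summand sits at the even position \<open>0\<close>, that
    of the second at the odd position \<open>1\<close>.\<close>
  have space: "f \<in> rep_space ?\<rho> \<longleftrightarrow> f 0 \<in> range E \<and> f 1 \<in> range F \<and> (\<forall>i>1. f i = 0)" for f
  proof
    assume *: "f \<in> rep_space ?\<rho>"
    then have "f 0 \<in> range E" "f 1 \<in> range F" and
      zero: "\<And>i. i > 0 \<Longrightarrow> f (2 * i) = 0" "\<And>i. i > 0 \<Longrightarrow> f (2 * i + 1) = 0"
      by (auto simp: rep_space_sum rep_space_proj_rep evens_def odds_def)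
    moreover have "f i = 0" if "i > 1" for i
      using zero[of "i div 2"] that by (cases "even i") auto
    ultimately show "f 0 \<in> range E \<and> f 1 \<in> range F \<and> (\<forall>i>1. f i = 0)" by blast
  qed (auto simp: rep_space_sum rep_space_proj_rep evens_def odds_def)
  have "unitarily_equivalent (commutant A) ?\<rho> (proj_rep P)"
  proof (rule unitarily_equivalentI[where U = "\<lambda>f i. if i = 0 then f 0 + f 1 else 0"
        and U' = "\<lambda>f i. if i = 0 then E (f 0) else if i = 1 then F (f 0) else 0"])
    let ?U = "\<lambda>f (i::nat). if i = (0::nat) then f (0::nat) + f 1 else (0::'a)"
    show U: "?U f \<in> rep_space (proj_rep P)" if "f \<in> rep_space ?\<rho>" for f
      using that by (simp add: rep_space_proj_rep space range_P)
    show "seq_cinner (?U f) (?U g) = seq_cinner f g"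
      if f: "f \<in> rep_space ?\<rho>" and g: "g \<in> rep_space ?\<rho>" for f g
    proof -
      have fg: "f 0 \<in> range E" "f 1 \<in> range F" "g 0 \<in> range E" "g 1 \<in> range F"
        using f g by (simp_all add: space)
      have "cinner (f 0) (g 1) = 0" "cinner (f 1) (g 0) = 0"
        using projectionsD(4)[OF E', of "f 0" "g 1"] projectionsD(4)[OF F', of "f 1" "g 0"]
        unfolding fix_E[OF fg(1)] fix_E[OF fg(3)] fix_F[OF fg(2)] fix_F[OF fg(4)]
        by (simp_all add: cinner.zero_right)
      moreover have "finite {i. f i \<noteq> 0}"
        by (rule regular_rep_finite[OF regular_rep_generated f])
           (intro generated_reps.sum generated_reps.proj E F)
      moreover have "evens f \<in> rep_space (proj_rep E)" "odds f \<in> rep_space (proj_rep F)"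
        using f by (simp_all add: rep_space_sum)
      ultimately show ?thesis
        by (simp add: seq_cinner_proj_rep[OF U[OF f]] seq_cinner_evens_odds[of f]
            seq_cinner_proj_rep[of "evens f"] seq_cinner_proj_rep[of "odds f"])
           (simp add: evens_def odds_def cinner_add_left cinner_add_right)
    qed
    show "?U (rep_act ?\<rho> S f) = rep_act (proj_rep P) S (?U f)"
      if S: "S \<in> commutant A" and f: "f \<in> rep_space ?\<rho>" for S f
    proof -
      have linS: "bounded_clinear S" using S by (simp add: commutant_def)
      have ranges: "f 0 \<in> range E" "f 1 \<in> range F" using f by (simp_all add: space)
      \<comment> \<open>\<open>S\<close> commutes with both projections and therefore preserves each
        component.\<close>
      have "E (S (f 0)) = S (f 0)" "F (S (f 0)) = 0" "E (S (f 1)) = 0" "F (S (f 1)) = S (f 1)"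
        unfolding commute_mem[OF projectionsD(1)[OF E'] S, symmetric]
          commute_mem[OF projectionsD(1)[OF F'] S, symmetric] fix_E[OF ranges(1)] fix_F[OF ranges(2)]
        by (rule refl bounded_clinear_zero[OF linS])+
      then show ?thesis
        by (simp add: rep_act_sum interleave_def evens_def odds_def proj_rep_def fun_eq_iff sum
            bounded_clinear_add[OF linS] lin)
    qed
    let ?U' = "\<lambda>f (i::nat). if i = 0 then E (f (0::nat)) else if i = 1 then F (f 0) else (0::'a)"
    show "?U' f \<in> rep_space ?\<rho>" for f by (simp add: space)
    show "?U' (?U f) = f" if "f \<in> rep_space ?\<rho>" for f
    proof
      have f: "f 0 \<in> range E" "f 1 \<in> range F" "\<And>i. i > 1 \<Longrightarrow> f i = 0" using that by (auto simp: space)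
      have "E (f 0 + f 1) = f 0" "F (f 0 + f 1) = f 1"
        unfolding lin fix_E[OF f(1)] fix_F[OF f(2)] by simp_all
      then show "?U' (?U f) i = f i" for i using f(3)[of i] by auto
    qed
    show "?U (?U' f) = f" if "f \<in> rep_space (proj_rep P)" for f
    proof
      show "?U (?U' f) i = f i" for i
        using that fix_P[of "f 0"] by (auto simp: rep_space_proj_rep)
    qed
  qed (simp_all add: fun_eq_iff scaleC_add_right)
  then have "rep_rel A `` {?\<rho>} = proj_class P"
    unfolding proj_class_def by (intro rep_class_eqI generated_reps.sum generated_reps.proj E F P)
  then show ?thesis
    unfolding proj_class_def by (simp add: rep_monoid_mult_class generated_reps.proj E F)
qed

text \<open>\<open>cproj K - cproj L\<close> meets the characterisation of the projection onto the
  remaining part; both parts are finite as subprojections of \<open>cproj K\<close>.\<close>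

lemma proj_class_orth_decomposition:
  assumes K: "affil K" "cproj K \<in> Proj0 A" and L: "affil L" "L \<subseteq> K"
  shows "proj_class (cproj K) =
    proj_class (cproj L) \<otimes>\<^bsub>rep_monoid A\<^esub> proj_class (cproj (K \<inter> orth_compl L))"
proof (rule proj_class_sum)
  let ?N = "K \<inter> orth_compl L"
  have N: "affil ?N" by (intro affil_Int affil_orth_compl K L)
  note K' = affil_closed_csubspace[OF K(1)] and L' = affil_closed_csubspace[OF L(1)]
    and N' = affil_closed_csubspace[OF N]
  show "cproj L \<in> Proj0 A" "cproj ?N \<in> Proj0 A"
    using cproj_Proj0_subset[OF K(2) K'] L N by blast+
  have "cproj ?N x = cproj K x - cproj L x" for x
  proof (rule cproj_eqI[OF N'])
    have "cproj L x \<in> K" using cproj_in[OF L'] L(2) by blast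
    moreover have "cproj K x - cproj L x \<in> orth_compl L"
    proof -
      have "x - cproj K x \<in> orth_compl L"
        using diff_cproj_in[OF K'] orth_compl_antimono[OF L(2)] by blast
      from closed_csubspace_diff[OF closed_csubspace_orth_compl diff_cproj_in[OF L', of x] this]
      show ?thesis by simp
    qed
    ultimately show "cproj K x - cproj L x \<in> ?N"
      using closed_csubspace_diff[OF K' cproj_in[OF K']] by blast
    have "x - cproj K x \<in> orth_compl ?N" using diff_cproj_in[OF K'] orth_compl_antimono[of ?N K] by blast
    moreover have "cproj L x \<in> orth_compl ?N"
      using cproj_in[OF L'] orth_compl_orth_compl[OF L'] orth_compl_antimono[of ?N "orth_compl L"] by blast
    ultimately have "(x - cproj K x) + cproj L x \<in> orth_compl ?N"
      by (rule closed_csubspace_add[OF closed_csubspace_orth_compl])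
    then show "x - (cproj K x - cproj L x) \<in> orth_compl ?N" by (simp add: algebra_simps)
  qed
  then show "cproj K x = cproj L x + cproj ?N x" for x by simp
  show "cproj L (cproj ?N x) = 0" for x using cproj_in[OF N'] by (simp add: cproj_eq_0_iff[OF L'])
  show "cproj ?N (cproj L x) = 0" for x
    unfolding cproj_eq_0_iff[OF N']
    using cproj_in[OF L'] orth_compl_orth_compl[OF L'] orth_compl_antimono[of ?N "orth_compl L"] by blast
qed (rule K)

lemma affil_INT: "(\<And>i. i \<in> I \<Longrightarrow> affil (L i)) \<Longrightarrow> affil (\<Inter>i\<in>I. L i)"
  by (simp add: affil_def closed_csubspace_INT)

lemma subspace_dim_eq_mult:
  assumes "cproj K \<in> Proj0 A" "cproj L \<in> Proj0 A" "cproj N \<in> Proj0 A" "k \<in> carrier (rep_monoid A)"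
    and "proj_class (cproj K) \<otimes>\<^bsub>rep_monoid A\<^esub> k =
      proj_class (cproj L) \<otimes>\<^bsub>rep_monoid A\<^esub> proj_class (cproj N) \<otimes>\<^bsub>rep_monoid A\<^esub> k"
  shows "subspace_dim A K = subspace_dim A L \<otimes>\<^bsub>index_group A\<^esub> subspace_dim A N"
  unfolding subspace_dim_def index_group_def proj_class_def[symmetric]
  by (rule comm_monoid.grothendieck_class_eq_mult[OF comm_monoid_rep_monoid _ _ _ _ assms(5)])
     (simp_all add: assms proj_class_carrier)

end

section \<open>Combining the classes of kernels and cokernels\<close>

theorem proposition4p11:
  fixes A :: "('a::chilbert_space \<Rightarrow> 'a) set" and T :: "'a \<Rightarrow> 'a"
  assumes "von_neumann_algebra A"
    and "properly_infinite A"
    and "fredholm A T"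
    and "\<And>n::nat. n \<ge> 1 \<Longrightarrow> closed (range (T ^^ n))"
    and "T ` (\<Inter>n\<in>{1::nat..}. range (T ^^ n)) = (\<Inter>n\<in>{1::nat..}. range (T ^^ n))"
  shows "cproj (ker T) \<in> Proj0 A \<and> cproj (orth_compl (range T)) \<in> Proj0 A \<and>
    (\<exists>\<epsilon>::real. \<epsilon> > 0 \<and> (\<exists>N1. closed_csubspace N1 \<and> cproj N1 \<in> Proj0 A \<and>
    (\<forall>\<mu>::complex. 0 < cmod \<mu> \<and> cmod \<mu> < \<epsilon> \<longrightarrow>
      cproj (ker (\<lambda>x. T x - \<mu> *\<^sub>C x)) \<in> Proj0 A \<and>
      cproj (orth_compl (range (\<lambda>x. T x - \<mu> *\<^sub>C x))) \<in> Proj0 A \<and>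
      subspace_dim A (ker T) =
        subspace_dim A (ker (\<lambda>x. T x - \<mu> *\<^sub>C x)) \<otimes>\<^bsub>index_group A\<^esub> subspace_dim A N1 \<and>
      subspace_dim A (orth_compl (range T)) =
        subspace_dim A (orth_compl (range (\<lambda>x. T x - \<mu> *\<^sub>C x)))
          \<otimes>\<^bsub>index_group A\<^esub> subspace_dim A N1)))"
proof -
  interpret vna A by unfold_locales (rule assms(1))
  interpret R: comm_monoid "rep_monoid A" by (rule comm_monoid_rep_monoid)
  obtain E where T: "T \<in> A" and finK: "cproj (ker T) \<in> Proj0 A"
    and E: "E \<in> Proj0 A" "range (\<lambda>x. x - E x) \<subseteq> range T"
    using assms(3) by (auto simp: fredholm_def)
  define K where "K = ker T"
  define C where "C = orth_compl (range T)"
  define M where "M = (\<Inter>n\<in>{1::nat..}. range (T ^^ n))"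
  \<comment> \<open>The subspace called \<open>N1\<close> in the conclusion; it is fixed before any
    \<mu> is chosen.\<close>
  define N where "N = K \<inter> orth_compl (K \<inter> M)"
  have closed: "closed (range T)" using assms(4)[of 1] by simp
  have K: "affil K" unfolding K_def by (rule affil_ker[OF T])
  have C: "affil C" unfolding C_def by (rule affil_orth_compl_range[OF T])
  have M: "affil M" unfolding M_def by (rule affil_INT) (simp add: affil_range mem_power T assms(4))
  have N: "affil N" unfolding N_def by (intro affil_Int affil_orth_compl K M)
  note K' = affil_closed_csubspace[OF K] and C' = affil_closed_csubspace[OF C]
  have TM: "T ` M = M" using assms(5) by (simp add: M_def)
  have finK: "cproj K \<in> Proj0 A" using finK by (simp add: K_def)
  \<comment> \<open>The Fredholm condition makes \<open>C\<close> orthogonal to the range of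
    \<open>1 - E\<close>, so \<open>E\<close> fixes \<open>C\<close>; hence the cokernel is
    finite.\<close>
  have "C \<subseteq> range E"
  proof
    fix x assume x: "x \<in> C"
    have "cinner y (E x) = cinner y x" for y
    proof -
      have "cinner (y - E y) x = 0"
        using x E(2) by (intro orth_complD[of x "range T"]) (auto simp: C_def)
      then show ?thesis
        by (simp add: cinner.diff_left projectionsD(4)[OF Proj0_projections[OF E(1)]])
    qed
    then have "E x = x" by (rule cinner_ext_right)
    then show "x \<in> range E" by (metis rangeI)
  qed
  then have finC: "cproj C \<in> Proj0 A"
    using Proj0_subset[OF E(1) cproj_projections[OF C]] by (simp add: range_cproj[OF C'])
  have finKM: "cproj (K \<inter> M) \<in> Proj0 A" by (rule cproj_Proj0_subset[OF finK K' affil_Int[OF K M]]) simp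
  have finN: "cproj N \<in> Proj0 A" by (rule cproj_Proj0_subset[OF finK K' N]) (simp add: N_def)
  \<comment> \<open>An eigenvector is the image under \<open>T ^^ n\<close> of its own multiple by
    the inverse of \<open>\<mu> ^ n\<close>.\<close>
  have eigen: "x \<in> M" if \<mu>: "\<mu> \<noteq> 0" and x: "T x = \<mu> *\<^sub>C x" for \<mu> x
  proof -
    have lin: "bounded_clinear (T ^^ n)" for n by (intro bounded_clinear_mem mem_power T)
    have "(T ^^ n) x = \<mu> ^ n *\<^sub>C x" for n
      by (induction n) (simp_all add: bounded_clinear_scaleC[OF bounded_clinear_mem[OF T]] x scaleC_scaleC mult.commute)
    then have "(T ^^ n) ((1 / \<mu> ^ n) *\<^sub>C x) = x" for n
      using \<mu> by (simp add: bounded_clinear_scaleC[OF lin] scaleC_scaleC)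
    then show ?thesis unfolding M_def by (metis INT_I rangeI)
  qed
  obtain \<epsilon>1 where \<epsilon>1: "\<epsilon>1 > 0"
    and pert1: "\<And>\<mu>. 0 < cmod \<mu> \<Longrightarrow> cmod \<mu> < \<epsilon>1 \<Longrightarrow> \<exists>D\<in>A. \<exists>D'. is_adjoint D' D \<and>
      orth_compl (ker D) \<subseteq> K \<and> closure (range D) \<subseteq> C \<and>
      mvn_equivalent A (cproj (K \<inter> ker D)) (cproj (ker (\<lambda>x. T x - \<mu> *\<^sub>C x))) \<and>
      mvn_equivalent A (cproj (C \<inter> ker D')) (cproj (orth_compl (range (\<lambda>x. T x - \<mu> *\<^sub>C x))))"
    by (rule closed_range_perturbation[OF T closed, folded K_def C_def]) (rule that, assumption, simp)
  obtain \<epsilon>2 where \<epsilon>2: "\<epsilon>2 > 0"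
    and pert2: "\<And>\<mu>. 0 < cmod \<mu> \<Longrightarrow> cmod \<mu> < \<epsilon>2 \<Longrightarrow>
      mvn_equivalent A (cproj (K \<inter> M)) (cproj (ker (\<lambda>x. T x - \<mu> *\<^sub>C x)))"
    by (rule ker_perturbation_invariant[OF T M TM, folded K_def], erule (1) eigen)
       (rule that, assumption, simp)
  have main: "cproj (ker (\<lambda>x. T x - \<mu> *\<^sub>C x)) \<in> Proj0 A \<and>
      cproj (orth_compl (range (\<lambda>x. T x - \<mu> *\<^sub>C x))) \<in> Proj0 A \<and>
      subspace_dim A K = subspace_dim A (ker (\<lambda>x. T x - \<mu> *\<^sub>C x)) \<otimes>\<^bsub>index_group A\<^esub> subspace_dim A N \<and>
      subspace_dim A C = subspace_dim A (orth_compl (range (\<lambda>x. T x - \<mu> *\<^sub>C x)))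
          \<otimes>\<^bsub>index_group A\<^esub> subspace_dim A N"
    if \<mu>: "0 < cmod \<mu>" "cmod \<mu> < min \<epsilon>1 \<epsilon>2" for \<mu>
  proof -
    define K1 where "K1 = ker (\<lambda>x. T x - \<mu> *\<^sub>C x)"
    define C1 where "C1 = orth_compl (range (\<lambda>x. T x - \<mu> *\<^sub>C x))"
    have K1: "affil K1" unfolding K1_def by (rule affil_ker[OF diff_scaleC_mem[OF T]])
    have C1: "affil C1" unfolding C1_def by (rule affil_orth_compl_range[OF diff_scaleC_mem[OF T]])
    obtain D D' where D: "D \<in> A" "is_adjoint D' D" "orth_compl (ker D) \<subseteq> K" "closure (range D) \<subseteq> C"
      "mvn_equivalent A (cproj (K \<inter> ker D)) (cproj K1)" "mvn_equivalent A (cproj (C \<inter> ker D')) (cproj C1)"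
      using pert1[of \<mu>] \<mu> unfolding K1_def C1_def by auto
    have KM_K1: "mvn_equivalent A (cproj (K \<inter> M)) (cproj K1)"
      using pert2[of \<mu>] \<mu> unfolding K1_def by auto
    define L where "L = orth_compl (ker D)"
    define L' where "L' = closure (range D)"
    have L: "affil L" unfolding L_def by (rule affil_orth_compl[OF affil_ker[OF D(1)]])
    have L': "affil L'" unfolding L'_def by (rule affil_closure_range[OF D(1)])
    have KL: "K \<inter> ker D = K \<inter> orth_compl L"
      unfolding L_def by (simp add: orth_compl_orth_compl closed_csubspace_ker bounded_clinear_mem[OF D(1)])
    have CL': "C \<inter> ker D' = C \<inter> orth_compl L'"
      unfolding L'_def by (simp add: orth_compl_closure orth_compl_range[OF D(2)])
    have fin_KL: "cproj (K \<inter> orth_compl L) \<in> Proj0 A"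
      by (rule cproj_Proj0_subset[OF finK K' affil_Int[OF K affil_orth_compl[OF L]]]) simp
    have fin_CL': "cproj (C \<inter> orth_compl L') \<in> Proj0 A"
      by (rule cproj_Proj0_subset[OF finC C' affil_Int[OF C affil_orth_compl[OF L']]]) simp
    have finL: "cproj L \<in> Proj0 A"
      by (rule cproj_Proj0_subset[OF finK K' L]) (simp add: L_def D(3))
    have finL': "cproj L' \<in> Proj0 A"
      by (rule cproj_Proj0_subset[OF finC C' L']) (simp add: L'_def D(4))
    \<comment> \<open>Finiteness of the perturbed kernel and cokernel is transported along
      equivalences with subprojections of \<open>cproj K\<close> and \<open>cproj C\<close>.\<close>
    have finK1: "cproj K1 \<in> Proj0 A"
      by (rule Proj0_mvn_equivalent[OF finKM cproj_projections[OF K1] KM_K1])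
    have finC1: "cproj C1 \<in> Proj0 A"
      by (rule Proj0_mvn_equivalent[OF fin_CL' cproj_projections[OF C1] D(6)[unfolded CL']])
    define a b a' b' r n where
      "a = proj_class (cproj K)" and "b = proj_class (cproj C)" and
      "a' = proj_class (cproj K1)" and "b' = proj_class (cproj C1)" and
      "r = proj_class (cproj L)" and "n = proj_class (cproj N)"
    have mem: "a \<in> carrier (rep_monoid A)" "b \<in> carrier (rep_monoid A)" "a' \<in> carrier (rep_monoid A)"
      "b' \<in> carrier (rep_monoid A)" "r \<in> carrier (rep_monoid A)" "n \<in> carrier (rep_monoid A)"
      unfolding a_def b_def a'_def b'_def r_def n_def
      by (intro proj_class_carrier finK finC finK1 finC1 finL finN)+
    \<comment> \<open>The class of \<open>K\<close> is decomposed twice: here along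
      \<open>K \<inter> M\<close>, and next along the support \<open>L\<close> of
      \<open>D\<close>.\<close>
    have a_n: "a = a' \<otimes>\<^bsub>rep_monoid A\<^esub> n"
      unfolding a_def a'_def n_def N_def proj_class_mvn_equivalent[OF finKM finK1 KM_K1, symmetric]
      by (rule proj_class_orth_decomposition[OF K finK affil_Int[OF K M]]) simp
    have a_r: "a = r \<otimes>\<^bsub>rep_monoid A\<^esub> a'"
      unfolding a_def a'_def r_def
        proj_class_mvn_equivalent[OF fin_KL finK1 D(5)[unfolded KL], symmetric]
      by (rule proj_class_orth_decomposition[OF K finK L]) (simp add: L_def D(3))
    \<comment> \<open>Polar decomposition of \<open>D\<close> identifies its support in
      \<open>K\<close> with the closure of its range in \<open>C\<close>; this is the link between
      kernel and cokernel.\<close>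
    have r: "r = proj_class (cproj L')"
      unfolding r_def using mvn_equivalent_polar[OF D(1)]
      by (intro proj_class_mvn_equivalent finL finL') (simp add: L_def L'_def)
    have b_r: "b = r \<otimes>\<^bsub>rep_monoid A\<^esub> b'"
      unfolding r b_def b'_def
        proj_class_mvn_equivalent[OF fin_CL' finC1 D(6)[unfolded CL'], symmetric]
      by (rule proj_class_orth_decomposition[OF C finC L']) (simp add: L'_def D(4))
    \<comment> \<open>Adding \<open>a'\<close> to the decomposition of \<open>b\<close> produces
      \<open>r + a' = a\<close>, which is then replaced by \<open>a' + n\<close>. The extra
      \<open>a'\<close> is the witness \<open>k\<close> absorbed in the index group.\<close>
    have "b \<otimes>\<^bsub>rep_monoid A\<^esub> a' = b' \<otimes>\<^bsub>rep_monoid A\<^esub> (r \<otimes>\<^bsub>rep_monoid A\<^esub> a')"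
      unfolding b_r using mem by (simp add: R.m_ac)
    also have "\<dots> = b' \<otimes>\<^bsub>rep_monoid A\<^esub> n \<otimes>\<^bsub>rep_monoid A\<^esub> a'"
      unfolding a_r[symmetric] a_n using mem by (simp add: R.m_ac)
    finally have "subspace_dim A C = subspace_dim A C1 \<otimes>\<^bsub>index_group A\<^esub> subspace_dim A N"
      unfolding a'_def b_def b'_def n_def
      by (intro subspace_dim_eq_mult[OF finC finC1 finN proj_class_carrier[OF finK1]])
    moreover have "subspace_dim A K = subspace_dim A K1 \<otimes>\<^bsub>index_group A\<^esub> subspace_dim A N"
      \<comment> \<open>The kernel equation already holds in the monoid, so the neutral element
        serves as the witness \<open>k\<close>.\<close>
      using a_n unfolding a_def a'_def n_def
      by (intro subspace_dim_eq_mult[OF finK finK1 finN R.one_closed]) simp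
    ultimately show ?thesis using finK1 finC1 by (simp add: K1_def C1_def)
  qed
  have "min \<epsilon>1 \<epsilon>2 > 0" using \<epsilon>1 \<epsilon>2 by simp
  then show ?thesis
    using finK finC finN main affil_closed_csubspace[OF N] unfolding K_def C_def by blast
qed

end
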